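(* Let $\hat{\mathbf{x}}\in\mathbb{R}^d$, $\hat{\sigma}>0$, and consider the stochastic process on $[0,T]$ started at $\mathbf{x}_0\in\mathbb{R}^d$ and governed by $$\mathrm{d}\mathbf{x}_t=\left[\theta_t(\boldsymbol{\mu}-\mathbf{x}_t)+g_t^2e^{-\bar{\theta}_{t:T}}\frac{\hat{\mathbf{x}}-\bar{\boldsymbol{\mu}}_{t:T}}{\hat{\sigma}^2+\bar{\sigma}_{t:T}^2}\right]\mathrm{d}t+g_t\,\mathrm{d}\mathbf{w}_t ,\qquad \bar{\boldsymbol{\mu}}_{t:T}=e^{-\bar{\theta}_{t:T}}\mathbf{x}_t+(1-e^{-\bar{\theta}_{t:T}})\boldsymbol{\mu}.$$ For $0<t\le T$, its time-$t$ marginal density under the $h$-transformed path measure is $$p_h(\mathbf{x}_t,t\mid\mathbf{x}_0,0)=\mathcal{N}\left(\mathbf{x}_t;\ \bar{\boldsymbol{\mu}}_{0:t}+\frac{e^{-\bar{\theta}_{t:T}}\bar{\sigma}_{0:t}^2}{\hat{\sigma}^2+\bar{\sigma}_{0:T}^2}\left(\hat{\mathbf{x}}-\bar{\boldsymbol{\mu}}_{0:T}\right),\ \frac{\bar{\sigma}_{0:t}^2(\hat{\sigma}^2+\bar{\sigma}_{t:T}^2)}{\hat{\sigma}^2+\bar{\sigma}_{0:T}^2}\,\mathbf{I}\right).$$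
   Context: $\mathcal{N}(\mathbf{x};\mathbf{m},s^2\mathbf{I})$ denotes the density at $\mathbf{x}\in\mathbb{R}^d$ of the Gaussian with mean $\mathbf{m}$ and covariance $s^2\mathbf{I}$; $\mathbf{w}$ is a standard $d$-dimensional Wiener process. Reference (generalized Ornstein–Uhlenbeck, GOU) process: $\mathrm{d}\mathbf{x}_t=\theta_t(\boldsymbol{\mu}-\mathbf{x}_t)\,\mathrm{d}t+g_t\,\mathrm{d}\mathbf{w}_t$ with $\boldsymbol{\mu}\in\mathbb{R}^d$ fixed and $\theta_t>0$, $g_t$ deterministic scalar coefficients (continuous in $t$). For $s<t$ its transition density is $p(\mathbf{x}_t,t\mid\mathbf{x}_s,s)=\mathcal{N}(\mathbf{x}_t;\bar{\boldsymbol{\mu}}_{s:t},\bar{\sigma}_{s:t}^2\mathbf{I})$ with $$\bar{\theta}_{s:t}=\int_s^t\theta_u\,\mathrm{d}u,\quad \bar{\boldsymbol{\mu}}_{s:t}=e^{-\bar{\theta}_{s:t}}\mathbf{x}_s+(1-e^{-\bar{\theta}_{s:t}})\boldsymbol{\mu},\quad \bar{\sigma}_{s:t}^2=\int_s^t e^{-2\bar{\theta}_{u:t}}g_u^2\,\mathrm{d}u ,$$ and $\bar{\sigma}_{0:t}^2>0$ for all $t\in(0,T]$. The displayed SDE is the Doob $h$-transform of the GOU process, with drift $\theta_t(\boldsymbol{\mu}-\mathbf{x}_t)+g_t^2\nabla_{\mathbf{x}_t}\log h(\mathbf{x}_t,t)$, where $h(\mathbf{x},t)=\int p(\mathbf{z},T\mid\mathbf{x},t)\,\mathcal{N}(\mathbf{z};\hat{\mathbf{x}},\hat{\sigma}^2\mathbf{I})\,\mathrm{d}\mathbf{z}$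 for $t<T$ and $h(\mathbf{x},T)=\mathcal{N}(\mathbf{x};\hat{\mathbf{x}},\hat{\sigma}^2\mathbf{I})$. The time-$t$ marginal density of the $h$-transformed path measure started at $\mathbf{x}_0$ is $p_h(\mathbf{x},t\mid\mathbf{x}_0,0)=p(\mathbf{x},t\mid\mathbf{x}_0,0)\,h(\mathbf{x},t)/h(\mathbf{x}_0,0)$. *)

theory Defs
  imports "HOL-Probability.Probability"
begin

text \<open>The third argument is the variance, i.e. the covariance is v times the identity; the
  formula is a density only for positive v.\<close>

definition gauss_density :: "'a::euclidean_space \<Rightarrow> real \<Rightarrow> 'a \<Rightarrow> real" where
  "gauss_density m v x =
     (2 * pi * v) powr (- real DIM('a) / 2) * exp (- (norm (x - m))\<^sup>2 / (2 * v))"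

definition wiener_process :: "'w measure \<Rightarrow> (real \<Rightarrow> 'w \<Rightarrow> 'a::euclidean_space) \<Rightarrow> bool" where
  "wiener_process M W \<longleftrightarrow>
     prob_space M \<and>
     (\<forall>t\<ge>0. W t \<in> borel_measurable M) \<and>
     (AE \<omega> in M. W 0 \<omega> = 0) \<and>
     (AE \<omega> in M. continuous_on {0..} (\<lambda>t. W t \<omega>)) \<and>
     (\<forall>s t. 0 \<le> s \<and> s < t \<longrightarrow>
        distributed M lborel (\<lambda>\<omega>. W t \<omega> - W s \<omega>) (gauss_density 0 (t - s))) \<and>
     (\<forall>(\<tau> :: nat \<Rightarrow> real) n. 0 \<le> \<tau> 0 \<and> (\<forall>i<n. \<tau> i \<le> \<tau> (Suc i)) \<longrightarrow>
        prob_space.indep_vars M (\<lambda>_. borel) (\<lambda>i \<omega>. W (\<tau> (Suc i)) \<omega> - W (\<tau> i) \<omega>) {..<n})"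

text \<open>I is (a version of) the stochastic integral of g with respect to W over the interval from
  a to b: the left-point Riemann sums converge to I in mean square as the mesh of the partition
  tends to 0.  For deterministic continuous g this is the Ito integral.\<close>

definition wiener_integral ::
  "'w measure \<Rightarrow> (real \<Rightarrow> 'w \<Rightarrow> 'a::euclidean_space) \<Rightarrow> (real \<Rightarrow> real) \<Rightarrow> real \<Rightarrow> real \<Rightarrow>
   ('w \<Rightarrow> 'a) \<Rightarrow> bool" where
  "wiener_integral M W g a b I \<longleftrightarrow>
     I \<in> borel_measurable M \<and>
     (\<forall>\<epsilon>>0. \<exists>\<delta>>0. \<forall>(\<tau> :: nat \<Rightarrow> real) n.
        \<tau> 0 = a \<and> \<tau> n = b \<and> (\<forall>i<n. \<tau> i \<le> \<tau> (Suc i) \<and> \<tau> (Suc i) - \<tau> i < \<delta>) \<longrightarrow>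
        (\<integral>\<^sup>+ \<omega>. ennreal ((norm ((\<Sum>i<n. g (\<tau> i) *\<^sub>R (W (\<tau> (Suc i)) \<omega> - W (\<tau> i) \<omega>)) - I \<omega>))\<^sup>2) \<partial>M)
          < ennreal \<epsilon>)"

text \<open>X solves dX = b(t, X) dt + g(t) dW on the time interval from 0 to T with X(0) = x0.
  As g does not depend on X, the stochastic integral makes sense without mentioning a filtration,
  and no adaptedness of X is required.\<close>

definition sde_solution ::
  "'w measure \<Rightarrow> (real \<Rightarrow> 'w \<Rightarrow> 'a::euclidean_space) \<Rightarrow> real \<Rightarrow> 'a \<Rightarrow> (real \<Rightarrow> 'a \<Rightarrow> 'a) \<Rightarrow>
   (real \<Rightarrow> real) \<Rightarrow> (real \<Rightarrow> 'w \<Rightarrow> 'a) \<Rightarrow> bool" where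
  "sde_solution M W T x0 b g X \<longleftrightarrow>
     (\<forall>t\<in>{0..T}. X t \<in> borel_measurable M) \<and>
     (AE \<omega> in M. continuous_on {0..T} (\<lambda>t. X t \<omega>)) \<and>
     (\<forall>t\<in>{0..T}. \<exists>I. wiener_integral M W g 0 t I \<and>
        (AE \<omega> in M. ((\<lambda>s. b s (X s \<omega>)) has_integral (X t \<omega> - x0 - I \<omega>)) {0..t}))"

definition theta_bar :: "(real \<Rightarrow> real) \<Rightarrow> real \<Rightarrow> real \<Rightarrow> real" where
  "theta_bar \<theta> s t = integral {s..t} \<theta>"

definition mu_bar ::
  "(real \<Rightarrow> real) \<Rightarrow> 'a::euclidean_space \<Rightarrow> real \<Rightarrow> real \<Rightarrow> 'a \<Rightarrow> 'a" where
  "mu_bar \<theta> \<mu> s t x =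
     exp (- theta_bar \<theta> s t) *\<^sub>R x + (1 - exp (- theta_bar \<theta> s t)) *\<^sub>R \<mu>"

text \<open>The variance, i.e. the square of sigma-bar.\<close>

definition var_bar :: "(real \<Rightarrow> real) \<Rightarrow> (real \<Rightarrow> real) \<Rightarrow> real \<Rightarrow> real \<Rightarrow> real" where
  "var_bar \<theta> g s t = integral {s..t} (\<lambda>u. exp (- 2 * theta_bar \<theta> u t) * (g u)\<^sup>2)"

definition gou_drift ::
  "(real \<Rightarrow> real) \<Rightarrow> 'a::euclidean_space \<Rightarrow> real \<Rightarrow> 'a \<Rightarrow> 'a" where
  "gou_drift \<theta> \<mu> t x = \<theta> t *\<^sub>R (\<mu> - x)"

text \<open>Transition density from the point x at time s to the point z at time t.\<close>

definition gou_density ::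
  "(real \<Rightarrow> real) \<Rightarrow> (real \<Rightarrow> real) \<Rightarrow> 'a::euclidean_space \<Rightarrow> real \<Rightarrow> 'a \<Rightarrow> real \<Rightarrow> 'a \<Rightarrow> real" where
  "gou_density \<theta> g \<mu> s x t z = gauss_density (mu_bar \<theta> \<mu> s t x) (var_bar \<theta> g s t) z"

text \<open>The corresponding transition law.  If g vanishes between s and t, the Gaussian degenerates
  to a point mass and has no density; this can happen for s > 0 even though the variance from
  time 0 is positive.\<close>

definition gou_law ::
  "(real \<Rightarrow> real) \<Rightarrow> (real \<Rightarrow> real) \<Rightarrow> 'a::euclidean_space \<Rightarrow> real \<Rightarrow> 'a \<Rightarrow> real \<Rightarrow> 'a measure" where
  "gou_law \<theta> g \<mu> s x t =
     (if var_bar \<theta> g s t = 0 then return borel (mu_bar \<theta> \<mu> s t x)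
      else density lborel (gou_density \<theta> g \<mu> s x t))"

definition h_fun ::
  "(real \<Rightarrow> real) \<Rightarrow> (real \<Rightarrow> real) \<Rightarrow> 'a::euclidean_space \<Rightarrow> real \<Rightarrow> 'a \<Rightarrow> real \<Rightarrow> 'a \<Rightarrow> real \<Rightarrow> real"
  where
  "h_fun \<theta> g \<mu> T xh \<sigma>h x t =
     (if t < T then (\<integral>z. gauss_density xh (\<sigma>h\<^sup>2) z \<partial>gou_law \<theta> g \<mu> t x T)
      else gauss_density xh (\<sigma>h\<^sup>2) x)"

lemma gauss_density_nonneg: "0 \<le> gauss_density m v x"
  by (simp add: gauss_density_def)

lemma borel_measurable_gauss_density [measurable]: "gauss_density m v \<in> borel_measurable borel"
  unfolding gauss_density_def by measurable

lemma h_fun_eq_density_integral: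
  assumes "t < T" "var_bar \<theta> g t T \<noteq> 0"
  shows "h_fun \<theta> g \<mu> T xh \<sigma>h x t =
    (\<integral>z. gou_density \<theta> g \<mu> t x T z * gauss_density xh (\<sigma>h\<^sup>2) z \<partial>lborel)"
  using assms unfolding h_fun_def gou_law_def gou_density_def
  by (simp add: integral_density gauss_density_nonneg)

definition p_h ::
  "(real \<Rightarrow> real) \<Rightarrow> (real \<Rightarrow> real) \<Rightarrow> 'a::euclidean_space \<Rightarrow> real \<Rightarrow> 'a \<Rightarrow> real \<Rightarrow> 'a \<Rightarrow> real \<Rightarrow> 'a \<Rightarrow> real"
  where
  "p_h \<theta> g \<mu> T xh \<sigma>h x0 t x =
     gou_density \<theta> g \<mu> 0 x0 t x * h_fun \<theta> g \<mu> T xh \<sigma>h x t / h_fun \<theta> g \<mu> T xh \<sigma>h x0 0"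

text \<open>The h-transform of the underlying probability measure M, where Y is the reference process
  on M started at x0.  The h-transformed path measure is the law of Y under this measure.\<close>

definition h_transform ::
  "(real \<Rightarrow> real) \<Rightarrow> (real \<Rightarrow> real) \<Rightarrow> 'a::euclidean_space \<Rightarrow> real \<Rightarrow> 'a \<Rightarrow> real \<Rightarrow> 'a \<Rightarrow>
   'w measure \<Rightarrow> (real \<Rightarrow> 'w \<Rightarrow> 'a) \<Rightarrow> 'w measure" where
  "h_transform \<theta> g \<mu> T xh \<sigma>h x0 M Y =
     density M (\<lambda>\<omega>. ennreal (h_fun \<theta> g \<mu> T xh \<sigma>h (Y T \<omega>) T / h_fun \<theta> g \<mu> T xh \<sigma>h x0 0))"

definition bridge_drift ::
  "(real \<Rightarrow> real) \<Rightarrow> (real \<Rightarrow> real) \<Rightarrow> 'a::euclidean_space \<Rightarrow> real \<Rightarrow> 'a \<Rightarrow> real \<Rightarrow> real \<Rightarrow> 'a \<Rightarrow> 'a" where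
  "bridge_drift \<theta> g \<mu> T xh \<sigma>h t x =
     \<theta> t *\<^sub>R (\<mu> - x) +
     ((g t)\<^sup>2 * exp (- theta_bar \<theta> t T) / (\<sigma>h\<^sup>2 + var_bar \<theta> g t T)) *\<^sub>R (xh - mu_bar \<theta> \<mu> t T x)"

end

theory Submission
  imports Defs
begin

text \<open>Both processes solve a linear equation dX = (a X + c) dt + g dW.  With the integrating factor
  \<psi>, where \<psi>' = - a \<psi>, and the mean m, where m' = a m + c, the process \<psi> (X - m) is the
  Wiener integral of \<psi> g.  Pathwise it is the limit of the sums of \<psi> times the increments of
  the integral of g, each of which is close in mean to a finite sum of Wiener increments over a finer
  partition.  Those sums are Gaussian and independent on disjoint time intervals, and both
  properties pass to the limit.  The density \<open>p_h\<close> is then identified by completing the square,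
  and for the h-transformed measure one integrates the terminal weight against the law of the
  noise after time t, which is independent of the state at time t.\<close>

section \<open>Gaussian laws\<close>

text \<open>\<open>sde_solution\<close> supplies a separate version of the Wiener integral for each
  time, and an equation that holds outside a null set depending on that time. Only countably many
  times can therefore be used together, and there is no process of integrals to which a product rule
  could be applied. Continuity of the paths of X takes its place: summation by parts moves the
  irregular increments onto the smooth factor \<open>\<psi>\<close>. Independence is carried as the
  product form of the law of a pair, because a law can be identified in the limit by Lipschitz test
  functions, and these tolerate both almost sure convergence and closeness in mean. Every Gaussian
  is an image of one standard Gaussian scaled by the root of its variance, so convergence of
  variances becomes pointwise convergence of maps; variance 0 is included, which occurs on empty
  intervals and wherever g vanishes. For the bridge, the variance
  \<open>D s = \<sigma>h\<^sup>2 + var_bar \<theta> g s T\<close> of the Gaussian h governs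
  everything: the h-term of the drift adds D'/D to the linear coefficient \<open>- \<theta>\<close>,
  which makes the integrating factor explicit and gives the variance integral a multiple of 1/D as
  antiderivative.\<close>

lemma gauss_density_eq_prod_normal_density:
  fixes m x :: "'a::euclidean_space"
  assumes "0 < v"
  shows "gauss_density m v x = (\<Prod>b\<in>Basis. normal_density (m \<bullet> b) (sqrt v) (x \<bullet> b))"
proof -
  have sq: "(norm (x - m))\<^sup>2 = (\<Sum>b\<in>Basis. (x \<bullet> b - m \<bullet> b)\<^sup>2)"
    unfolding power2_norm_eq_inner
    by (subst euclidean_inner) (simp add: inner_diff_left power2_eq_square)
  have "(\<Prod>b\<in>(Basis::'a set). normal_density (m \<bullet> b) (sqrt v) (x \<bullet> b))
      = (1 / sqrt (2 * pi * v)) ^ DIM('a) * exp (- (norm (x - m))\<^sup>2 / (2 * v))"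
    using assms
    by (simp add: normal_density_def prod.distrib prod_dividef power_divide exp_sum[symmetric] sq sum_divide_distrib sum_negf)
  also have "1 / sqrt (2 * pi * v) = (2 * pi * v) powr (- 1 / 2)"
    using assms powr_minus_divide[of "2 * pi * v" "1 / 2"] by (simp add: powr_half_sqrt)
  also have "((2 * pi * v) powr (- 1 / 2)) ^ DIM('a) = (2 * pi * v) powr (- real DIM('a) / 2)"
    using assms powr_power[of "2 * pi * v" "- 1 / 2" "DIM('a)"] by simp
  finally show ?thesis
    by (simp add: gauss_density_def)
qed

lemma nn_integral_gauss_density:
  assumes "0 < v"
  shows "(\<integral>\<^sup>+x. gauss_density m v x \<partial>lborel) = 1"
proof -
  have "(\<integral>\<^sup>+x. normal_density a (sqrt v) x \<partial>lborel) = 1" for a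
    using assms by (subst nn_integral_eq_integral) auto
  then show ?thesis
    using assms
    by (simp add: gauss_density_eq_prod_normal_density prod_ennreal[symmetric],
        subst nn_integral_lborel_prod) simp_all
qed

lemma gauss_density_pos: "0 < v \<Longrightarrow> 0 < gauss_density m v x"
  by (simp add: gauss_density_def)

lemma gauss_density_commute: "gauss_density m v x = gauss_density x v m"
  by (simp add: gauss_density_def norm_minus_commute)

text \<open>The factor \<open>\<bar>c\<bar> ^ DIM('a)\<close> is the Jacobian of the affine map,
  placed so that it cancels the one produced by \<open>lborel_affine\<close>.\<close>

lemma gauss_density_affine:
  fixes m x b :: "'a::euclidean_space"
  assumes "0 < v" "c \<noteq> 0"
  shows "gauss_density (b + c *\<^sub>R m) (c\<^sup>2 * v) (b + c *\<^sub>R x) * \<bar>c\<bar> ^ DIM('a) = gauss_density m v x"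
proof -
  have "(2 * pi * (c\<^sup>2 * v)) powr (- real DIM('a) / 2) * \<bar>c\<bar> ^ DIM('a)
      = (2 * pi * v) powr (- real DIM('a) / 2)"
  proof -
    have "(c\<^sup>2) powr (- real DIM('a) / 2) = \<bar>c\<bar> powr (- real DIM('a))"
      using powr_powr[of "\<bar>c\<bar>" 2 "- real DIM('a) / 2"] assms by (simp add: powr_numeral)
    moreover have "\<bar>c\<bar> powr (- real DIM('a)) * \<bar>c\<bar> ^ DIM('a) = 1"
      using assms by (simp add: powr_realpow[symmetric] powr_add[symmetric])
    moreover have "(2 * pi * (c\<^sup>2 * v)) powr (- real DIM('a) / 2)
       = (2 * pi * v) powr (- real DIM('a) / 2) * (c\<^sup>2) powr (- real DIM('a) / 2)"
      using assms powr_mult[of "2 * pi * v" "c\<^sup>2"] by (simp add: mult_ac)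
    ultimately show ?thesis by simp
  qed
  moreover have "(b + c *\<^sub>R x) - (b + c *\<^sub>R m) = c *\<^sub>R (x - m)"
    by (simp add: algebra_simps)
  ultimately show ?thesis
    using assms by (simp add: gauss_density_def power_mult_distrib)
qed

lemma distr_density_gauss_affine:
  fixes m b :: "'a::euclidean_space"
  assumes "0 < v" "c \<noteq> 0"
  shows "distr (density lborel (gauss_density m v)) borel (\<lambda>x. b + c *\<^sub>R x)
    = density lborel (gauss_density (b + c *\<^sub>R m) (c\<^sup>2 * v))"
proof (rule measure_eqI)
  fix S assume "S \<in> sets (distr (density lborel (gauss_density m v)) borel (\<lambda>x. b + c *\<^sub>R x))"
  then have [measurable]: "S \<in> sets borel" by simp
  let ?q = "gauss_density (b + c *\<^sub>R m) (c\<^sup>2 * v)"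
  have "emeasure (density lborel ?q) S = (\<integral>\<^sup>+y. ennreal (?q y) * indicator S y \<partial>lborel)"
    by (simp add: emeasure_density)
  also have "\<dots> = (\<integral>\<^sup>+x. \<bar>c\<bar> ^ DIM('a) * (ennreal (?q (b + c *\<^sub>R x)) * indicator S (b + c *\<^sub>R x)) \<partial>lborel)"
    using assms
    by (subst lborel_affine[of c b]) (simp_all add: nn_integral_density nn_integral_distr ennreal_power)
  also have "\<dots> = (\<integral>\<^sup>+x. ennreal (gauss_density m v x) * indicator S (b + c *\<^sub>R x) \<partial>lborel)"
    using assms
    by (simp add: gauss_density_affine[OF assms, of b, symmetric] ennreal_mult gauss_density_nonneg mult_ac)
  also have "\<dots> = emeasure (distr (density lborel (gauss_density m v)) borel (\<lambda>x. b + c *\<^sub>R x)) S"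
    by (simp add: nn_integral_indicator[symmetric] nn_integral_distr nn_integral_density del: nn_integral_indicator)
  finally show "emeasure (distr (density lborel (gauss_density m v)) borel (\<lambda>x. b + c *\<^sub>R x)) S
    = emeasure (density lborel ?q) S" ..
qed simp

text \<open>Completing the square, read as Bayes' rule: for x with law N(m, v) and y given x with
  law N(\<kappa> x + b, s), the joint density also factors into the marginal of y, of variance r,
  and the posterior of x given y. Integrating out x yields convolutions of Gaussians; keeping the
  posterior yields the closed form of \<open>p_h\<close>.\<close>

lemma gauss_density_mult:
  fixes m x b y :: "'a::euclidean_space" and \<kappa> :: real
  assumes "0 < v" "0 < s"
  defines "r \<equiv> s + \<kappa>\<^sup>2 * v"
  shows "gauss_density m v x * gauss_density (\<kappa> *\<^sub>R x + b) s y
    = gauss_density (\<kappa> *\<^sub>R m + b) r y *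
      gauss_density (m + (\<kappa> * v / r) *\<^sub>R (y - (\<kappa> *\<^sub>R m + b))) (v * s / r) x"
proof -
  have r: "0 < r" unfolding r_def using assms by (simp add: add_pos_nonneg)
  define u w where "u = x - m" and "w = y - (\<kappa> *\<^sub>R m + b)"
  have e: "y - (\<kappa> *\<^sub>R x + b) = w - \<kappa> *\<^sub>R u" "x - (m + (\<kappa> * v / r) *\<^sub>R w) = u - (\<kappa> * v / r) *\<^sub>R w"
    by (simp_all add: u_def w_def algebra_simps)
  have n: "(norm (w - \<kappa> *\<^sub>R u))\<^sup>2 = w \<bullet> w - 2 * \<kappa> * (u \<bullet> w) + \<kappa>\<^sup>2 * (u \<bullet> u)"
    "(norm (u - (\<kappa> * v / r) *\<^sub>R w))\<^sup>2 = u \<bullet> u - 2 * (\<kappa> * v / r) * (u \<bullet> w) + (\<kappa> * v / r)\<^sup>2 * (w \<bullet> w)"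
    unfolding power2_norm_eq_inner
    by (simp_all add: inner_diff_left inner_diff_right inner_commute power2_eq_square algebra_simps)
  \<comment> \<open>Both sides are quadratic forms in u and w, and the coefficients are compared one
    by one. The two identities needed, \<open>1 / r + \<kappa>\<^sup>2 * v / (r * s) = 1 / s\<close>
    and \<open>r / (v * s) = 1 / v + \<kappa>\<^sup>2 / s\<close>, both restate
    \<open>r = s + \<kappa>\<^sup>2 * v\<close>.\<close>
  have "(u \<bullet> u) / v + (w \<bullet> w - 2 * \<kappa> * (u \<bullet> w) + \<kappa>\<^sup>2 * (u \<bullet> u)) / s
     = (w \<bullet> w) / r + (u \<bullet> u - 2 * (\<kappa> * v / r) * (u \<bullet> w) + (\<kappa> * v / r)\<^sup>2 * (w \<bullet> w)) / (v * s / r)" (is "?l = ?R")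
  proof -
    have "?R = (w \<bullet> w) * (1 / r + \<kappa>\<^sup>2 * v / (r * s)) - 2 * \<kappa> / s * (u \<bullet> w) + (u \<bullet> u) * (r / (v * s))"
      using assms(1,2) r by (simp add: field_simps power2_eq_square)
    also have "1 / r + \<kappa>\<^sup>2 * v / (r * s) = 1 / s"
      using assms(1,2) r by (simp add: field_simps) (simp add: r_def algebra_simps)
    also have "r / (v * s) = 1 / v + \<kappa>\<^sup>2 / s"
      using assms(1,2) by (simp add: r_def field_simps)
    finally show ?thesis by (simp add: field_simps diff_divide_distrib add_divide_distrib)
  qed
  moreover have "- p / (2 * v) + - q / (2 * s) = - p' / (2 * r) + - q' / (2 * (v * s / r))"
    if "p / v + q / s = p' / r + q' / (v * s / r)" for p q p' q' :: real
  proof -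
    have "- x / (2 * y) = (x / y) * (- 1 / 2)" for x y :: real by simp
    then show ?thesis
      by (simp only: distrib_right[symmetric] that)
  qed
  ultimately have ex: "- (norm u)\<^sup>2 / (2 * v) + - (norm (w - \<kappa> *\<^sub>R u))\<^sup>2 / (2 * s)
      = - (norm w)\<^sup>2 / (2 * r) + - (norm (u - (\<kappa> * v / r) *\<^sub>R w))\<^sup>2 / (2 * (v * s / r))"
    unfolding n power2_norm_eq_inner[of u] power2_norm_eq_inner[of w] by blast
  \<comment> \<open>The normalising constants agree because v s is, per coordinate, the determinant
    of the joint covariance, whichever way it is factored.\<close>
  have pw: "(2 * pi * v) powr p * (2 * pi * s) powr p = (2 * pi * r) powr p * (2 * pi * (v * s / r)) powr p" for p
  proof -
    have "(2 * pi * v) powr p * (2 * pi * s) powr p = ((2 * pi * v) * (2 * pi * s)) powr p"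
      by (rule powr_mult[symmetric])
    also have "(2 * pi * v) * (2 * pi * s) = (2 * pi * r) * (2 * pi * (v * s / r))"
      using r by (simp add: field_simps)
    also have "\<dots> powr p = (2 * pi * r) powr p * (2 * pi * (v * s / r)) powr p"
      by (rule powr_mult)
    finally show ?thesis .
  qed
  have "gauss_density m v x * gauss_density (\<kappa> *\<^sub>R x + b) s y
     = ((2 * pi * v) powr (- real DIM('a) / 2) * (2 * pi * s) powr (- real DIM('a) / 2)) *
       exp (- (norm u)\<^sup>2 / (2 * v) + - (norm (w - \<kappa> *\<^sub>R u))\<^sup>2 / (2 * s))"
    unfolding gauss_density_def e exp_add by (simp add: u_def)
  also have "\<dots> = gauss_density (\<kappa> *\<^sub>R m + b) r y *
      gauss_density (m + (\<kappa> * v / r) *\<^sub>R w) (v * s / r) x"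
    unfolding pw ex unfolding gauss_density_def e exp_add by (simp add: w_def)
  finally show ?thesis by (simp add: w_def)
qed

text \<open>A push-forward of the standard Gaussian, so that v = 0 gives a point mass.\<close>

definition gauss_law :: "'a::euclidean_space \<Rightarrow> real \<Rightarrow> 'a measure" where
  "gauss_law m v = distr (density lborel (gauss_density 0 1)) borel (\<lambda>z. m + sqrt v *\<^sub>R z)"

lemma sets_gauss_law [simp, measurable_cong]: "sets (gauss_law m v) = sets borel"
  by (simp add: gauss_law_def)

lemma space_gauss_law [simp]: "space (gauss_law m v) = UNIV"
  by (simp add: gauss_law_def)

lemma prob_space_density_gauss:
  "0 < v \<Longrightarrow> prob_space (density lborel (gauss_density m v))"
  by (rule prob_spaceI) (simp add: emeasure_density nn_integral_gauss_density)

lemma prob_space_gauss_law: "prob_space (gauss_law m v)"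
  unfolding gauss_law_def
  by (intro prob_space.prob_space_distr prob_space_density_gauss) simp_all

lemma gauss_law_eq_density:
  "0 < v \<Longrightarrow> gauss_law m v = density lborel (gauss_density m v)"
  unfolding gauss_law_def using distr_density_gauss_affine[of 1 "sqrt v" 0 m] by simp

lemma (in prob_space) distr_const_return:
  assumes "c \<in> space N" shows "distr M N (\<lambda>x. c) = return N c"
  using assms by (intro measure_eqI) (auto simp: emeasure_distr emeasure_space_1 indicator_def)

lemma gauss_law_0: "gauss_law m 0 = return borel m"
  unfolding gauss_law_def
  by (simp add: prob_space.distr_const_return[OF prob_space_density_gauss])

text \<open>If c = 0 or v = 0 the image is a point mass and densities cannot be transformed, hence
  the case distinction.\<close>

lemma distr_gauss_law_affine:
  fixes m b :: "'a::euclidean_space"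
  assumes "0 \<le> v"
  shows "distr (gauss_law m v) borel (\<lambda>x. b + c *\<^sub>R x) = gauss_law (b + c *\<^sub>R m) (c\<^sup>2 * v)"
proof -
  interpret prob_space "gauss_law m v" by (rule prob_space_gauss_law)
  consider "c = 0" | "v = 0" | "0 < v" "c \<noteq> 0" using assms by fastforce
  then show ?thesis
  proof cases
    case 1
    then show ?thesis by (simp add: gauss_law_0 distr_const_return)
  next
    case 2
    then show ?thesis by (simp add: gauss_law_0 distr_return)
  next
    case 3
    then show ?thesis by (simp add: gauss_law_eq_density distr_density_gauss_affine)
  qed
qed

text \<open>After the Bayes factorisation the marginal factor is constant in x and the posterior
  factor has mass 1. For v = 0 the integral is an evaluation at m.\<close>

lemma nn_integral_gauss_density_gauss_law:
  fixes m b y :: "'a::euclidean_space"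
  assumes "0 \<le> v" "0 < s"
  shows "(\<integral>\<^sup>+x. gauss_density (\<kappa> *\<^sub>R x + b) s y \<partial>gauss_law m v)
    = gauss_density (\<kappa> *\<^sub>R m + b) (s + \<kappa>\<^sup>2 * v) y"
proof -
  have meas [measurable]: "(\<lambda>x. gauss_density (\<kappa> *\<^sub>R x + b) s y) \<in> borel_measurable borel"
    unfolding gauss_density_def by measurable
  show ?thesis
  proof (cases "v = 0")
    case True
    then show ?thesis by (simp add: gauss_law_0 nn_integral_return)
  next
    case False
    then have v: "0 < v" using assms by simp
    define r where "r = s + \<kappa>\<^sup>2 * v"
    have r: "0 < r" unfolding r_def using assms by (simp add: add_pos_nonneg)
    have "(\<integral>\<^sup>+x. gauss_density (\<kappa> *\<^sub>R x + b) s y \<partial>gauss_law m v)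
        = (\<integral>\<^sup>+x. ennreal (gauss_density m v x * gauss_density (\<kappa> *\<^sub>R x + b) s y) \<partial>lborel)"
      using v by (simp add: gauss_law_eq_density nn_integral_density ennreal_mult gauss_density_nonneg)
    also have "\<dots> = (\<integral>\<^sup>+x. ennreal (gauss_density (\<kappa> *\<^sub>R m + b) r y) *
       ennreal (gauss_density (m + (\<kappa> * v / r) *\<^sub>R (y - (\<kappa> *\<^sub>R m + b))) (v * s / r) x) \<partial>lborel)"
      by (simp add: gauss_density_mult[OF v assms(2)] r_def ennreal_mult gauss_density_nonneg)
    also have "\<dots> = gauss_density (\<kappa> *\<^sub>R m + b) r y"
      using v assms r by (simp add: nn_integral_cmult nn_integral_gauss_density)
    finally show ?thesis by (simp add: r_def)
  qed
qed

text \<open>A Gaussian density is symmetric in point and mean, so integrating over the point is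
  integrating over the mean. This is the integral that defines h, in Bochner form.\<close>

lemma integral_gauss_density_gauss_law:
  fixes m y :: "'a::euclidean_space"
  assumes "0 \<le> v" "0 < s"
  shows "(\<integral>x. gauss_density y s x \<partial>gauss_law m v) = gauss_density m (s + v) y"
proof -
  have "(\<integral>\<^sup>+x. gauss_density y s x \<partial>gauss_law m v) = gauss_density m (s + v) y"
    using nn_integral_gauss_density_gauss_law[OF assms, where \<kappa>=1 and b=0 and y=y and m=m]
    by (simp add: gauss_density_commute[of y])
  then show ?thesis
    by (subst integral_eq_nn_integral) (auto simp: gauss_density_nonneg)
qed

text \<open>Given the first summand x, the sum has law \<open>gauss_law (x + m') v'\<close>, so the
  law of the sum is a mixture over Gaussian means. The mixture is computed through densities when v'
  is positive, and is a mere translation when v' = 0.\<close>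

lemma distr_add_gauss_law:
  fixes m m' :: "'a::euclidean_space"
  assumes "0 \<le> v" "0 \<le> v'"
  shows "distr (gauss_law m v \<Otimes>\<^sub>M gauss_law m' v') borel (\<lambda>(x, y). x + y) = gauss_law (m + m') (v + v')"
    (is "?L = _")
proof (rule measure_eqI)
  interpret A: prob_space "gauss_law m v" by (rule prob_space_gauss_law)
  interpret B: prob_space "gauss_law m' v'" by (rule prob_space_gauss_law)
  interpret AL: pair_sigma_finite "gauss_law m v" lborel ..
  fix S assume "S \<in> sets ?L"
  then have [measurable]: "S \<in> sets borel" by simp
  have "emeasure ?L S = (\<integral>\<^sup>+z. indicator S (fst z + snd z) \<partial>(gauss_law m v \<Otimes>\<^sub>M gauss_law m' v'))"
    by (simp add: nn_integral_indicator[symmetric] nn_integral_distr case_prod_beta del: nn_integral_indicator)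
  also have "\<dots> = (\<integral>\<^sup>+x. \<integral>\<^sup>+y. indicator S (x + y) \<partial>gauss_law m' v' \<partial>gauss_law m v)"
    by (subst B.nn_integral_fst[symmetric]) simp_all
  also have "\<dots> = (\<integral>\<^sup>+x. emeasure (gauss_law (x + m') v') S \<partial>gauss_law m v)"
  proof (rule nn_integral_cong)
    fix x
    have "gauss_law (x + m') v' = distr (gauss_law m' v') borel (\<lambda>y. x + 1 *\<^sub>R y)"
      using distr_gauss_law_affine[OF assms(2), of m' x 1] by simp
    then show "(\<integral>\<^sup>+y. indicator S (x + y) \<partial>gauss_law m' v') = emeasure (gauss_law (x + m') v') S"
      by (simp add: nn_integral_indicator[symmetric] nn_integral_distr del: nn_integral_indicator)
  qed
  also have "\<dots> = emeasure (gauss_law (m + m') (v + v')) S"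
  proof (cases "v' = 0")
    case True
    have "gauss_law (m' + m) v = distr (gauss_law m v) borel (\<lambda>x. m' + 1 *\<^sub>R x)"
      using distr_gauss_law_affine[OF assms(1), of m m' 1] by simp
    then show ?thesis using True
      by (simp add: gauss_law_0 nn_integral_indicator[symmetric] nn_integral_distr nn_integral_return
          add.commute del: nn_integral_indicator)
  next
    case False
    then have v': "0 < v'" using assms by simp
    have [measurable]: "(\<lambda>p. gauss_density (fst p + m') v' (snd p)) \<in> borel_measurable (gauss_law m v \<Otimes>\<^sub>M lborel)"
      unfolding gauss_density_def by measurable
    have "(\<integral>\<^sup>+x. emeasure (gauss_law (x + m') v') S \<partial>gauss_law m v)
       = (\<integral>\<^sup>+x. \<integral>\<^sup>+w. ennreal (gauss_density (x + m') v' w) * indicator S w \<partial>lborel \<partial>gauss_law m v)"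
      using v' by (simp add: gauss_law_eq_density[of v'] emeasure_density)
    also have "\<dots> = (\<integral>\<^sup>+w. \<integral>\<^sup>+x. ennreal (gauss_density (x + m') v' w) * indicator S w \<partial>gauss_law m v \<partial>lborel)"
      \<comment> \<open>Exchanging the integrals puts the average over the mean x inside, where it
        is the mixture integral already computed.\<close>
      by (rule AL.Fubini'[symmetric]) (simp add: case_prod_beta)
    also have "\<dots> = (\<integral>\<^sup>+w. ennreal (gauss_density (m + m') (v + v') w) * indicator S w \<partial>lborel)"
    proof (rule nn_integral_cong)
      fix w
      have [measurable]: "(\<lambda>x. gauss_density (x + m') v' w) \<in> borel_measurable (gauss_law m v)"
        unfolding gauss_density_def by measurable
      show "(\<integral>\<^sup>+x. ennreal (gauss_density (x + m') v' w) * indicator S w \<partial>gauss_law m v)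
         = ennreal (gauss_density (m + m') (v + v') w) * indicator S w"
        using nn_integral_gauss_density_gauss_law[OF assms(1) v', where \<kappa>=1 and b=m' and y=w and m=m]
        by (simp add: nn_integral_multc add.commute)
    qed
    also have "\<dots> = emeasure (gauss_law (m + m') (v + v')) S"
      using v' assms by (simp add: gauss_law_eq_density emeasure_density)
    finally show ?thesis .
  qed
  finally show "emeasure ?L S = emeasure (gauss_law (m + m') (v + v')) S" .
qed simp

section \<open>Limits of laws and sums of Wiener increments\<close>

text \<open>The indicator of a closed set C is the pointwise limit of the Lipschitz functions
  \<open>max 0 (1 - real k * infdist x C)\<close>, so tests against these determine the measure of
  C; closed sets are stable under intersection and generate the Borel sets. Lipschitz tests are
  chosen because they turn a small mean distance into a small difference of expectations.\<close>

lemma measure_eqI_lipschitz: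
  fixes P Q :: "'b::metric_space measure"
  assumes sets: "sets P = sets borel" "sets Q = sets borel"
    and prob: "prob_space P" "prob_space Q"
    and eq: "\<And>(f :: 'b \<Rightarrow> real) L. (\<And>x. 0 \<le> f x) \<Longrightarrow> (\<And>x. f x \<le> 1) \<Longrightarrow>
      (\<And>x y. \<bar>f x - f y\<bar> \<le> L * dist x y) \<Longrightarrow> (\<integral>x. f x \<partial>P) = (\<integral>x. f x \<partial>Q)"
  shows "P = Q"
proof -
  interpret P: prob_space P by fact
  interpret Q: prob_space Q by fact
  have closed: "measure P C = measure Q C" if C: "closed C" for C
  proof (cases "C = {}")
    case False
    define f where "f k x = max 0 (1 - real k * infdist x C)" for k x
    have f01: "0 \<le> f k x" "f k x \<le> 1" for k x
      by (auto simp: f_def infdist_nonneg)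
    have lip: "\<bar>f k x - f k y\<bar> \<le> real k * dist x y" for k x y
    proof -
      have "\<bar>f k x - f k y\<bar> \<le> \<bar>real k * infdist x C - real k * infdist y C\<bar>"
        by (auto simp: f_def)
      also have "\<dots> = real k * \<bar>infdist x C - infdist y C\<bar>"
        by (simp add: right_diff_distrib[symmetric] abs_mult)
      also have "\<dots> \<le> real k * dist x y"
        by (intro mult_left_mono infdist_triangle_abs) simp
      finally show ?thesis .
    qed
    have [measurable]: "f k \<in> borel_measurable borel" for k
      unfolding f_def by (intro borel_measurable_continuous_onI continuous_intros)
    have lim: "(\<lambda>k. f k x) \<longlonglongrightarrow> indicator C x" for x
    proof (cases "x \<in> C")
      case True
      then show ?thesis by (simp add: f_def)
    next
      case notin: False
      then have pos: "0 < infdist x C"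
        using C False by (metis infdist_nonneg in_closed_iff_infdist_zero less_eq_real_def)
      then obtain K :: nat where K: "1 < real K * infdist x C"
        using reals_Archimedean3 by blast
      have "f k x = 0" if "K \<le> k" for k
      proof -
        have "real K * infdist x C \<le> real k * infdist x C"
          using that pos by (intro mult_right_mono) auto
        with K show ?thesis by (simp add: f_def)
      qed
      then have "eventually (\<lambda>k. f k x = 0) sequentially"
        by (auto simp: eventually_sequentially)
      then show ?thesis using notin by (simp add: tendsto_eventually)
    qed
    have L: "(\<lambda>k. \<integral>x. f k x \<partial>R) \<longlonglongrightarrow> measure R C"
      if "prob_space R" "sets R = sets borel" for R
    proof -
      interpret R: prob_space R by fact
      note that(2)[measurable_cong]
      have [measurable]: "C \<in> sets borel" using C by simp
      have "(\<lambda>k. \<integral>x. f k x \<partial>R) \<longlonglongrightarrow> (\<integral>x. indicator C x \<partial>R)"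
        by (rule integral_dominated_convergence[where w = "\<lambda>_. 1"]) (use lim f01 in auto)
      also have "space R = UNIV"
        using that(2) by (metis sets_eq_imp_space_eq space_borel)
      ultimately show ?thesis
        by simp
    qed
    have "(\<integral>x. f k x \<partial>P) = (\<integral>x. f k x \<partial>Q)" for k
      by (rule eq[OF f01 lip])
    then show ?thesis
      using L[OF prob(1) sets(1)] L[OF prob(2) sets(2)] LIMSEQ_unique by auto
  qed simp
  show ?thesis
  proof (rule measure_eqI_generator_eq[where E="Collect closed" and \<Omega>=UNIV and A="\<lambda>_. UNIV"])
    show "Int_stable (Collect closed :: 'b set set)"
      by (auto simp: Int_stable_def)
    show "sets P = sigma_sets UNIV (Collect closed)" "sets Q = sigma_sets UNIV (Collect closed)"
      by (auto simp: sets borel_eq_closed)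
    show "emeasure P C = emeasure Q C" if "C \<in> Collect closed" for C
      using that by (simp add: P.emeasure_eq_measure Q.emeasure_eq_measure closed)
    show "emeasure P UNIV \<noteq> \<infinity>"
      by (simp add: P.emeasure_eq_measure)
  qed auto
qed

lemma lipschitz_imp_borel_measurable:
  fixes f :: "'b::metric_space \<Rightarrow> real"
  assumes "\<And>x y. \<bar>f x - f y\<bar> \<le> L * dist x y"
  shows "f \<in> borel_measurable borel"
proof -
  have "\<bar>L\<bar>-lipschitz_on UNIV f"
  proof (rule lipschitz_onI)
    fix x y :: 'b
    have "L * dist x y \<le> \<bar>L\<bar> * dist x y" by (intro mult_right_mono) auto
    then show "dist (f x) (f y) \<le> \<bar>L\<bar> * dist x y"
      using assms[of x y] by (simp add: dist_real_def)
  qed simp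
  then show ?thesis
    by (intro borel_measurable_continuous_onI lipschitz_on_continuous_on)
qed

text \<open>The sums S converge to V almost surely but have no known law; the variables Z have a
  known law but are only close to S in mean. The law of Z is realised a second time, on N, by maps z
  that converge pointwise. A Lipschitz test then passes to the limit by dominated convergence on
  both spaces, and the gap between Z and S costs at most the Lipschitz constant times e.\<close>

lemma (in prob_space) distr_limit_eqI:
  fixes Z S :: "nat \<Rightarrow> 'a \<Rightarrow> 'b::{metric_space, second_countable_topology}" and y :: "'c \<Rightarrow> 'b"
  assumes [measurable]: "\<And>n. Z n \<in> borel_measurable M" "\<And>n. S n \<in> borel_measurable M"
      "V \<in> borel_measurable M" "\<And>n. z n \<in> borel_measurable N" "y \<in> borel_measurable N"
    and N: "prob_space N"
    and law: "\<And>n. distr M borel (Z n) = distr N borel (z n)"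
    and zlim: "\<And>x. x \<in> space N \<Longrightarrow> (\<lambda>n. z n x) \<longlonglongrightarrow> y x"
    and Slim: "AE \<omega> in M. (\<lambda>n. S n \<omega>) \<longlonglongrightarrow> V \<omega>"
    and e: "e \<longlonglongrightarrow> 0"
    and close: "\<And>n. (\<integral>\<^sup>+\<omega>. ennreal (dist (Z n \<omega>) (S n \<omega>)) \<partial>M) \<le> ennreal (e n)"
    and e0: "\<And>n. 0 \<le> e n"
  shows "distr M borel V = distr N borel y"
proof (rule measure_eqI_lipschitz)
  interpret N: prob_space N by fact
  show "prob_space (distr M borel V)"
    by (rule prob_space_distr) measurable
  show "prob_space (distr N borel y)"
    by (rule N.prob_space_distr) measurable
  fix f :: "'b \<Rightarrow> real" and L
  assume f: "\<And>x. 0 \<le> f x" "\<And>x. f x \<le> 1" and lip: "\<And>x y. \<bar>f x - f y\<bar> \<le> L * dist x y"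
  have [measurable]: "f \<in> borel_measurable borel"
    using lip by (rule lipschitz_imp_borel_measurable)
  have tendsto_f: "(\<lambda>n. f (p n)) \<longlonglongrightarrow> f q" if "p \<longlonglongrightarrow> q" for p :: "nat \<Rightarrow> 'b" and q
  proof -
    have "(\<lambda>n. L * dist (p n) q) \<longlonglongrightarrow> 0"
      by (intro tendsto_mult_right_zero tendsto_dist_iff[THEN iffD1, OF that])
    then have "(\<lambda>n. f (p n) - f q) \<longlonglongrightarrow> 0"
      by (rule Lim_null_comparison[rotated]) (simp add: lip)
    then show ?thesis by (simp add: LIM_zero_iff)
  qed
  have 1: "(\<lambda>n. \<integral>x. f (z n x) \<partial>N) \<longlonglongrightarrow> (\<integral>x. f (y x) \<partial>N)"
    by (rule integral_dominated_convergence[where w = "\<lambda>_. 1"])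
      (use f in \<open>auto intro!: AE_I2 tendsto_f zlim\<close>)
  have 2: "(\<lambda>n. \<integral>x. f (S n x) \<partial>M) \<longlonglongrightarrow> (\<integral>x. f (V x) \<partial>M)"
    by (rule integral_dominated_convergence[where w = "\<lambda>_. 1"])
      (use f Slim in \<open>auto intro: tendsto_f\<close>)
  have L: "\<bar>f x - f x'\<bar> \<le> \<bar>L\<bar> * dist x x'" for x x' :: 'b
    by (rule order_trans[OF lip]) (intro mult_right_mono, auto)
  have 3: "norm ((\<integral>x. f (z n x) \<partial>N) - (\<integral>x. f (S n x) \<partial>M)) \<le> \<bar>L\<bar> * e n" for n
  proof -
    have int: "integrable M (\<lambda>x. f (Z n x))" "integrable M (\<lambda>x. f (S n x))"
      using f by (auto intro!: integrable_const_bound[where B=1])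
    have "(\<integral>x. f (z n x) \<partial>N) = (\<integral>x. f x \<partial>distr N borel (z n))"
      by (simp add: integral_distr)
    also have "\<dots> = (\<integral>x. f (Z n x) \<partial>M)"
      by (simp add: law[symmetric] integral_distr)
    finally have "norm ((\<integral>x. f (z n x) \<partial>N) - (\<integral>x. f (S n x) \<partial>M)) = norm (\<integral>x. f (Z n x) - f (S n x) \<partial>M)"
      using int by simp
    also have "ennreal \<dots> \<le> (\<integral>\<^sup>+x. norm (f (Z n x) - f (S n x)) \<partial>M)"
      using int by (intro integral_norm_bound_ennreal) auto
    also have "\<dots> \<le> (\<integral>\<^sup>+x. ennreal \<bar>L\<bar> * ennreal (dist (Z n x) (S n x)) \<partial>M)"
      by (intro nn_integral_mono) (simp add: ennreal_mult[symmetric] L)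
    also have "\<dots> \<le> ennreal \<bar>L\<bar> * ennreal (e n)"
      by (simp add: nn_integral_cmult mult_left_mono close)
    also have "\<dots> = ennreal (\<bar>L\<bar> * e n)"
      by (simp add: ennreal_mult e0)
    finally show ?thesis
      by (simp add: e0 ennreal_le_iff)
  qed
  have "(\<lambda>n. \<bar>L\<bar> * e n) \<longlonglongrightarrow> 0"
    using e by (rule tendsto_mult_right_zero)
  then have "(\<lambda>n. (\<integral>x. f (z n x) \<partial>N) - (\<integral>x. f (S n x) \<partial>M)) \<longlonglongrightarrow> 0"
    by (rule Lim_null_comparison[OF always_eventually[OF allI[OF 3]]])
  from tendsto_diff[OF 1 this] have "(\<lambda>n. \<integral>x. f (S n x) \<partial>M) \<longlonglongrightarrow> (\<integral>x. f (y x) \<partial>N)"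
    by simp
  with 2 have "(\<integral>x. f (V x) \<partial>M) = (\<integral>x. f (y x) \<partial>N)"
    by (rule LIMSEQ_unique)
  then show "(\<integral>x. f x \<partial>distr M borel V) = (\<integral>x. f x \<partial>distr N borel y)"
    by (simp add: integral_distr)
qed simp_all

section \<open>Sums of independent Gaussian vectors and of Wiener increments\<close>

lemma (in prob_space) indep_var_sum_sum:
  fixes Z :: "'i \<Rightarrow> 'a \<Rightarrow> 'b::euclidean_space"
  assumes "finite I" "finite J" "I \<inter> J = {}" and indep: "indep_vars (\<lambda>_. borel) Z (I \<union> J)"
  shows "indep_var borel (\<lambda>\<omega>. \<Sum>i\<in>I. Z i \<omega>) borel (\<lambda>\<omega>. \<Sum>j\<in>J. Z j \<omega>)"
proof -
  have "indep_var
    borel ((\<lambda>f. \<Sum>i\<in>I. f i) \<circ> (\<lambda>\<omega>. restrict (\<lambda>i. Z i \<omega>) I))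
    borel ((\<lambda>f. \<Sum>i\<in>J. f i) \<circ> (\<lambda>\<omega>. restrict (\<lambda>i. Z i \<omega>) J))"
    using assms by (intro indep_var_compose[OF indep_var_restrict[OF indep]]) auto
  then show ?thesis
    by (simp add: comp_def)
qed

lemma (in prob_space) distr_sum_gauss_law:
  fixes Z :: "'i \<Rightarrow> 'a \<Rightarrow> 'b::euclidean_space"
  assumes "finite I" "indep_vars (\<lambda>_. borel) Z I"
    and "\<And>i. i \<in> I \<Longrightarrow> distr M borel (Z i) = gauss_law 0 (v i)" "\<And>i. i \<in> I \<Longrightarrow> 0 \<le> v i"
  shows "distr M borel (\<lambda>\<omega>. \<Sum>i\<in>I. Z i \<omega>) = gauss_law 0 (\<Sum>i\<in>I. v i)"
  using assms
proof (induction I rule: finite_induct)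
  case empty
  then show ?case by (simp add: gauss_law_0 distr_const_return)
next
  case (insert i I)
  have [measurable]: "Z j \<in> borel_measurable M" if "j \<in> insert i I" for j
    using insert.prems(1) that by (auto simp: indep_vars_def)
  have IH: "distr M borel (\<lambda>\<omega>. \<Sum>i\<in>I. Z i \<omega>) = gauss_law 0 (\<Sum>i\<in>I. v i)"
    using insert.prems by (intro insert.IH) (auto intro: indep_vars_subset)
  have "indep_var borel (\<lambda>\<omega>. \<Sum>i\<in>{i}. Z i \<omega>) borel (\<lambda>\<omega>. \<Sum>i\<in>I. Z i \<omega>)"
    using insert by (intro indep_var_sum_sum) auto
  then have joint: "distr M (borel \<Otimes>\<^sub>M borel) (\<lambda>\<omega>. (Z i \<omega>, \<Sum>i\<in>I. Z i \<omega>))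
      = gauss_law 0 (v i) \<Otimes>\<^sub>M gauss_law 0 (\<Sum>i\<in>I. v i)"
    using insert.prems by (simp add: indep_var_distribution_eq IH)
  have "distr M borel (\<lambda>\<omega>. \<Sum>i\<in>insert i I. Z i \<omega>)
      = distr (distr M (borel \<Otimes>\<^sub>M borel) (\<lambda>\<omega>. (Z i \<omega>, \<Sum>i\<in>I. Z i \<omega>))) borel (\<lambda>(x, y). x + y)"
    using insert.hyps by (subst distr_distr) (auto simp: comp_def)
  also have "\<dots> = gauss_law 0 (v i + (\<Sum>i\<in>I. v i))"
    unfolding joint using insert.prems by (subst distr_add_gauss_law) (auto intro: sum_nonneg)
  finally show ?case
    using insert.hyps by simp
qed

lemma distr_wiener_increment:
  assumes W: "wiener_process M W" and "0 \<le> s" "s \<le> t"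
  shows "distr M borel (\<lambda>\<omega>. c *\<^sub>R (W t \<omega> - W s \<omega>)) = gauss_law 0 (c\<^sup>2 * (t - s))"
proof -
  interpret prob_space M using W by (simp add: wiener_process_def)
  have [measurable]: "W t \<in> borel_measurable M" "W s \<in> borel_measurable M"
    using assms by (auto simp: wiener_process_def)
  show ?thesis
  proof (cases "s = t")
    case True
    then show ?thesis by (simp add: gauss_law_0 distr_const_return)
  next
    case False
    then have "s < t" using assms by simp
    then have "distributed M lborel (\<lambda>\<omega>. W t \<omega> - W s \<omega>) (gauss_density 0 (t - s))"
      using W assms(2) by (simp add: wiener_process_def)
    then have *: "distr M borel (\<lambda>\<omega>. W t \<omega> - W s \<omega>) = gauss_law 0 (t - s)"
      using \<open>s < t\<close> by (simp add: distributed_def gauss_law_eq_density cong: distr_cong)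
    have "distr M borel (\<lambda>\<omega>. c *\<^sub>R (W t \<omega> - W s \<omega>))
        = distr (distr M borel (\<lambda>\<omega>. W t \<omega> - W s \<omega>)) borel (\<lambda>x. 0 + c *\<^sub>R x)"
      by (subst distr_distr) (auto simp: comp_def)
    also have "\<dots> = gauss_law 0 (c\<^sup>2 * (t - s))"
      unfolding * using assms by (subst distr_gauss_law_affine) auto
    finally show ?thesis .
  qed
qed

text \<open>Both sums run over a single increasing list of times, cut at index p, so the
  independence of all increments along that list gives the independence of the two blocks. This is
  the only place where past and future noise are separated; everything later inherits the product
  form.\<close>

lemma distr_wiener_sum_pair:
  fixes W :: "real \<Rightarrow> 'w \<Rightarrow> 'a::euclidean_space" and \<tau> :: "nat \<Rightarrow> real"
  assumes W: "wiener_process M W" and "0 \<le> \<tau> 0" and mono: "\<And>i. i < p + q \<Longrightarrow> \<tau> i \<le> \<tau> (Suc i)"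
  shows "distr M borel (\<lambda>\<omega>. (\<Sum>i<p. c i *\<^sub>R (W (\<tau> (Suc i)) \<omega> - W (\<tau> i) \<omega>),
                            \<Sum>i=p..<p + q. c i *\<^sub>R (W (\<tau> (Suc i)) \<omega> - W (\<tau> i) \<omega>)))
     = gauss_law 0 (\<Sum>i<p. (c i)\<^sup>2 * (\<tau> (Suc i) - \<tau> i)) \<Otimes>\<^sub>M
       gauss_law 0 (\<Sum>i=p..<p + q. (c i)\<^sup>2 * (\<tau> (Suc i) - \<tau> i))"
proof -
  interpret prob_space M using W by (simp add: wiener_process_def)
  define Z where "Z i \<omega> = c i *\<^sub>R (W (\<tau> (Suc i)) \<omega> - W (\<tau> i) \<omega>)" for i \<omega>
  have nonneg: "0 \<le> \<tau> i" if "i \<le> p + q" for i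
    using that
  proof (induction i)
    case (Suc i)
    then show ?case using mono[of i] by simp
  qed (simp add: assms)
  have "indep_vars (\<lambda>_. borel) (\<lambda>i \<omega>. W (\<tau> (Suc i)) \<omega> - W (\<tau> i) \<omega>) {..<p + q}"
    using W assms(2) mono by (simp add: wiener_process_def)
  then have indep: "indep_vars (\<lambda>_. borel) Z {..<p + q}"
    unfolding Z_def by (rule indep_vars_compose2) simp
  have U: "{..<p + q} = {..<p} \<union> {p..<p + q}" by auto
  have law: "distr M borel (Z i) = gauss_law 0 ((c i)\<^sup>2 * (\<tau> (Suc i) - \<tau> i))" if "i < p + q" for i
    unfolding Z_def using that by (intro distr_wiener_increment W nonneg mono) auto
  have v: "0 \<le> (c i)\<^sup>2 * (\<tau> (Suc i) - \<tau> i)" if "i < p + q" for i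
    using mono[OF that] by simp
  have "indep_var borel (\<lambda>\<omega>. \<Sum>i<p. Z i \<omega>) borel (\<lambda>\<omega>. \<Sum>i=p..<p + q. Z i \<omega>)"
    using indep unfolding U by (intro indep_var_sum_sum) auto
  then have "distr M (borel \<Otimes>\<^sub>M borel) (\<lambda>\<omega>. (\<Sum>i<p. Z i \<omega>, \<Sum>i=p..<p + q. Z i \<omega>))
     = distr M borel (\<lambda>\<omega>. \<Sum>i<p. Z i \<omega>) \<Otimes>\<^sub>M distr M borel (\<lambda>\<omega>. \<Sum>i=p..<p + q. Z i \<omega>)"
    by (simp add: indep_var_distribution_eq)
  also have "distr M borel (\<lambda>\<omega>. \<Sum>i<p. Z i \<omega>) = gauss_law 0 (\<Sum>i<p. (c i)\<^sup>2 * (\<tau> (Suc i) - \<tau> i))"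
    by (intro distr_sum_gauss_law law v) (auto intro: indep_vars_subset[OF indep])
  also have "distr M borel (\<lambda>\<omega>. \<Sum>i=p..<p + q. Z i \<omega>)
      = gauss_law 0 (\<Sum>i=p..<p + q. (c i)\<^sup>2 * (\<tau> (Suc i) - \<tau> i))"
    by (intro distr_sum_gauss_law law v) (auto intro: indep_vars_subset[OF indep])
  finally show ?thesis
    by (simp add: Z_def borel_prod)
qed

section \<open>Riemann sums and Wiener integrals\<close>

lemma partition_mono:
  fixes p :: "nat \<Rightarrow> real"
  assumes "\<And>i. i < n \<Longrightarrow> p i \<le> p (Suc i)" "i \<le> j" "j \<le> n"
  shows "p i \<le> p j"
  using assms(2,3)
proof (induction j rule: dec_induct)
  case (step k)
  then show ?case using assms(1)[of k] by simp
qed simp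

text \<open>The integrand \<open>F i\<close> may change from step to step, which is what freezing
  some of its arguments at a node requires.\<close>

lemma sum_integral_close:
  fixes p :: "nat \<Rightarrow> real" and f :: "real \<Rightarrow> 'a::euclidean_space"
  assumes "\<And>i. i < n \<Longrightarrow> p i \<le> p (Suc i)"
    and "\<And>i. i < n \<Longrightarrow> (F i has_integral I i) {p i..p (Suc i)}"
    and "(f has_integral J) {p 0..p n}"
    and "\<And>i s. i < n \<Longrightarrow> s \<in> {p i..p (Suc i)} \<Longrightarrow> norm (F i s - f s) \<le> e" "0 \<le> e"
  shows "norm ((\<Sum>i<n. I i) - J) \<le> e * (p n - p 0)"
  using assms(1-4)
proof (induction n arbitrary: J)
  case 0
  then show ?case by (simp add: has_integral_unique[OF _ has_integral_refl(2)])
next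
  case (Suc n)
  have le: "p 0 \<le> p n" "p n \<le> p (Suc n)"
    using Suc.prems(1) partition_mono[of "Suc n" p 0 n] by auto
  have "f integrable_on {p 0..p n}" "f integrable_on {p n..p (Suc n)}"
    using le by (intro integrable_subinterval_real[OF has_integral_integrable[OF Suc.prems(3)]]; simp)+
  then obtain J1 J2 where J: "(f has_integral J1) {p 0..p n}" "(f has_integral J2) {p n..p (Suc n)}"
    by (auto simp: integrable_on_def)
  then have "J = J1 + J2"
    using has_integral_unique[OF Suc.prems(3) has_integral_combine[OF le J]] by simp
  have 1: "norm ((\<Sum>i<n. I i) - J1) \<le> e * (p n - p 0)"
    using Suc.prems by (intro Suc.IH J) auto
  have "norm (I n - J2) \<le> e * measure lborel {p n..p (Suc n)}"
    using Suc.prems assms(5)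
    by (intro has_integral_bound_real[OF _ finite.emptyI has_integral_diff[OF Suc.prems(2) J(2)]]) auto
  then have 2: "norm (I n - J2) \<le> e * (p (Suc n) - p n)"
    using le by simp
  have "norm ((\<Sum>i<Suc n. I i) - J) = norm (((\<Sum>i<n. I i) - J1) + (I n - J2))"
    by (simp add: \<open>J = J1 + J2\<close> algebra_simps)
  also have "\<dots> \<le> e * (p n - p 0) + e * (p (Suc n) - p n)"
    using 1 2 norm_triangle_le by (metis add_mono)
  finally show ?case by (simp add: algebra_simps)
qed

lemma riemann_sum_limit:
  fixes H :: "real \<times> real \<times> real \<Rightarrow> 'a::euclidean_space"
    and p q q' :: "nat \<Rightarrow> nat \<Rightarrow> real" and N :: "nat \<Rightarrow> nat"
  assumes H: "continuous_on ({A..B} \<times> {A..B} \<times> {A..B}) H"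
    and ends: "\<And>n. p n 0 = A" "\<And>n. p n (N n) = B"
    and mono: "\<And>n j. j < N n \<Longrightarrow> p n j \<le> p n (Suc j)"
    and q: "\<And>n j. j < N n \<Longrightarrow> q n j \<in> {A..B}"
      "\<And>n j s. j < N n \<Longrightarrow> s \<in> {p n j..p n (Suc j)} \<Longrightarrow> \<bar>q n j - s\<bar> \<le> (B - A) / real (Suc n)"
    and q': "\<And>n j. j < N n \<Longrightarrow> q' n j \<in> {A..B}"
      "\<And>n j s. j < N n \<Longrightarrow> s \<in> {p n j..p n (Suc j)} \<Longrightarrow> \<bar>q' n j - s\<bar> \<le> (B - A) / real (Suc n)"
  shows "(\<lambda>n. \<Sum>j<N n. integral {p n j..p n (Suc j)} (\<lambda>s. H (s, q n j, q' n j)))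
    \<longlonglongrightarrow> integral {A..B} (\<lambda>s. H (s, s, s))"
proof (rule LIMSEQ_I)
  have le: "A \<le> p n j" "p n j \<le> B" if "j \<le> N n" for n j
    using partition_mono[of "N n" "p n" 0 j] partition_mono[of "N n" "p n" j "N n"] mono ends that by auto
  have AB: "A \<le> B" using le[of 0 0] ends by simp
  fix e :: real assume "0 < e"
  \<comment> \<open>The added 1 keeps the denominator positive when A = B, and the 2 leaves room for
    a strict inequality.\<close>
  define e' where "e' = e / (2 * (B - A + 1))"
  have e': "0 < e'" "e' * (B - A) < e"
  proof -
    show "0 < e'" using \<open>0 < e\<close> AB by (simp add: e'_def)
    have "e' * (B - A) \<le> e' * (B - A + 1)" using \<open>0 < e'\<close> by simp
    also have "\<dots> = e / 2"
    proof -
      have "e / (2 * x) * x = e / 2" if "0 < x" for x :: real using that by simp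
      from this[of "B - A + 1"] show ?thesis unfolding e'_def using AB by simp
    qed
    finally show "e' * (B - A) < e" using \<open>0 < e\<close> by simp
  qed
  have "uniformly_continuous_on ({A..B} \<times> {A..B} \<times> {A..B}) H"
    by (intro compact_uniformly_continuous H compact_Times compact_Icc)
  then obtain d where d: "0 < d" and
    H': "\<And>x y. x \<in> {A..B} \<times> {A..B} \<times> {A..B} \<Longrightarrow> y \<in> {A..B} \<times> {A..B} \<times> {A..B} \<Longrightarrow>
      dist y x < d \<Longrightarrow> dist (H y) (H x) < e'"
    using e'(1) unfolding uniformly_continuous_on_def by metis
  \<comment> \<open>The factor 2 accounts for the two frozen coordinates, each off by at most
    \<open>(B - A) / real (Suc n)\<close>.\<close>
  have "(\<lambda>n. 2 * ((B - A) / real (Suc n))) \<longlonglongrightarrow> 0"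
    by (intro tendsto_mult_right_zero lim_const_over_n[THEN LIMSEQ_Suc])
  from order_tendstoD(2)[OF this d]
  obtain n0 where n0: "\<And>n. n0 \<le> n \<Longrightarrow> 2 * ((B - A) / real (Suc n)) < d"
    unfolding eventually_sequentially by blast
  have "norm ((\<Sum>j<N n. integral {p n j..p n (Suc j)} (\<lambda>s. H (s, q n j, q' n j)))
      - integral {A..B} (\<lambda>s. H (s, s, s))) < e" if "n0 \<le> n" for n
  proof -
    have "norm ((\<Sum>j<N n. integral {p n j..p n (Suc j)} (\<lambda>s. H (s, q n j, q' n j)))
      - integral {A..B} (\<lambda>s. H (s, s, s))) \<le> e' * (p n (N n) - p n 0)"
    proof (rule sum_integral_close[where F = "\<lambda>j s. H (s, q n j, q' n j)" and f = "\<lambda>s. H (s, s, s)"])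
      show "((\<lambda>s. H (s, q n j, q' n j)) has_integral
          integral {p n j..p n (Suc j)} (\<lambda>s. H (s, q n j, q' n j))) {p n j..p n (Suc j)}" if "j < N n" for j
      proof (intro integrable_integral integrable_continuous_real continuous_on_compose2[OF H] continuous_intros)
        show "(\<lambda>s. (s, q n j, q' n j)) ` {p n j..p n (Suc j)} \<subseteq> {A..B} \<times> {A..B} \<times> {A..B}"
          using le[of j n] le[of "Suc j" n] q(1)[OF that] q'(1)[OF that] that by auto
      qed
      show "((\<lambda>s. H (s, s, s)) has_integral integral {A..B} (\<lambda>s. H (s, s, s))) {p n 0..p n (N n)}"
        unfolding ends
        by (intro integrable_integral integrable_continuous_real continuous_on_compose2[OF H] continuous_intros) auto
      show "norm (H (s, q n j, q' n j) - H (s, s, s)) \<le> e'" if "j < N n" "s \<in> {p n j..p n (Suc j)}" for j s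
      proof -
        have "s \<in> {A..B}"
          using le[of j n] le[of "Suc j" n] that by auto
        moreover have "dist (s, q n j, q' n j) (s, s, s) \<le> \<bar>q n j - s\<bar> + \<bar>q' n j - s\<bar>"
          using sqrt_sum_squares_le_sum_abs[of "q n j - s" "q' n j - s"]
          by (simp add: dist_Pair_Pair dist_real_def)
        then have "dist (s, q n j, q' n j) (s, s, s) < d"
          using q(2)[OF that] q'(2)[OF that] n0[OF \<open>n0 \<le> n\<close>] by linarith
        ultimately show ?thesis
          using H'[of "(s, s, s)" "(s, q n j, q' n j)"] q(1)[OF that(1)] q'(1)[OF that(1)]
          by (simp add: dist_norm less_imp_le)
      qed
    qed (use mono e' in auto)
    also have "\<dots> < e" using e' by (simp add: ends)
    finally show ?thesis .
  qed
  then show "\<exists>n0. \<forall>n\<ge>n0. norm ((\<Sum>j<N n. integral {p n j..p n (Suc j)} (\<lambda>s. H (s, q n j, q' n j)))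
      - integral {A..B} (\<lambda>s. H (s, s, s))) < e"
    by blast
qed

text \<open>The pointwise inequality 2 \<eta> x \<le> \<eta>^2 + x^2 does the work of Cauchy-Schwarz
  on a probability space. It converts the mean-square bounds in \<open>wiener_integral\<close> into
  the mean bounds that Lipschitz tests accept.\<close>

lemma nn_integral_norm_le:
  fixes D :: "'w \<Rightarrow> 'a::euclidean_space"
  assumes "prob_space M" and [measurable]: "D \<in> borel_measurable M" and "0 < \<eta>"
    and le: "(\<integral>\<^sup>+\<omega>. ennreal ((norm (D \<omega>))\<^sup>2) \<partial>M) \<le> ennreal (\<eta>\<^sup>2)"
  shows "(\<integral>\<^sup>+\<omega>. ennreal (norm (D \<omega>)) \<partial>M) \<le> ennreal \<eta>"
proof -
  interpret prob_space M by fact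
  have "norm (D \<omega>) \<le> \<eta> / 2 + 1 / (2 * \<eta>) * (norm (D \<omega>))\<^sup>2" for \<omega>
  proof -
    have "0 \<le> (norm (D \<omega>) - \<eta>)\<^sup>2 / (2 * \<eta>)" using \<open>0 < \<eta>\<close> by simp
    also have "\<dots> = \<eta> / 2 + 1 / (2 * \<eta>) * (norm (D \<omega>))\<^sup>2 - norm (D \<omega>)"
      using \<open>0 < \<eta>\<close> by (simp add: field_simps power2_eq_square)
    finally show ?thesis by simp
  qed
  then have "(\<integral>\<^sup>+\<omega>. ennreal (norm (D \<omega>)) \<partial>M)
      \<le> (\<integral>\<^sup>+\<omega>. ennreal (\<eta> / 2) + ennreal (1 / (2 * \<eta>)) * ennreal ((norm (D \<omega>))\<^sup>2) \<partial>M)"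
    using \<open>0 < \<eta>\<close> by (intro nn_integral_mono) (simp add: ennreal_mult[symmetric] ennreal_plus[symmetric] del: ennreal_plus)
  also have "\<dots> = ennreal (\<eta> / 2) + ennreal (1 / (2 * \<eta>)) * (\<integral>\<^sup>+\<omega>. ennreal ((norm (D \<omega>))\<^sup>2) \<partial>M)"
    by (simp add: nn_integral_add nn_integral_cmult emeasure_space_1)
  also have "\<dots> \<le> ennreal (\<eta> / 2) + ennreal (1 / (2 * \<eta>)) * ennreal (\<eta>\<^sup>2)"
    by (intro add_left_mono mult_left_mono le) simp
  also have "\<dots> = ennreal (\<eta> / 2 + 1 / (2 * \<eta>) * \<eta>\<^sup>2)"
    using \<open>0 < \<eta>\<close> by (simp add: ennreal_mult[symmetric] ennreal_plus[symmetric] del: ennreal_plus)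
  also have "\<eta> / 2 + 1 / (2 * \<eta>) * \<eta>\<^sup>2 = \<eta>"
    using \<open>0 < \<eta>\<close> by (simp add: field_simps power2_eq_square)
  finally show ?thesis .
qed

section \<open>Wiener integrals as mean-square limits of left-point sums\<close>

definition wiener_sum :: "(real \<Rightarrow> 'w \<Rightarrow> 'a::euclidean_space) \<Rightarrow> (real \<Rightarrow> real) \<Rightarrow> (nat \<Rightarrow> real) \<Rightarrow> nat \<Rightarrow> 'w \<Rightarrow> 'a" where
  "wiener_sum W g \<tau> n \<omega> = (\<Sum>i<n. g (\<tau> i) *\<^sub>R (W (\<tau> (Suc i)) \<omega> - W (\<tau> i) \<omega>))"

text \<open>On a degenerate interval the partition with 0 steps satisfies every mesh condition and
  its sum is empty, so the second moment of I is below every positive bound.\<close>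

lemma wiener_integral_zero_AE:
  assumes "wiener_integral M W g a a I"
  shows "AE \<omega> in M. I \<omega> = 0"
proof -
  have [measurable]: "I \<in> borel_measurable M"
    using assms by (simp add: wiener_integral_def)
  have "(\<integral>\<^sup>+\<omega>. ennreal ((norm (I \<omega>))\<^sup>2) \<partial>M) < ennreal \<epsilon>" if "0 < \<epsilon>" for \<epsilon>
    using assms that unfolding wiener_integral_def
    by (auto dest!: spec[of _ \<epsilon>] spec[of _ "\<lambda>_. a"] spec[of _ "0::nat"])
  then have "(\<integral>\<^sup>+\<omega>. ennreal ((norm (I \<omega>))\<^sup>2) \<partial>M) \<le> 0 + ennreal \<epsilon>" if "0 < \<epsilon>" for \<epsilon>
    using that unfolding add_0 by (intro less_imp_le) blast
  then have "(\<integral>\<^sup>+\<omega>. ennreal ((norm (I \<omega>))\<^sup>2) \<partial>M) \<le> 0"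
    by (rule ennreal_le_epsilon)
  then show ?thesis
    by (simp add: nn_integral_0_iff_AE)
qed

text \<open>A partition of the interval from a to b is prolonged to the left by a fine partition of
  the interval from 0 to a. Its sum is then the full sum minus the initial one, and each of these is
  close to its own integral.\<close>

lemma wiener_integral_diff:
  fixes W :: "real \<Rightarrow> 'w \<Rightarrow> 'a::euclidean_space"
  assumes W: "wiener_process M W" and "0 \<le> a" "a \<le> b"
    and I: "wiener_integral M W g 0 a I" and I': "wiener_integral M W g 0 b I'"
  shows "wiener_integral M W g a b (\<lambda>\<omega>. I' \<omega> - I \<omega>)"
  unfolding wiener_integral_def
proof (intro conjI allI impI)
  have [measurable]: "I \<in> borel_measurable M" "I' \<in> borel_measurable M"
    using I I' by (simp_all add: wiener_integral_def)
  show "(\<lambda>\<omega>. I' \<omega> - I \<omega>) \<in> borel_measurable M" by measurable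
  fix \<epsilon> :: real assume "0 < \<epsilon>"
  \<comment> \<open>Squaring a difference of two errors costs a factor 2 on each square, so two
    errors below \<epsilon> / 8 give \<epsilon> / 2, strictly below \<epsilon>.\<close>
  then have e8: "0 < \<epsilon> / 8" by simp
  obtain d1 where d1: "0 < d1" "\<And>\<tau> n. \<tau> 0 = 0 \<and> \<tau> n = a \<and> (\<forall>i<n. \<tau> i \<le> \<tau> (Suc i) \<and> \<tau> (Suc i) - \<tau> i < d1) \<Longrightarrow>
      (\<integral>\<^sup>+\<omega>. ennreal ((norm (wiener_sum W g \<tau> n \<omega> - I \<omega>))\<^sup>2) \<partial>M) < ennreal (\<epsilon> / 8)"
    using I e8 unfolding wiener_integral_def wiener_sum_def by meson
  obtain d2 where d2: "0 < d2" "\<And>\<tau> n. \<tau> 0 = 0 \<and> \<tau> n = b \<and> (\<forall>i<n. \<tau> i \<le> \<tau> (Suc i) \<and> \<tau> (Suc i) - \<tau> i < d2) \<Longrightarrow>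
      (\<integral>\<^sup>+\<omega>. ennreal ((norm (wiener_sum W g \<tau> n \<omega> - I' \<omega>))\<^sup>2) \<partial>M) < ennreal (\<epsilon> / 8)"
    using I' e8 unfolding wiener_integral_def wiener_sum_def by meson
  define d where "d = min d1 d2"
  have d: "0 < d" using d1 d2 by (simp add: d_def)
  show "\<exists>\<delta>>0. \<forall>\<tau> n. \<tau> 0 = a \<and> \<tau> n = b \<and> (\<forall>i<n. \<tau> i \<le> \<tau> (Suc i) \<and> \<tau> (Suc i) - \<tau> i < \<delta>) \<longrightarrow>
      (\<integral>\<^sup>+\<omega>. ennreal ((norm ((\<Sum>i<n. g (\<tau> i) *\<^sub>R (W (\<tau> (Suc i)) \<omega> - W (\<tau> i) \<omega>)) - (I' \<omega> - I \<omega>)))\<^sup>2) \<partial>M)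
        < ennreal \<epsilon>"
  proof (intro exI[of _ d] conjI allI impI d)
    fix \<tau> :: "nat \<Rightarrow> real" and n
    assume \<tau>: "\<tau> 0 = a \<and> \<tau> n = b \<and> (\<forall>i<n. \<tau> i \<le> \<tau> (Suc i) \<and> \<tau> (Suc i) - \<tau> i < d)"
    \<comment> \<open>The interval from 0 to a gets k equal steps of length a / k < d. As a / d is
      nonnegative, k is positive even for a = 0.\<close>
    obtain k where k: "a / d < real k" using reals_Archimedean2 by blast
    then have k0: "0 < k" using assms(2) d
      by (metis divide_nonneg_pos not_less of_nat_0_less_iff order_le_less_trans)
    have kd: "a / k < d" using k k0 d by (simp add: field_simps)
    \<comment> \<open>The two partitions are joined at index k, where both formulas give a.\<close>
    define \<sigma> where "\<sigma> i = (if i \<le> k then a * i / k else \<tau> (i - k))" for i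
    have \<sigma>k: "\<sigma> (k + i) = \<tau> i" for i
      using \<tau> k0 by (cases i) (auto simp: \<sigma>_def)
    have \<sigma>1: "\<sigma> 0 = 0" "\<sigma> k = a" "\<sigma> (k + n) = b"
      using \<tau> k0 by (simp_all add: \<sigma>k) (simp_all add: \<sigma>_def)
    have step: "\<sigma> i \<le> \<sigma> (Suc i) \<and> \<sigma> (Suc i) - \<sigma> i < d" if "i < k + n" for i
    proof (cases "i < k")
      case True
      have "\<sigma> (Suc i) - \<sigma> i = a / k"
        using True by (simp add: \<sigma>_def diff_divide_distrib[symmetric] algebra_simps)
      moreover have "0 \<le> a / k" using assms(2) by simp
      ultimately show ?thesis using kd by linarith
    next
      case False
      then obtain j where "i = k + j" by (metis le_add_diff_inverse not_less)
      then show ?thesis using that \<tau> \<sigma>k[of j] \<sigma>k[of "Suc j"] by simp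
    qed
    have nonneg: "0 \<le> \<sigma> i" if "i \<le> k + n" for i
      using partition_mono[of "k + n" \<sigma> 0 i] step that by (simp add: \<sigma>1)
    have meas[measurable]: "wiener_sum W g \<sigma> j \<in> borel_measurable M" if "j \<le> k + n" for j
    proof -
      have "W (\<sigma> i) \<in> borel_measurable M" if "i \<le> k + n" for i
        using W nonneg[OF that] by (simp add: wiener_process_def)
      then show ?thesis using that
        unfolding wiener_sum_def by (intro borel_measurable_sum borel_measurable_scaleR borel_measurable_diff) auto
    qed
    note m = meas[of k, simplified] meas[of "k + n", simplified]
    note m[measurable]
    have A: "(\<integral>\<^sup>+\<omega>. ennreal ((norm (wiener_sum W g \<sigma> k \<omega> - I \<omega>))\<^sup>2) \<partial>M) < ennreal (\<epsilon> / 8)"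
      using step \<sigma>1 by (intro d1(2)) (auto simp: d_def)
    have B: "(\<integral>\<^sup>+\<omega>. ennreal ((norm (wiener_sum W g \<sigma> (k + n) \<omega> - I' \<omega>))\<^sup>2) \<partial>M) < ennreal (\<epsilon> / 8)"
      using step \<sigma>1 by (intro d2(2)) (auto simp: d_def)
    have split: "wiener_sum W g \<sigma> (k + n) \<omega> = wiener_sum W g \<sigma> k \<omega> + (\<Sum>i<n. g (\<tau> i) *\<^sub>R (W (\<tau> (Suc i)) \<omega> - W (\<tau> i) \<omega>))" for \<omega>
    proof -
      have "(\<Sum>i<n. g (\<tau> i) *\<^sub>R (W (\<tau> (Suc i)) \<omega> - W (\<tau> i) \<omega>))
         = (\<Sum>i=k..<k+n. g (\<sigma> i) *\<^sub>R (W (\<sigma> (Suc i)) \<omega> - W (\<sigma> i) \<omega>))"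
        using sum.shift_bounds_nat_ivl[of "\<lambda>i. g (\<sigma> i) *\<^sub>R (W (\<sigma> (Suc i)) \<omega> - W (\<sigma> i) \<omega>)" 0 k n]
        by (simp add: \<sigma>k add.commute[of _ k] atLeast0LessThan flip: add_Suc_right)
      then show ?thesis
        unfolding wiener_sum_def lessThan_atLeast0 by (simp add: sum.atLeastLessThan_concat)
    qed
    have par: "(norm (x - y))\<^sup>2 \<le> 2 * (norm x)\<^sup>2 + 2 * (norm y)\<^sup>2" for x y :: 'a
    proof -
      have "(norm (x - y))\<^sup>2 \<le> (norm x + norm y)\<^sup>2"
        by (intro power_mono norm_triangle_ineq4) simp
      also have "\<dots> \<le> 2 * (norm x)\<^sup>2 + 2 * (norm y)\<^sup>2"
        using sum_squares_bound[of "norm x" "norm y"] by (simp add: power2_sum)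
      finally show ?thesis .
    qed
    have "(\<integral>\<^sup>+\<omega>. ennreal ((norm ((\<Sum>i<n. g (\<tau> i) *\<^sub>R (W (\<tau> (Suc i)) \<omega> - W (\<tau> i) \<omega>)) - (I' \<omega> - I \<omega>)))\<^sup>2) \<partial>M)
      \<le> (\<integral>\<^sup>+\<omega>. 2 * ennreal ((norm (wiener_sum W g \<sigma> (k + n) \<omega> - I' \<omega>))\<^sup>2)
            + 2 * ennreal ((norm (wiener_sum W g \<sigma> k \<omega> - I \<omega>))\<^sup>2) \<partial>M)"
    proof (rule nn_integral_mono)
      fix \<omega>
      have "(\<Sum>i<n. g (\<tau> i) *\<^sub>R (W (\<tau> (Suc i)) \<omega> - W (\<tau> i) \<omega>)) - (I' \<omega> - I \<omega>)
        = (wiener_sum W g \<sigma> (k + n) \<omega> - I' \<omega>) - (wiener_sum W g \<sigma> k \<omega> - I \<omega>)"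
        by (simp add: split)
      then have "ennreal ((norm ((\<Sum>i<n. g (\<tau> i) *\<^sub>R (W (\<tau> (Suc i)) \<omega> - W (\<tau> i) \<omega>)) - (I' \<omega> - I \<omega>)))\<^sup>2)
        \<le> ennreal (2 * (norm (wiener_sum W g \<sigma> (k + n) \<omega> - I' \<omega>))\<^sup>2 + 2 * (norm (wiener_sum W g \<sigma> k \<omega> - I \<omega>))\<^sup>2)"
        by (simp only:) (intro ennreal_leI par)
      then show "ennreal ((norm ((\<Sum>i<n. g (\<tau> i) *\<^sub>R (W (\<tau> (Suc i)) \<omega> - W (\<tau> i) \<omega>)) - (I' \<omega> - I \<omega>)))\<^sup>2)
        \<le> 2 * ennreal ((norm (wiener_sum W g \<sigma> (k + n) \<omega> - I' \<omega>))\<^sup>2)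
            + 2 * ennreal ((norm (wiener_sum W g \<sigma> k \<omega> - I \<omega>))\<^sup>2)"
        by (simp add: ennreal_mult)
    qed
    also have "\<dots> = 2 * (\<integral>\<^sup>+\<omega>. ennreal ((norm (wiener_sum W g \<sigma> (k + n) \<omega> - I' \<omega>))\<^sup>2) \<partial>M)
         + 2 * (\<integral>\<^sup>+\<omega>. ennreal ((norm (wiener_sum W g \<sigma> k \<omega> - I \<omega>))\<^sup>2) \<partial>M)"
      by (simp add: nn_integral_add nn_integral_cmult)
    also have "\<dots> \<le> 2 * ennreal (\<epsilon> / 8) + 2 * ennreal (\<epsilon> / 8)"
      using A B by (intro add_mono mult_left_mono) auto
    also have "\<dots> = ennreal (\<epsilon> / 2)"
      using \<open>0 < \<epsilon>\<close> by (simp add: ennreal_mult[symmetric] ennreal_plus[symmetric] flip: ennreal_numeral del: ennreal_plus)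
    also have "\<dots> < ennreal \<epsilon>"
      using \<open>0 < \<epsilon>\<close> by (intro ennreal_lessI) auto
    finally show "(\<integral>\<^sup>+\<omega>. ennreal ((norm ((\<Sum>i<n. g (\<tau> i) *\<^sub>R (W (\<tau> (Suc i)) \<omega> - W (\<tau> i) \<omega>)) - (I' \<omega> - I \<omega>)))\<^sup>2) \<partial>M)
        < ennreal \<epsilon>" .
  qed
qed

section \<open>Equidistant partitions and sums with a frozen integrating factor\<close>

definition unif :: "real \<Rightarrow> real \<Rightarrow> nat \<Rightarrow> nat \<Rightarrow> real" where
  "unif a b n i = a + (b - a) * real i / real (Suc n)"

lemma unif_0 [simp]: "unif a b n 0 = a"
  by (simp add: unif_def)

lemma unif_Suc_n [simp]: "unif a b n (Suc n) = b"
  by (simp add: unif_def del: of_nat_Suc)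

lemma unif_diff: "unif a b n (Suc i) - unif a b n i = (b - a) / real (Suc n)"
proof -
  have "a + c * (1 + x) / y - (a + c * x / y) = c / y" for c x y :: real
    by (simp add: add_divide_distrib distrib_left)
  then show ?thesis
    unfolding unif_def of_nat_Suc[of i] .
qed

lemma unif_step: "a \<le> b \<Longrightarrow> unif a b n i \<le> unif a b n (Suc i)"
proof -
  assume "a \<le> b"
  then have "0 \<le> (b - a) / real (Suc n)" by simp
  then show ?thesis using unif_diff[of a b n i] by linarith
qed

lemma unif_mono: "a \<le> b \<Longrightarrow> i \<le> j \<Longrightarrow> unif a b n i \<le> unif a b n j"
  by (rule partition_mono[of j]) (auto intro: unif_step)

lemma unif_mem: "a \<le> b \<Longrightarrow> i \<le> Suc n \<Longrightarrow> unif a b n i \<in> {a..b}"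
  using unif_mono[of a b 0 i n] unif_mono[of a b i "Suc n" n] by simp

lemma wiener_sum_measurable:
  assumes "wiener_process M W" "\<And>i. i \<le> n \<Longrightarrow> 0 \<le> \<tau> i"
  shows "wiener_sum W g \<tau> n \<in> borel_measurable M"
proof -
  have "W (\<tau> i) \<in> borel_measurable M" if "i \<le> n" for i
    using assms that by (simp add: wiener_process_def)
  then show ?thesis
    unfolding wiener_sum_def by (intro borel_measurable_sum borel_measurable_scaleR borel_measurable_diff) auto
qed

text \<open>Two-level partitions: within each step of the coarse partition \<psi> is frozen, so no
  orthogonality of the approximation errors is needed to control the sum.\<close>

lemma wiener_step_approx:
  fixes W :: "real \<Rightarrow> 'w \<Rightarrow> 'a::euclidean_space"
  assumes W: "wiener_process M W" and ab: "0 \<le> a" "a \<le> b"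
    and K: "\<And>s. s \<in> {a..b} \<Longrightarrow> wiener_integral M W g a s (K s)"
    and "0 < \<eta>"
  obtains N p r where "p 0 = a" "p N = b"
    "\<And>j. j < N \<Longrightarrow> p j \<le> p (Suc j) \<and> r j \<in> {a..b} \<and> p (Suc j) - p j \<le> (b - a) / real (Suc n)"
    "\<And>j s. j < N \<Longrightarrow> s \<in> {p j..p (Suc j)} \<Longrightarrow> \<bar>r j - s\<bar> \<le> (b - a) / real (Suc n)"
    "(\<integral>\<^sup>+\<omega>. ennreal (norm ((\<Sum>j<N. (\<psi> (r j) * g (p j)) *\<^sub>R (W (p (Suc j)) \<omega> - W (p j) \<omega>))
       - (\<Sum>i<Suc n. \<psi> (unif a b n i) *\<^sub>R (K (unif a b n (Suc i)) \<omega> - K (unif a b n i) \<omega>)))) \<partial>M) \<le> ennreal \<eta>"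
proof -
  interpret prob_space M using W by (simp add: wiener_process_def)
  define \<tau> where "\<tau> = unif a b n"
  have \<tau>: "\<tau> i \<in> {a..b}" if "i \<le> Suc n" for i
    unfolding \<tau>_def using ab that by (intro unif_mem)
  have measK: "K (\<tau> i) \<in> borel_measurable M" if "i \<le> Suc n" for i
    using K[OF \<tau>[OF that]] by (simp add: wiener_integral_def)
  \<comment> \<open>The summand 1 keeps C positive when \<open>\<psi>\<close> vanishes at all nodes.
    The 2 in \<open>\<eta>'\<close> is there because a coarse increment carries the errors of both
    its end nodes.\<close>
  define C where "C = 1 + (\<Sum>i<Suc n. \<bar>\<psi> (\<tau> i)\<bar>)"
  have C: "0 < C" "(\<Sum>i<Suc n. \<bar>\<psi> (\<tau> i)\<bar>) \<le> C"
    unfolding C_def by (simp_all add: sum_nonneg add_pos_nonneg del: sum.lessThan_Suc)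
  define \<eta>' where "\<eta>' = \<eta> / (2 * C)"
  have \<eta>': "0 < \<eta>'" using C \<open>0 < \<eta>\<close> by (simp add: \<eta>'_def)
  \<comment> \<open>Each coarse node has its own Wiener integral and hence its own mesh bound; there
    are finitely many nodes, so the minimum d serves all of them.\<close>
  have "\<forall>k\<in>{..Suc n}. \<exists>\<delta>>0. \<forall>(\<sigma>::nat \<Rightarrow> real) N. \<sigma> 0 = a \<and> \<sigma> N = \<tau> k \<and> (\<forall>i<N. \<sigma> i \<le> \<sigma> (Suc i) \<and> \<sigma> (Suc i) - \<sigma> i < \<delta>) \<longrightarrow>
     (\<integral>\<^sup>+\<omega>. ennreal ((norm (wiener_sum W g \<sigma> N \<omega> - K (\<tau> k) \<omega>))\<^sup>2) \<partial>M) < ennreal (\<eta>'\<^sup>2)"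
  proof
    fix k assume "k \<in> {..Suc n}"
    then have "wiener_integral M W g a (\<tau> k) (K (\<tau> k))" by (intro K \<tau>) simp
    moreover have "0 < \<eta>'\<^sup>2" using \<eta>' by simp
    ultimately show "\<exists>\<delta>>0. \<forall>(\<sigma>::nat \<Rightarrow> real) N. \<sigma> 0 = a \<and> \<sigma> N = \<tau> k \<and> (\<forall>i<N. \<sigma> i \<le> \<sigma> (Suc i) \<and> \<sigma> (Suc i) - \<sigma> i < \<delta>) \<longrightarrow>
     (\<integral>\<^sup>+\<omega>. ennreal ((norm (wiener_sum W g \<sigma> N \<omega> - K (\<tau> k) \<omega>))\<^sup>2) \<partial>M) < ennreal (\<eta>'\<^sup>2)"
      unfolding wiener_integral_def wiener_sum_def by blast
  qed
  from bchoice[OF this] obtain \<delta> where "\<forall>k\<in>{..Suc n}. 0 < \<delta> k \<and> (\<forall>(\<sigma>::nat \<Rightarrow> real) N.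
     \<sigma> 0 = a \<and> \<sigma> N = \<tau> k \<and> (\<forall>i<N. \<sigma> i \<le> \<sigma> (Suc i) \<and> \<sigma> (Suc i) - \<sigma> i < \<delta> k) \<longrightarrow>
     (\<integral>\<^sup>+\<omega>. ennreal ((norm (wiener_sum W g \<sigma> N \<omega> - K (\<tau> k) \<omega>))\<^sup>2) \<partial>M) < ennreal (\<eta>'\<^sup>2))" ..
  then have \<delta>: "\<And>k. k \<le> Suc n \<Longrightarrow> 0 < \<delta> k"
    "\<And>k \<sigma> N. k \<le> Suc n \<Longrightarrow> \<sigma> 0 = a \<and> \<sigma> N = \<tau> k \<and> (\<forall>i<N. \<sigma> i \<le> \<sigma> (Suc i) \<and> \<sigma> (Suc i) - \<sigma> i < \<delta> k) \<Longrightarrow>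
     (\<integral>\<^sup>+\<omega>. ennreal ((norm (wiener_sum W g \<sigma> N \<omega> - K (\<tau> k) \<omega>))\<^sup>2) \<partial>M) < ennreal (\<eta>'\<^sup>2)"
    by (blast intro: atMost_iff[THEN iffD2])+
  define d where "d = Min (\<delta> ` {..Suc n})"
  have d: "0 < d" "\<And>k. k \<le> Suc n \<Longrightarrow> d \<le> \<delta> k"
    unfolding d_def using \<delta>(1) by auto
  obtain m0 :: nat where m0: "(b - a) / d < real m0" using reals_Archimedean2 by blast
  define m where "m = Suc m0"
  have m: "0 < m" "(b - a) / real m < d"
    using m0 d(1) by (auto simp: m_def field_simps)
  \<comment> \<open>Every coarse step is cut into m equal pieces of length h < d. The coarse node k
    is then the fine node \<open>k * m\<close>, so the first \<open>k * m\<close> fine steps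
    partition the interval from a to that node.\<close>
  define h where "h = (b - a) / (real (Suc n) * real m)"
  define p where "p j = a + h * real j" for j
  have h: "0 \<le> h" "h < d" "h \<le> (b - a) / real (Suc n)" "h * real m = (b - a) / real (Suc n)"
  proof -
    show "0 \<le> h" unfolding h_def using ab by simp
    have "h = (b - a) / real m / real (Suc n)" by (simp add: h_def field_simps)
    also have "\<dots> \<le> (b - a) / real m / 1" using ab by (intro divide_left_mono) auto
    finally show "h < d" using m by simp
    show *: "h * real m = (b - a) / real (Suc n)" using m by (simp add: h_def)
    have "h * 1 \<le> h * real m" using \<open>0 \<le> h\<close> m by (intro mult_left_mono) auto
    then show "h \<le> (b - a) / real (Suc n)" using * by simp
  qed
  have pm: "p (k * m) = \<tau> k" for k
    using h(4) by (simp add: p_def \<tau>_def unif_def mult.assoc[symmetric] mult.commute mult.left_commute)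
  have pstep: "p (Suc j) = p j + h" for j by (simp add: p_def algebra_simps)
  have pmono: "p i \<le> p j" if "i \<le> j" for i j
    using that h(1) by (simp add: p_def mult_left_mono)
  have p0: "p 0 = a" by (simp add: p_def)
  \<comment> \<open>The coarse node at the left of the fine step j: the place where
    \<open>\<psi>\<close> is frozen.\<close>
  define r where "r j = \<tau> (j div m)" for j
  have D: "(\<integral>\<^sup>+\<omega>. ennreal (norm (wiener_sum W g p (k * m) \<omega> - K (\<tau> k) \<omega>)) \<partial>M) \<le> ennreal \<eta>'" if "k \<le> Suc n" for k
  proof (rule nn_integral_norm_le)
    show "(\<lambda>\<omega>. wiener_sum W g p (k * m) \<omega> - K (\<tau> k) \<omega>) \<in> borel_measurable M"
      using measK[OF that] pmono[of 0] ab p0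
      by (intro borel_measurable_diff wiener_sum_measurable[OF W]) (auto intro: order_trans)
    show "(\<integral>\<^sup>+\<omega>. ennreal ((norm (wiener_sum W g p (k * m) \<omega> - K (\<tau> k) \<omega>))\<^sup>2) \<partial>M) \<le> ennreal (\<eta>'\<^sup>2)"
      using h d(2)[OF that] by (intro less_imp_le \<delta>(2) that) (auto simp: p0 pm pstep)
  qed (use \<eta>' prob_space_axioms in auto)
  \<comment> \<open>Within a block of m fine steps the value of \<open>\<psi>\<close> is constant,
    and the remaining sum over the block is a difference of two initial Wiener sums.\<close>
  have sum_eq: "(\<Sum>j<Suc n * m. (\<psi> (r j) * g (p j)) *\<^sub>R (W (p (Suc j)) \<omega> - W (p j) \<omega>))
      = (\<Sum>i<Suc n. \<psi> (\<tau> i) *\<^sub>R (wiener_sum W g p (Suc i * m) \<omega> - wiener_sum W g p (i * m) \<omega>))" for \<omega>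
  proof -
    have "(\<Sum>j<Suc n * m. (\<psi> (r j) * g (p j)) *\<^sub>R (W (p (Suc j)) \<omega> - W (p j) \<omega>))
      = (\<Sum>i<Suc n. \<Sum>j=i * m..<i * m + m. (\<psi> (r j) * g (p j)) *\<^sub>R (W (p (Suc j)) \<omega> - W (p j) \<omega>))"
      by (rule sum.nat_group[symmetric])
    also have "\<dots> = (\<Sum>i<Suc n. \<psi> (\<tau> i) *\<^sub>R (wiener_sum W g p (Suc i * m) \<omega> - wiener_sum W g p (i * m) \<omega>))"
    proof (rule sum.cong[OF refl])
      fix i
      have "(\<Sum>j=i * m..<i * m + m. (\<psi> (r j) * g (p j)) *\<^sub>R (W (p (Suc j)) \<omega> - W (p j) \<omega>))
         = (\<Sum>j=i * m..<i * m + m. \<psi> (\<tau> i) *\<^sub>R (g (p j) *\<^sub>R (W (p (Suc j)) \<omega> - W (p j) \<omega>)))"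
      proof (rule sum.cong[OF refl])
        fix j assume "j \<in> {i * m..<i * m + m}"
        then have "j div m = i" using m by (intro div_nat_eqI) (auto simp: mult.commute)
        then show "(\<psi> (r j) * g (p j)) *\<^sub>R (W (p (Suc j)) \<omega> - W (p j) \<omega>)
          = \<psi> (\<tau> i) *\<^sub>R (g (p j) *\<^sub>R (W (p (Suc j)) \<omega> - W (p j) \<omega>))"
          by (simp add: r_def)
      qed
      also have "\<dots> = \<psi> (\<tau> i) *\<^sub>R (wiener_sum W g p (Suc i * m) \<omega> - wiener_sum W g p (i * m) \<omega>)"
      proof -
        have "wiener_sum W g p (Suc i * m) \<omega> - wiener_sum W g p (i * m) \<omega>
          = (\<Sum>j=i * m..<i * m + m. g (p j) *\<^sub>R (W (p (Suc j)) \<omega> - W (p j) \<omega>))"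
          unfolding wiener_sum_def lessThan_atLeast0
          by (subst sum_diff_nat_ivl) (auto simp: add.commute)
        then show ?thesis by (simp add: scaleR_sum_right)
      qed
      finally show "(\<Sum>j=i * m..<i * m + m. (\<psi> (r j) * g (p j)) *\<^sub>R (W (p (Suc j)) \<omega> - W (p j) \<omega>))
        = \<psi> (\<tau> i) *\<^sub>R (wiener_sum W g p (Suc i * m) \<omega> - wiener_sum W g p (i * m) \<omega>)" .
    qed
    finally show ?thesis .
  qed
  \<comment> \<open>E is the error at a coarse node. The total error is the sum of
    \<open>\<psi>\<close> times increments of E, bounded crudely by the triangle inequality: n is
    fixed here, so the errors at its finitely many nodes can be made as small as wanted.\<close>
  define E where "E k \<omega> = wiener_sum W g p (k * m) \<omega> - K (\<tau> k) \<omega>" for k \<omega>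
  have measE: "E k \<in> borel_measurable M" if "k \<le> Suc n" for k
    unfolding E_def using measK[OF that] pmono[of 0] ab p0
    by (intro borel_measurable_diff wiener_sum_measurable[OF W]) (auto intro: order_trans)
  have "(\<integral>\<^sup>+\<omega>. ennreal (norm ((\<Sum>j<Suc n * m. (\<psi> (r j) * g (p j)) *\<^sub>R (W (p (Suc j)) \<omega> - W (p j) \<omega>))
       - (\<Sum>i<Suc n. \<psi> (\<tau> i) *\<^sub>R (K (\<tau> (Suc i)) \<omega> - K (\<tau> i) \<omega>)))) \<partial>M)
    \<le> (\<integral>\<^sup>+\<omega>. (\<Sum>i<Suc n. ennreal \<bar>\<psi> (\<tau> i)\<bar> * (ennreal (norm (E (Suc i) \<omega>)) + ennreal (norm (E i \<omega>)))) \<partial>M)"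
  proof (rule nn_integral_mono)
    fix \<omega>
    have "(\<Sum>j<Suc n * m. (\<psi> (r j) * g (p j)) *\<^sub>R (W (p (Suc j)) \<omega> - W (p j) \<omega>))
       - (\<Sum>i<Suc n. \<psi> (\<tau> i) *\<^sub>R (K (\<tau> (Suc i)) \<omega> - K (\<tau> i) \<omega>))
       = (\<Sum>i<Suc n. \<psi> (\<tau> i) *\<^sub>R (E (Suc i) \<omega> - E i \<omega>))"
      unfolding sum_eq sum_subtractf[symmetric] E_def by (intro sum.cong) (auto simp: algebra_simps)
    also have "norm \<dots> \<le> (\<Sum>i<Suc n. \<bar>\<psi> (\<tau> i)\<bar> * (norm (E (Suc i) \<omega>) + norm (E i \<omega>)))"
    proof (rule sum_norm_le)
      fix i
      have "norm (\<psi> (\<tau> i) *\<^sub>R (E (Suc i) \<omega> - E i \<omega>)) = \<bar>\<psi> (\<tau> i)\<bar> * norm (E (Suc i) \<omega> - E i \<omega>)" by simp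
      also have "\<dots> \<le> \<bar>\<psi> (\<tau> i)\<bar> * (norm (E (Suc i) \<omega>) + norm (E i \<omega>))"
        by (intro mult_left_mono norm_triangle_ineq4) simp
      finally show "norm (\<psi> (\<tau> i) *\<^sub>R (E (Suc i) \<omega> - E i \<omega>)) \<le> \<bar>\<psi> (\<tau> i)\<bar> * (norm (E (Suc i) \<omega>) + norm (E i \<omega>))" .
    qed
    finally show "ennreal (norm ((\<Sum>j<Suc n * m. (\<psi> (r j) * g (p j)) *\<^sub>R (W (p (Suc j)) \<omega> - W (p j) \<omega>))
       - (\<Sum>i<Suc n. \<psi> (\<tau> i) *\<^sub>R (K (\<tau> (Suc i)) \<omega> - K (\<tau> i) \<omega>))))
      \<le> (\<Sum>i<Suc n. ennreal \<bar>\<psi> (\<tau> i)\<bar> * (ennreal (norm (E (Suc i) \<omega>)) + ennreal (norm (E i \<omega>))))"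
      by (simp add: ennreal_mult[symmetric] ennreal_plus[symmetric] sum_ennreal ennreal_leI del: ennreal_plus sum.lessThan_Suc)
  qed
  also have "\<dots> = (\<Sum>i<Suc n. \<integral>\<^sup>+\<omega>. ennreal \<bar>\<psi> (\<tau> i)\<bar> * (ennreal (norm (E (Suc i) \<omega>)) + ennreal (norm (E i \<omega>))) \<partial>M)"
    by (intro nn_integral_sum) (use measE in auto)
  also have "\<dots> \<le> (\<Sum>i<Suc n. ennreal (\<bar>\<psi> (\<tau> i)\<bar> * (2 * \<eta>')))"
  proof (rule sum_mono)
    fix i assume "i \<in> {..<Suc n}"
    then have i: "i \<le> Suc n" "Suc i \<le> Suc n" by auto
    note [measurable] = measE[OF i(1)] measE[OF i(2)]
    have "(\<integral>\<^sup>+\<omega>. ennreal \<bar>\<psi> (\<tau> i)\<bar> * (ennreal (norm (E (Suc i) \<omega>)) + ennreal (norm (E i \<omega>))) \<partial>M)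
      = ennreal \<bar>\<psi> (\<tau> i)\<bar> * ((\<integral>\<^sup>+\<omega>. ennreal (norm (E (Suc i) \<omega>)) \<partial>M) + (\<integral>\<^sup>+\<omega>. ennreal (norm (E i \<omega>)) \<partial>M))"
      by (simp add: nn_integral_cmult nn_integral_add)
    also have "\<dots> \<le> ennreal \<bar>\<psi> (\<tau> i)\<bar> * (ennreal \<eta>' + ennreal \<eta>')"
      unfolding E_def by (intro mult_left_mono add_mono D i) simp
    also have "\<dots> = ennreal (\<bar>\<psi> (\<tau> i)\<bar> * (2 * \<eta>'))"
    proof -
      have "ennreal \<eta>' + ennreal \<eta>' = ennreal (\<eta>' + \<eta>')"
        using \<eta>' by (intro ennreal_plus[symmetric]) simp_all
      then show ?thesis
        using \<eta>' by (simp only: ennreal_mult mult_2[symmetric] abs_ge_zero)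
    qed
    finally show "(\<integral>\<^sup>+\<omega>. ennreal \<bar>\<psi> (\<tau> i)\<bar> * (ennreal (norm (E (Suc i) \<omega>)) + ennreal (norm (E i \<omega>))) \<partial>M)
      \<le> ennreal (\<bar>\<psi> (\<tau> i)\<bar> * (2 * \<eta>'))" .
  qed
  also have "\<dots> = ennreal ((\<Sum>i<Suc n. \<bar>\<psi> (\<tau> i)\<bar>) * (2 * \<eta>'))"
    using \<eta>' by (simp only: sum_distrib_right) (intro sum_ennreal, simp)
  also have "\<dots> \<le> ennreal (C * (2 * \<eta>'))"
    using \<eta>' by (intro ennreal_leI mult_right_mono C) simp
  also have "C * (2 * \<eta>') = \<eta>"
    using C by (simp add: \<eta>'_def)
  finally have fin: "(\<integral>\<^sup>+\<omega>. ennreal (norm ((\<Sum>j<Suc n * m. (\<psi> (r j) * g (p j)) *\<^sub>R (W (p (Suc j)) \<omega> - W (p j) \<omega>))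
       - (\<Sum>i<Suc n. \<psi> (\<tau> i) *\<^sub>R (K (\<tau> (Suc i)) \<omega> - K (\<tau> i) \<omega>)))) \<partial>M) \<le> ennreal \<eta>" .
  show ?thesis
  proof (rule that)
    show "p 0 = a" by (rule p0)
    show "p (Suc n * m) = b" unfolding pm \<tau>_def by simp
    fix j assume j: "j < Suc n * m"
    then have jm: "j div m < Suc n" by (simp add: less_mult_imp_div_less)
    show "p j \<le> p (Suc j) \<and> r j \<in> {a..b} \<and> p (Suc j) - p j \<le> (b - a) / real (Suc n)"
      using h jm \<tau>[of "j div m"] by (simp add: pstep r_def)
    fix s assume s: "s \<in> {p j..p (Suc j)}"
    \<comment> \<open>The fine step and its frozen node lie in one coarse step, whose length is the
      claimed bound.\<close>
    have "r j \<le> p j"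
      unfolding r_def pm[symmetric] by (intro pmono) simp
    moreover have "p (Suc j) \<le> \<tau> (Suc (j div m))"
      unfolding pm[symmetric] using m
      by (intro pmono) (metis Suc_leI dividend_less_div_times mult.commute mult_Suc add.commute)
    moreover have "\<tau> (Suc (j div m)) = r j + (b - a) / real (Suc n)"
      using unif_diff[of a b n "j div m"] by (simp add: \<tau>_def r_def)
    ultimately show "\<bar>r j - s\<bar> \<le> (b - a) / real (Suc n)" using s by auto
  next
    show "(\<integral>\<^sup>+\<omega>. ennreal (norm ((\<Sum>j<Suc n * m. (\<psi> (r j) * g (p j)) *\<^sub>R (W (p (Suc j)) \<omega> - W (p j) \<omega>))
       - (\<Sum>i<Suc n. \<psi> (unif a b n i) *\<^sub>R (K (unif a b n (Suc i)) \<omega> - K (unif a b n i) \<omega>)))) \<partial>M) \<le> ennreal \<eta>"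
      using fin by (simp only: \<tau>_def)
  qed
qed

text \<open>A purely deterministic statement about one path. The increments of K are those of x
  minus the integral of the drift; summation by parts turns their weighted sum into a telescoping
  boundary term plus ordinary Riemann sums, which converge because x is continuous. K itself is
  constrained only at the nodes of the equidistant partitions.\<close>

lemma riemann_sum_path_limit:
  fixes x K m c :: "real \<Rightarrow> 'a::euclidean_space" and z :: 'a and \<psi> a :: "real \<Rightarrow> real"
  assumes AB: "0 \<le> A" "A \<le> B"
    and cont: "continuous_on {A..B} x" "continuous_on {A..B} a" "continuous_on {A..B} c"
    and \<psi>: "\<And>s. s \<in> {A..B} \<Longrightarrow> (\<psi> has_real_derivative (- a s * \<psi> s)) (at s within {A..B})"
    and m: "\<And>s. s \<in> {A..B} \<Longrightarrow> (m has_vector_derivative (a s *\<^sub>R m s + c s)) (at s within {A..B})"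
    and int: "\<And>n i. i \<le> Suc n \<Longrightarrow> ((\<lambda>s. a s *\<^sub>R x s + c s) has_integral
        (x (unif A B n i) - z - K (unif A B n i))) {0..unif A B n i}"
  shows "(\<lambda>n. \<Sum>i<Suc n. \<psi> (unif A B n i) *\<^sub>R (K (unif A B n (Suc i)) - K (unif A B n i)))
    \<longlonglongrightarrow> \<psi> B *\<^sub>R (x B - m B) - \<psi> A *\<^sub>R (x A - m A)"
proof -
  \<comment> \<open>summation by parts: u and v stand for the right and left end points of the partition step containing s\<close>
  define H where "H = (\<lambda>(s, u, v). (a s * \<psi> s) *\<^sub>R x u - \<psi> v *\<^sub>R (a s *\<^sub>R x s + c s))"
  have c\<psi>: "continuous_on {A..B} \<psi>"
    using \<psi> by (rule DERIV_continuous_on)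
  have cont': "continuous_on S (\<lambda>y. f (k y))"
    if "continuous_on {A..B} f" "continuous_on S k" "k ` S \<subseteq> {A..B}"
    for f :: "real \<Rightarrow> 'c::topological_space" and S :: "(real \<times> real \<times> real) set" and k
    using that by (rule continuous_on_compose2)
  have contH: "continuous_on ({A..B} \<times> {A..B} \<times> {A..B}) H"
    unfolding H_def case_prod_beta
    by (intro continuous_intros cont'[OF cont(1)] cont'[OF cont(2)] cont'[OF cont(3)] cont'[OF c\<psi>]) auto
  have mem: "unif A B n i \<in> {A..B}" if "i \<le> Suc n" for n i
    using AB that by (intro unif_mem)
  \<comment> \<open>With J the integral of the drift over the step, K u' - K u = x u' - x u - J,
    where z cancels. Then \<psi> u (x u' - x u) is the increment of \<psi> x minus (\<psi> u' -
    \<psi> u) x u', and the increment of \<open>\<psi>\<close> is the integral of - a \<psi>; the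
    two correction terms form the integral of H.\<close>
  have incr: "\<psi> u *\<^sub>R (K u' - K u) = (\<psi> u' *\<^sub>R x u' - \<psi> u *\<^sub>R x u) + integral {u..u'} (\<lambda>s. H (s, u', u))"
    if i: "i < Suc n" and u: "u = unif A B n i" "u' = unif A B n (Suc i)" for n i u u'
  proof -
    have uu: "u \<in> {A..B}" "u' \<in> {A..B}" "u \<le> u'"
      unfolding u using i mem unif_step[OF AB(2)] by auto
    let ?f = "\<lambda>s. a s *\<^sub>R x s + c s"
    have 1: "(?f has_integral (x u - z - K u)) {0..u}" "(?f has_integral (x u' - z - K u')) {0..u'}"
      unfolding u using i by (auto intro!: int)
    have "?f integrable_on {u..u'}"
      using uu AB by (intro integrable_subinterval_real[OF has_integral_integrable[OF 1(2)]]) simp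
    then obtain J where J: "(?f has_integral J) {u..u'}" by (auto simp: integrable_on_def)
    have "x u - z - K u + J = x u' - z - K u'"
      using uu AB by (intro has_integral_unique[OF has_integral_combine[OF _ _ 1(1) J] 1(2)]) auto
    then have J': "J = (x u' - x u) - (K u' - K u)" by (simp add: algebra_simps)
    have d\<psi>: "((\<lambda>s. - a s * \<psi> s) has_integral (\<psi> u' - \<psi> u)) {u..u'}"
    proof (rule fundamental_theorem_of_calculus[OF uu(3)])
      fix s assume "s \<in> {u..u'}"
      then have "s \<in> {A..B}" using uu by auto
      then show "(\<psi> has_vector_derivative - a s * \<psi> s) (at s within {u..u'})"
        using has_field_derivative_subset[OF \<psi>, of s "{u..u'}"] uu
        by (simp add: has_real_derivative_iff_has_vector_derivative)
    qed
    have "((\<lambda>s. - ((- a s * \<psi> s) *\<^sub>R x u') - \<psi> u *\<^sub>R ?f s) has_integral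
       (- ((\<psi> u' - \<psi> u) *\<^sub>R x u') - \<psi> u *\<^sub>R J)) {u..u'}"
      by (intro has_integral_diff has_integral_neg has_integral_scaleR_left has_integral_cmul d\<psi> J)
    then have "integral {u..u'} (\<lambda>s. H (s, u', u)) = - ((\<psi> u' - \<psi> u) *\<^sub>R x u') - \<psi> u *\<^sub>R J"
      by (intro integral_unique) (simp add: H_def)
    then show ?thesis
      unfolding J' by (simp add: algebra_simps)
  qed
  have "(\<lambda>n. \<Sum>i<Suc n. integral {unif A B n i..unif A B n (Suc i)} (\<lambda>s. H (s, unif A B n (Suc i), unif A B n i)))
    \<longlonglongrightarrow> integral {A..B} (\<lambda>s. H (s, s, s))"
  proof (rule riemann_sum_limit[OF contH])
    fix n j :: nat and s
    assume j: "j < Suc n"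
    show "unif A B n j \<le> unif A B n (Suc j)" using AB by (intro unif_step)
    show "unif A B n (Suc j) \<in> {A..B}" "unif A B n j \<in> {A..B}" using j by (auto intro!: mem simp del: atLeastAtMost_iff)
    assume "s \<in> {unif A B n j..unif A B n (Suc j)}"
    then show "\<bar>unif A B n (Suc j) - s\<bar> \<le> (B - A) / real (Suc n)" "\<bar>unif A B n j - s\<bar> \<le> (B - A) / real (Suc n)"
      using unif_diff[of A B n j] by auto
  qed simp_all
  \<comment> \<open>On the diagonal the terms a \<psi> x cancel and H reduces to - \<psi> c. Since m
    solves the noiseless equation, \<psi> m is an antiderivative of \<psi> c.\<close>
  also have "integral {A..B} (\<lambda>s. H (s, s, s)) = - (\<psi> B *\<^sub>R m B - \<psi> A *\<^sub>R m A)"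
  proof -
    have "((\<lambda>s. \<psi> s *\<^sub>R m s) has_vector_derivative \<psi> s *\<^sub>R c s) (at s within {A..B})" if "s \<in> {A..B}" for s
      using has_vector_derivative_scaleR[OF \<psi>[OF that] m[OF that]] by (simp add: algebra_simps)
    then have "((\<lambda>s. \<psi> s *\<^sub>R c s) has_integral (\<psi> B *\<^sub>R m B - \<psi> A *\<^sub>R m A)) {A..B}"
      by (intro fundamental_theorem_of_calculus AB)
    then have "((\<lambda>s. - (\<psi> s *\<^sub>R c s)) has_integral - (\<psi> B *\<^sub>R m B - \<psi> A *\<^sub>R m A)) {A..B}"
      by (rule has_integral_neg)
    moreover have "(\<lambda>s. H (s, s, s)) = (\<lambda>s. - (\<psi> s *\<^sub>R c s))"
      by (auto simp: H_def algebra_simps)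
    ultimately show ?thesis by (metis integral_unique)
  qed
  finally have lim: "(\<lambda>n. (\<psi> B *\<^sub>R x B - \<psi> A *\<^sub>R x A) +
      (\<Sum>i<Suc n. integral {unif A B n i..unif A B n (Suc i)} (\<lambda>s. H (s, unif A B n (Suc i), unif A B n i))))
    \<longlonglongrightarrow> (\<psi> B *\<^sub>R x B - \<psi> A *\<^sub>R x A) + - (\<psi> B *\<^sub>R m B - \<psi> A *\<^sub>R m A)"
    by (intro tendsto_add tendsto_const)
  have "(\<Sum>i<Suc n. \<psi> (unif A B n i) *\<^sub>R (K (unif A B n (Suc i)) - K (unif A B n i)))
     = (\<psi> B *\<^sub>R x B - \<psi> A *\<^sub>R x A) +
      (\<Sum>i<Suc n. integral {unif A B n i..unif A B n (Suc i)} (\<lambda>s. H (s, unif A B n (Suc i), unif A B n i)))" for n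
  proof -
    have "(\<Sum>i<Suc n. \<psi> (unif A B n i) *\<^sub>R (K (unif A B n (Suc i)) - K (unif A B n i)))
       = (\<Sum>i<Suc n. (\<psi> (unif A B n (Suc i)) *\<^sub>R x (unif A B n (Suc i)) - \<psi> (unif A B n i) *\<^sub>R x (unif A B n i))
        + integral {unif A B n i..unif A B n (Suc i)} (\<lambda>s. H (s, unif A B n (Suc i), unif A B n i)))"
      by (intro sum.cong refl incr) auto
    also have "\<dots> = (\<Sum>i<Suc n. (\<psi> (unif A B n (Suc i)) *\<^sub>R x (unif A B n (Suc i)) - \<psi> (unif A B n i) *\<^sub>R x (unif A B n i)))
        + (\<Sum>i<Suc n. integral {unif A B n i..unif A B n (Suc i)} (\<lambda>s. H (s, unif A B n (Suc i), unif A B n i)))"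
      by (rule sum.distrib)
    also have "(\<Sum>i<Suc n. (\<psi> (unif A B n (Suc i)) *\<^sub>R x (unif A B n (Suc i)) - \<psi> (unif A B n i) *\<^sub>R x (unif A B n i)))
       = \<psi> B *\<^sub>R x B - \<psi> A *\<^sub>R x A"
      by (subst sum_lessThan_telescope) simp
    finally show ?thesis .
  qed
  moreover have "(\<psi> B *\<^sub>R x B - \<psi> A *\<^sub>R x A) + - (\<psi> B *\<^sub>R m B - \<psi> A *\<^sub>R m A)
     = \<psi> B *\<^sub>R (x B - m B) - \<psi> A *\<^sub>R (x A - m A)"
    by (simp add: algebra_simps)
  ultimately show ?thesis using lim by (simp only:)
qed

section \<open>Linear stochastic differential equations\<close>

text \<open>All product laws live on one fixed space, that of two standard Gaussians; the variances
  enter only through the map. Convergent variances then give pointwise convergent maps, as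
  \<open>distr_limit_eqI\<close> demands.\<close>

lemma gauss_law_pair_eq_distr:
  "gauss_law 0 u \<Otimes>\<^sub>M gauss_law 0 w =
    distr (density lborel (gauss_density (0::'a::euclidean_space) 1) \<Otimes>\<^sub>M density lborel (gauss_density (0::'a) 1)) borel
      (\<lambda>z. (sqrt u *\<^sub>R fst z, sqrt w *\<^sub>R snd z))"
proof -
  let ?G = "density lborel (gauss_density (0::'a) 1)"
  have "prob_space (distr ?G borel (\<lambda>z. 0 + sqrt w *\<^sub>R z))"
    using prob_space_gauss_law[of "0::'a" w] by (simp add: gauss_law_def)
  then have "sigma_finite_measure (distr ?G borel (\<lambda>z. 0 + sqrt w *\<^sub>R z))"
    by (intro finite_measure.sigma_finite_measure prob_space.axioms(1))
  then show ?thesis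
    unfolding gauss_law_def
    by (subst pair_measure_distr) (simp_all add: borel_prod case_prod_unfold)
qed

lemma dist_Pair_le: "dist (a, b) (c, d) \<le> dist a c + dist b d"
  using sqrt_sum_squares_le_sum_abs[of "dist a c" "dist b d"] by (simp add: dist_Pair_Pair)

text \<open>The two-level approximation with error 1 / (n + 1), its coefficients abstracted to c so
  that only their variance sums matter later. Those sums are Riemann sums of the Ito isometry
  integrand.\<close>

lemma wiener_step_approx_seq:
  fixes W :: "real \<Rightarrow> 'w \<Rightarrow> 'a::euclidean_space"
  assumes W: "wiener_process M W" and ab: "0 \<le> a" "a \<le> b"
    and K: "\<And>s. s \<in> {a..b} \<Longrightarrow> wiener_integral M W g a s (K s)"
    and g: "continuous_on {a..b} g" and \<psi>: "continuous_on {a..b} \<psi>"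
  obtains N p c where "\<And>n. p n 0 = a" "\<And>n. p n (N n) = b"
    "\<And>n j. j < N n \<Longrightarrow> p n j \<le> p n (Suc j)"
    "\<And>n. (\<integral>\<^sup>+\<omega>. ennreal (norm ((\<Sum>j<N n. c n j *\<^sub>R (W (p n (Suc j)) \<omega> - W (p n j) \<omega>))
       - (\<Sum>i<Suc n. \<psi> (unif a b n i) *\<^sub>R (K (unif a b n (Suc i)) \<omega> - K (unif a b n i) \<omega>)))) \<partial>M)
       \<le> ennreal (1 / real (Suc n))"
    "(\<lambda>n. \<Sum>j<N n. (c n j)\<^sup>2 * (p n (Suc j) - p n j)) \<longlonglongrightarrow> integral {a..b} (\<lambda>s. (\<psi> s)\<^sup>2 * (g s)\<^sup>2)"
proof -
  define P where "P n N p r \<longleftrightarrow> p 0 = a \<and> p N = b \<and>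
    (\<forall>j<N. p j \<le> p (Suc j) \<and> r j \<in> {a..b} \<and> p (Suc j) - p j \<le> (b - a) / real (Suc n)) \<and>
    (\<forall>j s. j < N \<longrightarrow> s \<in> {p j..p (Suc j)} \<longrightarrow> \<bar>r j - s\<bar> \<le> (b - a) / real (Suc n)) \<and>
    (\<integral>\<^sup>+\<omega>. ennreal (norm ((\<Sum>j<N. (\<psi> (r j) * g (p j)) *\<^sub>R (W (p (Suc j)) \<omega> - W (p j) \<omega>))
       - (\<Sum>i<Suc n. \<psi> (unif a b n i) *\<^sub>R (K (unif a b n (Suc i)) \<omega> - K (unif a b n i) \<omega>)))) \<partial>M)
     \<le> ennreal (1 / real (Suc n))" for n N p and r :: "nat \<Rightarrow> real"
  have "\<exists>N p r. P n N p r" for n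
  proof (rule wiener_step_approx[OF W ab K, where \<eta> = "1 / real (Suc n)" and n = n and \<psi> = \<psi>])
    fix p N r
    assume *: "p 0 = a" "p N = b"
      "\<And>j. j < N \<Longrightarrow> p j \<le> p (Suc j) \<and> r j \<in> {a..b} \<and> p (Suc j) - p j \<le> (b - a) / real (Suc n)"
      "\<And>j s. j < N \<Longrightarrow> s \<in> {p j..p (Suc j)} \<Longrightarrow> \<bar>r j - s\<bar> \<le> (b - a) / real (Suc n)"
      "(\<integral>\<^sup>+\<omega>. ennreal (norm ((\<Sum>j<N. (\<psi> (r j) * g (p j)) *\<^sub>R (W (p (Suc j)) \<omega> - W (p j) \<omega>))
       - (\<Sum>i<Suc n. \<psi> (unif a b n i) *\<^sub>R (K (unif a b n (Suc i)) \<omega> - K (unif a b n i) \<omega>)))) \<partial>M)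
       \<le> ennreal (1 / real (Suc n))"
    show ?thesis
      unfolding P_def by (rule exI[of _ N], rule exI[of _ p], rule exI[of _ r]) (use * in blast)
  qed simp_all
  then obtain N p r where "\<And>n. P n (N n) (p n) (r n)"
    by metis
  then have *: "p n 0 = a \<and> p n (N n) = b \<and>
    (\<forall>j<N n. p n j \<le> p n (Suc j) \<and> r n j \<in> {a..b} \<and> p n (Suc j) - p n j \<le> (b - a) / real (Suc n)) \<and>
    (\<forall>j s. j < N n \<longrightarrow> s \<in> {p n j..p n (Suc j)} \<longrightarrow> \<bar>r n j - s\<bar> \<le> (b - a) / real (Suc n)) \<and>
    (\<integral>\<^sup>+\<omega>. ennreal (norm ((\<Sum>j<N n. (\<psi> (r n j) * g (p n j)) *\<^sub>R (W (p n (Suc j)) \<omega> - W (p n j) \<omega>))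
       - (\<Sum>i<Suc n. \<psi> (unif a b n i) *\<^sub>R (K (unif a b n (Suc i)) \<omega> - K (unif a b n i) \<omega>)))) \<partial>M)
     \<le> ennreal (1 / real (Suc n))" for n
    unfolding P_def by blast
  have mem: "p n j \<in> {a..b}" if "j \<le> N n" for n j
    using partition_mono[of "N n" "p n" 0 j] partition_mono[of "N n" "p n" j "N n"] *[of n] that by auto
  \<comment> \<open>H does not vary with the running argument, so its integral over a step is the
    variance of one increment; u stands for the coarse node of \<open>\<psi>\<close> and v for the
    fine node of g.\<close>
  define H where "H = (\<lambda>(s::real, u, v). (\<psi> u)\<^sup>2 * (g v)\<^sup>2)"
  have cont': "continuous_on S (\<lambda>y. f (k y))"
    if "continuous_on {a..b} f" "continuous_on S k" "k ` S \<subseteq> {a..b}"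
    for f :: "real \<Rightarrow> real" and S :: "(real \<times> real \<times> real) set" and k
    using that by (rule continuous_on_compose2)
  have contH: "continuous_on ({a..b} \<times> {a..b} \<times> {a..b}) H"
    unfolding H_def case_prod_beta
    by (intro continuous_intros cont'[OF g] cont'[OF \<psi>]) auto
  have lim: "(\<lambda>n. \<Sum>j<N n. integral {p n j..p n (Suc j)} (\<lambda>s. H (s, r n j, p n j)))
    \<longlonglongrightarrow> integral {a..b} (\<lambda>s. H (s, s, s))"
  proof (rule riemann_sum_limit[OF contH])
    fix n j :: nat
    show "p n 0 = a" "p n (N n) = b" using * by auto
    fix s assume j: "j < N n"
    then have j': "p n j \<le> p n (Suc j)" "r n j \<in> {a..b}" "p n (Suc j) - p n j \<le> (b - a) / real (Suc n)"
      using * by auto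
    then show "p n j \<le> p n (Suc j)" "r n j \<in> {a..b}" "p n j \<in> {a..b}"
      using mem[of j n] j by auto
    assume s: "s \<in> {p n j..p n (Suc j)}"
    then show "\<bar>r n j - s\<bar> \<le> (b - a) / real (Suc n)" using * j by blast
    show "\<bar>p n j - s\<bar> \<le> (b - a) / real (Suc n)" using s j'(3) by auto
  qed
  have "(\<Sum>j<N n. integral {p n j..p n (Suc j)} (\<lambda>s. H (s, r n j, p n j)))
      = (\<Sum>j<N n. (\<psi> (r n j) * g (p n j))\<^sup>2 * (p n (Suc j) - p n j))" for n
    using *[of n] by (intro sum.cong) (auto simp: H_def power_mult_distrib)
  with lim have lim': "(\<lambda>n. \<Sum>j<N n. (\<psi> (r n j) * g (p n j))\<^sup>2 * (p n (Suc j) - p n j))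
      \<longlonglongrightarrow> integral {a..b} (\<lambda>s. (\<psi> s)\<^sup>2 * (g s)\<^sup>2)"
    by (simp add: H_def)
  show ?thesis
    by (rule that[of p N "\<lambda>n j. \<psi> (r n j) * g (p n j)"]) (use * lim' in blast)+
qed

text \<open>Independence survives the limit because it is never taken apart: for each n the
  approximations on both intervals come from one joined partition, so the pair already has a product
  Gaussian law, and the limit is taken for the pair.\<close>

lemma distr_wiener_integral_pair:
  fixes W :: "real \<Rightarrow> 'w \<Rightarrow> 'a::euclidean_space"
  assumes W: "wiener_process M W" and st: "0 \<le> s" "s \<le> t"
    and g: "continuous_on {0..t} g" and \<psi>: "continuous_on {0..t} \<psi>"
    and K: "\<And>u. u \<in> {0..t} \<Longrightarrow> wiener_integral M W g 0 u (K u)"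
    and V [measurable]: "V \<in> borel_measurable M" "V' \<in> borel_measurable M"
    and lim: "AE \<omega> in M. (\<lambda>n. \<Sum>i<Suc n. \<psi> (unif 0 s n i) *\<^sub>R (K (unif 0 s n (Suc i)) \<omega> - K (unif 0 s n i) \<omega>)) \<longlonglongrightarrow> V \<omega>"
    and lim': "AE \<omega> in M. (\<lambda>n. \<Sum>i<Suc n. \<psi> (unif s t n i) *\<^sub>R (K (unif s t n (Suc i)) \<omega> - K (unif s t n i) \<omega>)) \<longlonglongrightarrow> V' \<omega>"
  shows "distr M borel (\<lambda>\<omega>. (V \<omega>, V' \<omega>)) =
    gauss_law 0 (integral {0..s} (\<lambda>u. (\<psi> u)\<^sup>2 * (g u)\<^sup>2)) \<Otimes>\<^sub>M gauss_law 0 (integral {s..t} (\<lambda>u. (\<psi> u)\<^sup>2 * (g u)\<^sup>2))"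
proof -
  interpret prob_space M using W by (simp add: wiener_process_def)
  define S where "S n \<omega> = (\<Sum>i<Suc n. \<psi> (unif 0 s n i) *\<^sub>R (K (unif 0 s n (Suc i)) \<omega> - K (unif 0 s n i) \<omega>))" for n \<omega>
  define S' where "S' n \<omega> = (\<Sum>i<Suc n. \<psi> (unif s t n i) *\<^sub>R (K (unif s t n (Suc i)) \<omega> - K (unif s t n i) \<omega>))" for n \<omega>
  have measK: "K u \<in> borel_measurable M" if "u \<in> {0..t}" for u
    using K[OF that] by (simp add: wiener_integral_def)
  have um: "unif 0 s n i \<in> {0..t}" "unif s t n i \<in> {0..t}" if "i \<le> Suc n" for n i
    using unif_mem[of 0 s i n] unif_mem[of s t i n] st that by auto
  have [measurable]: "S n \<in> borel_measurable M" "S' n \<in> borel_measurable M" for n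
    unfolding S_def S'_def
    by (intro borel_measurable_sum borel_measurable_scaleR borel_measurable_diff borel_measurable_const measK um; auto)+
  \<comment> \<open>The approximation on the second interval needs integrals that start at s.
    Subtracting K s leaves the increments of K, and hence S', unchanged.\<close>
  have K': "wiener_integral M W g s u (\<lambda>\<omega>. K u \<omega> - K s \<omega>)" if "u \<in> {s..t}" for u
    using that st by (intro wiener_integral_diff W K) auto
  have sub: "{0..s} \<subseteq> {0..t}" "{s..t} \<subseteq> {0..t}" using st by auto
  obtain N p c where 1: "\<And>n. p n 0 = 0" "\<And>n. p n (N n) = s"
    "\<And>n j. j < N n \<Longrightarrow> p n j \<le> p n (Suc j)"
    "\<And>n. (\<integral>\<^sup>+\<omega>. ennreal (norm ((\<Sum>j<N n. c n j *\<^sub>R (W (p n (Suc j)) \<omega> - W (p n j) \<omega>)) - S n \<omega>)) \<partial>M)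
       \<le> ennreal (1 / real (Suc n))"
    "(\<lambda>n. \<Sum>j<N n. (c n j)\<^sup>2 * (p n (Suc j) - p n j)) \<longlonglongrightarrow> integral {0..s} (\<lambda>u. (\<psi> u)\<^sup>2 * (g u)\<^sup>2)"
    unfolding S_def using st sub
    by (rule_tac wiener_step_approx_seq[OF W order_refl st(1) K continuous_on_subset[OF g] continuous_on_subset[OF \<psi>]]) auto
  obtain N' p' c' where 2: "\<And>n. p' n 0 = s" "\<And>n. p' n (N' n) = t"
    "\<And>n j. j < N' n \<Longrightarrow> p' n j \<le> p' n (Suc j)"
    "\<And>n. (\<integral>\<^sup>+\<omega>. ennreal (norm ((\<Sum>j<N' n. c' n j *\<^sub>R (W (p' n (Suc j)) \<omega> - W (p' n j) \<omega>)) - S' n \<omega>)) \<partial>M)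
       \<le> ennreal (1 / real (Suc n))"
    "(\<lambda>n. \<Sum>j<N' n. (c' n j)\<^sup>2 * (p' n (Suc j) - p' n j)) \<longlonglongrightarrow> integral {s..t} (\<lambda>u. (\<psi> u)\<^sup>2 * (g u)\<^sup>2)"
  proof (rule wiener_step_approx_seq[OF W st K' continuous_on_subset[OF g sub(2)] continuous_on_subset[OF \<psi> sub(2)]])
    fix N' p' c'
    assume "\<And>n. (\<integral>\<^sup>+\<omega>. ennreal (norm ((\<Sum>j<N' n. c' n j *\<^sub>R (W (p' n (Suc j)) \<omega> - W (p' n j) \<omega>))
       - (\<Sum>i<Suc n. \<psi> (unif s t n i) *\<^sub>R ((K (unif s t n (Suc i)) \<omega> - K s \<omega>) - (K (unif s t n i) \<omega> - K s \<omega>))))) \<partial>M)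
       \<le> ennreal (1 / real (Suc n))"
    then have "\<And>n. (\<integral>\<^sup>+\<omega>. ennreal (norm ((\<Sum>j<N' n. c' n j *\<^sub>R (W (p' n (Suc j)) \<omega> - W (p' n j) \<omega>)) - S' n \<omega>)) \<partial>M)
       \<le> ennreal (1 / real (Suc n))"
      unfolding S'_def by (simp only: diff_diff_eq2 diff_add_cancel)
    moreover assume "\<And>n. p' n 0 = s" "\<And>n. p' n (N' n) = t" "\<And>n j. j < N' n \<Longrightarrow> p' n j \<le> p' n (Suc j)"
      "(\<lambda>n. \<Sum>j<N' n. (c' n j)\<^sup>2 * (p' n (Suc j) - p' n j)) \<longlonglongrightarrow> integral {s..t} (\<lambda>u. (\<psi> u)\<^sup>2 * (g u)\<^sup>2)"
    ultimately show thesis by (intro that)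
  qed
  define u where "u n = (\<Sum>j<N n. (c n j)\<^sup>2 * (p n (Suc j) - p n j))" for n
  define u' where "u' n = (\<Sum>j<N' n. (c' n j)\<^sup>2 * (p' n (Suc j) - p' n j))" for n
  define A where "A n \<omega> = (\<Sum>j<N n. c n j *\<^sub>R (W (p n (Suc j)) \<omega> - W (p n j) \<omega>))" for n \<omega>
  define A' where "A' n \<omega> = (\<Sum>j<N' n. c' n j *\<^sub>R (W (p' n (Suc j)) \<omega> - W (p' n j) \<omega>))" for n \<omega>
  have mW: "W v \<in> borel_measurable M" if "0 \<le> v" for v
    using W that by (simp add: wiener_process_def)
  have nn: "0 \<le> p n j" if "j \<le> N n" for n j
    using partition_mono[of "N n" "p n" 0 j] 1 that by auto
  have nn': "0 \<le> p' n j" if "j \<le> N' n" for n j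
    using partition_mono[of "N' n" "p' n" 0 j] 2 st that by auto
  have [measurable]: "A n \<in> borel_measurable M" "A' n \<in> borel_measurable M" for n
    unfolding A_def A'_def
    by (intro borel_measurable_sum borel_measurable_scaleR borel_measurable_diff borel_measurable_const mW nn nn'; auto)+
  have law: "distr M borel (\<lambda>\<omega>. (A n \<omega>, A' n \<omega>)) = gauss_law 0 (u n) \<Otimes>\<^sub>M gauss_law 0 (u' n)" for n
  proof -
    \<comment> \<open>The two partitions are joined at index N n, where both take the value
      s.\<close>
    define \<tau> where "\<tau> i = (if i \<le> N n then p n i else p' n (i - N n))" for i
    define k where "k i = (if i < N n then c n i else c' n (i - N n))" for i
    have \<tau>1: "\<tau> i = p n i" if "i \<le> N n" for i using that by (simp add: \<tau>_def)
    have \<tau>2: "\<tau> (i + N n) = p' n i" for i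
      using 1(2)[of n] 2(1)[of n] by (cases i) (auto simp: \<tau>_def)
    have "distr M borel (\<lambda>\<omega>. (\<Sum>i<N n. k i *\<^sub>R (W (\<tau> (Suc i)) \<omega> - W (\<tau> i) \<omega>),
                            \<Sum>i=N n..<N n + N' n. k i *\<^sub>R (W (\<tau> (Suc i)) \<omega> - W (\<tau> i) \<omega>)))
     = gauss_law 0 (\<Sum>i<N n. (k i)\<^sup>2 * (\<tau> (Suc i) - \<tau> i)) \<Otimes>\<^sub>M
       gauss_law 0 (\<Sum>i=N n..<N n + N' n. (k i)\<^sup>2 * (\<tau> (Suc i) - \<tau> i))"
    proof (rule distr_wiener_sum_pair[OF W])
      show "0 \<le> \<tau> 0" using 1 by (simp add: \<tau>_def)
      fix i assume i: "i < N n + N' n"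
      show "\<tau> i \<le> \<tau> (Suc i)"
      proof (cases "i < N n")
        case True
        then show ?thesis using 1(3) by (simp add: \<tau>1)
      next
        case False
        then obtain j where "i = j + N n" by (metis le_add_diff_inverse2 not_less)
        then show ?thesis using i 2(3)[of j n] \<tau>2[of j] \<tau>2[of "Suc j"] by simp
      qed
    qed
    moreover have "(\<Sum>i<N n. k i *\<^sub>R (W (\<tau> (Suc i)) \<omega> - W (\<tau> i) \<omega>)) = A n \<omega>" for \<omega>
      unfolding A_def by (intro sum.cong) (auto simp: \<tau>1 k_def)
    moreover have "(\<Sum>i<N n. (k i)\<^sup>2 * (\<tau> (Suc i) - \<tau> i)) = u n"
      unfolding u_def by (intro sum.cong) (auto simp: \<tau>1 k_def)
    moreover have "(\<Sum>i=N n..<N n + N' n. f i) = (\<Sum>j<N' n. f (j + N n))" for f :: "nat \<Rightarrow> 'a"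
      using sum.shift_bounds_nat_ivl[of f 0 "N n" "N' n"] by (simp add: atLeast0LessThan add.commute)
    moreover have "(\<Sum>i=N n..<N n + N' n. f i) = (\<Sum>j<N' n. f (j + N n))" for f :: "nat \<Rightarrow> real"
      using sum.shift_bounds_nat_ivl[of f 0 "N n" "N' n"] by (simp add: atLeast0LessThan add.commute)
    moreover have "\<tau> (Suc (j + N n)) = p' n (Suc j)" for j
      using \<tau>2[of "Suc j"] by simp
    ultimately show ?thesis
      unfolding A'_def u'_def by (simp add: \<tau>2 k_def)
  qed
  let ?G = "density lborel (gauss_density (0::'a) 1)"
  let ?v = "integral {0..s} (\<lambda>u. (\<psi> u)\<^sup>2 * (g u)\<^sup>2)" and ?v' = "integral {s..t} (\<lambda>u. (\<psi> u)\<^sup>2 * (g u)\<^sup>2)"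
  interpret G: prob_space ?G by (rule prob_space_density_gauss) simp
  interpret GG: pair_prob_space ?G ?G ..
  have sG: "sets (?G \<Otimes>\<^sub>M ?G) = sets (borel \<Otimes>\<^sub>M borel)"
    by (intro sets_pair_measure_cong) simp_all
  have mz: "(\<lambda>z. (a *\<^sub>R fst z, b *\<^sub>R snd z)) \<in> borel_measurable (?G \<Otimes>\<^sub>M ?G)" for a b
    by (simp add: borel_prod[symmetric] cong: measurable_cong_sets)
  have "distr M borel (\<lambda>\<omega>. (V \<omega>, V' \<omega>)) = distr (?G \<Otimes>\<^sub>M ?G) borel (\<lambda>z. (sqrt ?v *\<^sub>R fst z, sqrt ?v' *\<^sub>R snd z))"
  proof (rule distr_limit_eqI)
    show "prob_space (?G \<Otimes>\<^sub>M ?G)" by (rule GG.prob_space_axioms)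
    show "distr M borel (\<lambda>\<omega>. (A n \<omega>, A' n \<omega>)) = distr (?G \<Otimes>\<^sub>M ?G) borel (\<lambda>z. (sqrt (u n) *\<^sub>R fst z, sqrt (u' n) *\<^sub>R snd z))" for n
      unfolding law by (rule gauss_law_pair_eq_distr)
    show "(\<lambda>n. (sqrt (u n) *\<^sub>R fst z, sqrt (u' n) *\<^sub>R snd z)) \<longlonglongrightarrow> (sqrt ?v *\<^sub>R fst z, sqrt ?v' *\<^sub>R snd z)" for z :: "'a \<times> 'a"
      unfolding u_def u'_def using 1(5) 2(5) by (intro tendsto_intros)
    show "AE \<omega> in M. (\<lambda>n. (S n \<omega>, S' n \<omega>)) \<longlonglongrightarrow> (V \<omega>, V' \<omega>)"
      using lim lim' by eventually_elim (simp add: S_def S'_def tendsto_Pair)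
    \<comment> \<open>One error 1 / (n + 1) for each component of the pair.\<close>
    show "(\<lambda>n. 2 / real (Suc n)) \<longlonglongrightarrow> 0"
      by (intro lim_const_over_n[THEN LIMSEQ_Suc])
    show "0 \<le> 2 / real (Suc n)" for n by simp
    show "(\<integral>\<^sup>+\<omega>. ennreal (dist (A n \<omega>, A' n \<omega>) (S n \<omega>, S' n \<omega>)) \<partial>M) \<le> ennreal (2 / real (Suc n))" for n
    proof -
      have "(\<integral>\<^sup>+\<omega>. ennreal (dist (A n \<omega>, A' n \<omega>) (S n \<omega>, S' n \<omega>)) \<partial>M)
        \<le> (\<integral>\<^sup>+\<omega>. ennreal (norm (A n \<omega> - S n \<omega>)) + ennreal (norm (A' n \<omega> - S' n \<omega>)) \<partial>M)"
        by (intro nn_integral_mono)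
          (simp add: ennreal_plus[symmetric] ennreal_leI dist_Pair_le dist_norm[symmetric] del: ennreal_plus)
      also have "\<dots> = (\<integral>\<^sup>+\<omega>. ennreal (norm (A n \<omega> - S n \<omega>)) \<partial>M) + (\<integral>\<^sup>+\<omega>. ennreal (norm (A' n \<omega> - S' n \<omega>)) \<partial>M)"
        by (intro nn_integral_add) measurable
      also have "\<dots> \<le> ennreal (1 / real (Suc n)) + ennreal (1 / real (Suc n))"
        unfolding A_def A'_def by (intro add_mono 1(4) 2(4))
      also have "\<dots> = ennreal (2 / real (Suc n))"
        by (simp add: ennreal_plus[symmetric] add_divide_distrib[symmetric] del: ennreal_plus)
      finally show ?thesis .
    qed
  qed (simp_all add: mz borel_prod[symmetric] del: borel_prod)
  then show ?thesis
    by (simp only: gauss_law_pair_eq_distr)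
qed

text \<open>The difference X - m obeys the equation without its constant term, so
  \<open>\<psi>\<close> times it has no drift left. Its values at s and its increment up to t are
  pathwise limits of sums over disjoint intervals, which fixes their joint law.\<close>

lemma linear_sde_pair:
  fixes W :: "real \<Rightarrow> 'w \<Rightarrow> 'a::euclidean_space" and a \<psi> g :: "real \<Rightarrow> real" and c m :: "real \<Rightarrow> 'a"
  assumes W: "wiener_process M W"
    and X: "sde_solution M W T x0 b g X"
    and b: "\<And>s x. s \<in> {0..T} \<Longrightarrow> b s x = a s *\<^sub>R x + c s"
    and cont: "continuous_on {0..T} a" "continuous_on {0..T} c" "continuous_on {0..T} g"
    and \<psi>: "\<And>s. s \<in> {0..T} \<Longrightarrow> (\<psi> has_real_derivative (- a s * \<psi> s)) (at s within {0..T})"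
    and m: "\<And>s. s \<in> {0..T} \<Longrightarrow> (m has_vector_derivative (a s *\<^sub>R m s + c s)) (at s within {0..T})"
    and m0: "m 0 = x0" and st: "0 \<le> s" "s \<le> t" "t \<le> T"
  shows "distr M borel (\<lambda>\<omega>. (\<psi> s *\<^sub>R (X s \<omega> - m s), \<psi> t *\<^sub>R (X t \<omega> - m t) - \<psi> s *\<^sub>R (X s \<omega> - m s))) =
    gauss_law 0 (integral {0..s} (\<lambda>u. (\<psi> u)\<^sup>2 * (g u)\<^sup>2)) \<Otimes>\<^sub>M gauss_law 0 (integral {s..t} (\<lambda>u. (\<psi> u)\<^sup>2 * (g u)\<^sup>2))"
proof -
  have "\<forall>u\<in>{0..T}. \<exists>I. wiener_integral M W g 0 u I \<and>
        (AE \<omega> in M. ((\<lambda>s. b s (X s \<omega>)) has_integral (X u \<omega> - x0 - I \<omega>)) {0..u})"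
    using X by (simp add: sde_solution_def)
  from bchoice[OF this] obtain K where K: "\<And>u. u \<in> {0..T} \<Longrightarrow> wiener_integral M W g 0 u (K u)"
    and XK: "\<And>u. u \<in> {0..T} \<Longrightarrow> AE \<omega> in M. ((\<lambda>s. b s (X s \<omega>)) has_integral (X u \<omega> - x0 - K u \<omega>)) {0..u}"
    by blast
  have XK': "AE \<omega> in M. ((\<lambda>s. a s *\<^sub>R X s \<omega> + c s) has_integral (X u \<omega> - x0 - K u \<omega>)) {0..u}" if "u \<in> {0..T}" for u
    using XK[OF that]
  proof eventually_elim
    case (elim \<omega>)
    then show ?case
      using that by (subst (asm) has_integral_cong[where g="\<lambda>s. a s *\<^sub>R X s \<omega> + c s"]) (auto simp: b)
  qed
  have contX: "AE \<omega> in M. continuous_on {0..T} (\<lambda>t. X t \<omega>)"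
    and [measurable]: "X s \<in> borel_measurable M" "X t \<in> borel_measurable M"
    using X st by (auto simp: sde_solution_def)
  have "0 \<in> {0..T}" using st by simp
  \<comment> \<open>The initial value is read off from the equation at time 0, where both integrals
    vanish almost surely.\<close>
  have X0: "AE \<omega> in M. X 0 \<omega> = x0"
    using XK'[OF \<open>0 \<in> {0..T}\<close>] wiener_integral_zero_AE[OF K[OF \<open>0 \<in> {0..T}\<close>]]
  proof eventually_elim
    case (elim \<omega>)
    from elim(1) have "((\<lambda>s. a s *\<^sub>R X s \<omega> + c s) has_integral (X 0 \<omega> - x0 - K 0 \<omega>)) {0}"
      by simp
    from has_integral_unique[OF this has_integral_refl(2)] have "X 0 \<omega> - x0 - K 0 \<omega> = 0" .
    with elim show ?case by simp
  qed
  have lim: "AE \<omega> in M. (\<lambda>n. \<Sum>i<Suc n. \<psi> (unif A B n i) *\<^sub>R (K (unif A B n (Suc i)) \<omega> - K (unif A B n i) \<omega>))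
     \<longlonglongrightarrow> \<psi> B *\<^sub>R (X B \<omega> - m B) - \<psi> A *\<^sub>R (X A \<omega> - m A)" if AB: "0 \<le> A" "A \<le> B" "B \<le> T" for A B
  proof -
    have sub: "{A..B} \<subseteq> {0..T}" using AB by auto
    have "unif A B n i \<in> {0..T}" if "i \<le> Suc n" for i n
      using unif_mem[OF AB(2) that] AB by auto
    \<comment> \<open>The null set of the equation depends on the time. The nodes of all equidistant
      partitions are countably many, so one null set covers them.\<close>
    then have "AE \<omega> in M. \<forall>n. \<forall>i\<in>{..Suc n}. ((\<lambda>s. a s *\<^sub>R X s \<omega> + c s) has_integral
        (X (unif A B n i) \<omega> - x0 - K (unif A B n i) \<omega>)) {0..unif A B n i}"
      by (subst AE_all_countable, intro allI AE_finite_allI XK') auto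
    with contX show ?thesis
    proof eventually_elim
      case (elim \<omega>)
      show ?case
      proof (rule riemann_sum_path_limit[OF AB(1,2)])
        show "continuous_on {A..B} (\<lambda>u. X u \<omega>)" "continuous_on {A..B} a" "continuous_on {A..B} c"
          using elim(1) cont sub by (auto intro: continuous_on_subset)
        show "(\<psi> has_real_derivative - a s * \<psi> s) (at s within {A..B})" if "s \<in> {A..B}" for s
          using that sub by (intro has_field_derivative_subset[OF \<psi> sub]) auto
        show "(m has_vector_derivative a s *\<^sub>R m s + c s) (at s within {A..B})" if "s \<in> {A..B}" for s
          using that sub by (intro has_vector_derivative_within_subset[OF m sub]) auto
        show "((\<lambda>s. a s *\<^sub>R X s \<omega> + c s) has_integral (X (unif A B n i) \<omega> - x0 - K (unif A B n i) \<omega>)) {0..unif A B n i}"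
          if "i \<le> Suc n" for n i
          using elim(2) that by auto
      qed
    qed
  qed
  show ?thesis
  proof (rule distr_wiener_integral_pair[OF W st(1,2)])
    have sub: "{0..t} \<subseteq> {0..T}" using st by auto
    show "continuous_on {0..t} g" "continuous_on {0..t} \<psi>"
      using cont(3) DERIV_continuous_on[of "{0..T}" \<psi>, OF \<psi>] sub by (auto intro: continuous_on_subset)
    show "wiener_integral M W g 0 u (K u)" if "u \<in> {0..t}" for u
      using that sub by (intro K) auto
    have "0 \<le> (0::real)" "s \<le> T" using st by auto
    from X0 lim[OF this(1) st(1) this(2)]
    show "AE \<omega> in M. (\<lambda>n. \<Sum>i<Suc n. \<psi> (unif 0 s n i) *\<^sub>R (K (unif 0 s n (Suc i)) \<omega> - K (unif 0 s n i) \<omega>))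
      \<longlonglongrightarrow> \<psi> s *\<^sub>R (X s \<omega> - m s)"
      by eventually_elim (simp add: m0 del: sum.lessThan_Suc)
    show "AE \<omega> in M. (\<lambda>n. \<Sum>i<Suc n. \<psi> (unif s t n i) *\<^sub>R (K (unif s t n (Suc i)) \<omega> - K (unif s t n i) \<omega>))
      \<longlonglongrightarrow> \<psi> t *\<^sub>R (X t \<omega> - m t) - \<psi> s *\<^sub>R (X s \<omega> - m s)"
      using st by (intro lim)
  qed measurable
qed

lemma distr_affine_gauss_law_pair:
  fixes A B :: "'w \<Rightarrow> 'a::euclidean_space"
  assumes [measurable]: "A \<in> borel_measurable M" "B \<in> borel_measurable M"
    and law: "distr M borel (\<lambda>\<omega>. (A \<omega>, B \<omega>)) = gauss_law 0 u \<Otimes>\<^sub>M gauss_law 0 w"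
    and "0 \<le> u" "0 \<le> w"
  shows "distr M borel (\<lambda>\<omega>. (b + k *\<^sub>R A \<omega>, l *\<^sub>R B \<omega>)) = gauss_law b (k\<^sup>2 * u) \<Otimes>\<^sub>M gauss_law 0 (l\<^sup>2 * w)"
proof -
  have 1: "gauss_law b (k\<^sup>2 * u) = distr (gauss_law 0 u) borel (\<lambda>x. b + k *\<^sub>R x)"
    and 2: "gauss_law 0 (l\<^sup>2 * w) = distr (gauss_law (0::'a) w) borel (\<lambda>x. 0 + l *\<^sub>R x)"
    using assms by (simp_all only: distr_gauss_law_affine) simp_all
  have "sigma_finite_measure (distr (gauss_law (0::'a) w) borel (\<lambda>x. 0 + l *\<^sub>R x))"
    unfolding 2[symmetric]
    by (intro finite_measure.sigma_finite_measure prob_space.axioms(1) prob_space_gauss_law)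
  then have "gauss_law b (k\<^sup>2 * u) \<Otimes>\<^sub>M gauss_law (0::'a) (l\<^sup>2 * w)
      = distr (gauss_law 0 u \<Otimes>\<^sub>M gauss_law (0::'a) w) (borel \<Otimes>\<^sub>M borel) (\<lambda>(x, y). (b + k *\<^sub>R x, 0 + l *\<^sub>R y))"
    unfolding 1 2 by (intro pair_measure_distr) simp_all
  also have "\<dots> = distr M borel (\<lambda>\<omega>. (b + k *\<^sub>R A \<omega>, l *\<^sub>R B \<omega>))"
    unfolding law[symmetric] borel_prod[symmetric]
    by (subst distr_distr) (simp_all add: comp_def)
  finally show ?thesis ..
qed

text \<open>Dividing by \<open>\<psi>\<close> turns the increment into the prediction error of X t
  given X s. Its independence of X s is the form of the Markov property used later.\<close>

lemma linear_sde_joint_law: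
  fixes W :: "real \<Rightarrow> 'w \<Rightarrow> 'a::euclidean_space" and a \<psi> g :: "real \<Rightarrow> real" and c m :: "real \<Rightarrow> 'a"
  assumes W: "wiener_process M W"
    and X: "sde_solution M W T x0 b g X"
    and b: "\<And>s x. s \<in> {0..T} \<Longrightarrow> b s x = a s *\<^sub>R x + c s"
    and cont: "continuous_on {0..T} a" "continuous_on {0..T} c" "continuous_on {0..T} g"
    and \<psi>: "\<And>s. s \<in> {0..T} \<Longrightarrow> (\<psi> has_real_derivative (- a s * \<psi> s)) (at s within {0..T})"
    and m: "\<And>s. s \<in> {0..T} \<Longrightarrow> (m has_vector_derivative (a s *\<^sub>R m s + c s)) (at s within {0..T})"
    and m0: "m 0 = x0" and st: "0 \<le> s" "s \<le> t" "t \<le> T"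
    and pos: "\<psi> s \<noteq> 0" "\<psi> t \<noteq> 0"
  shows "distr M borel (\<lambda>\<omega>. (X s \<omega>, X t \<omega> - m t - (\<psi> s / \<psi> t) *\<^sub>R (X s \<omega> - m s))) =
    gauss_law (m s) (integral {0..s} (\<lambda>u. (\<psi> u)\<^sup>2 * (g u)\<^sup>2) / (\<psi> s)\<^sup>2) \<Otimes>\<^sub>M
    gauss_law 0 (integral {s..t} (\<lambda>u. (\<psi> u)\<^sup>2 * (g u)\<^sup>2) / (\<psi> t)\<^sup>2)"
proof -
  have [measurable]: "X s \<in> borel_measurable M" "X t \<in> borel_measurable M"
    using X st by (auto simp: sde_solution_def)
  have "continuous_on {0..T} (\<lambda>u. (\<psi> u)\<^sup>2 * (g u)\<^sup>2)"
    using cont DERIV_continuous_on[of "{0..T}" \<psi>, OF \<psi>] by (intro continuous_intros)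
  then have int: "(\<lambda>u. (\<psi> u)\<^sup>2 * (g u)\<^sup>2) integrable_on {p..q}" if "{p..q} \<subseteq> {0..T}" for p q
    using that by (intro integrable_continuous_real) (rule continuous_on_subset)
  have "distr M borel (\<lambda>\<omega>. (m s + (1 / \<psi> s) *\<^sub>R (\<psi> s *\<^sub>R (X s \<omega> - m s)),
      (1 / \<psi> t) *\<^sub>R (\<psi> t *\<^sub>R (X t \<omega> - m t) - \<psi> s *\<^sub>R (X s \<omega> - m s)))) =
    gauss_law (m s) ((1 / \<psi> s)\<^sup>2 * integral {0..s} (\<lambda>u. (\<psi> u)\<^sup>2 * (g u)\<^sup>2)) \<Otimes>\<^sub>M
    gauss_law 0 ((1 / \<psi> t)\<^sup>2 * integral {s..t} (\<lambda>u. (\<psi> u)\<^sup>2 * (g u)\<^sup>2))"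
  proof (rule distr_affine_gauss_law_pair)
    show "distr M borel (\<lambda>\<omega>. (\<psi> s *\<^sub>R (X s \<omega> - m s), \<psi> t *\<^sub>R (X t \<omega> - m t) - \<psi> s *\<^sub>R (X s \<omega> - m s))) =
      gauss_law 0 (integral {0..s} (\<lambda>u. (\<psi> u)\<^sup>2 * (g u)\<^sup>2)) \<Otimes>\<^sub>M gauss_law 0 (integral {s..t} (\<lambda>u. (\<psi> u)\<^sup>2 * (g u)\<^sup>2))"
      by (rule linear_sde_pair[OF W X b cont \<psi> m m0 st])
    show "0 \<le> integral {0..s} (\<lambda>u. (\<psi> u)\<^sup>2 * (g u)\<^sup>2)" "0 \<le> integral {s..t} (\<lambda>u. (\<psi> u)\<^sup>2 * (g u)\<^sup>2)"
      using st by (auto intro!: integral_nonneg int)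
  qed measurable
  then show ?thesis
    using pos by (simp add: power_divide scaleR_diff_right)
qed

text \<open>The joint law at two equal times, projected to its first factor; the second factor has
  mass 1 and so disappears.\<close>

lemma linear_sde_marginal_law:
  fixes W :: "real \<Rightarrow> 'w \<Rightarrow> 'a::euclidean_space" and a \<psi> g :: "real \<Rightarrow> real" and c m :: "real \<Rightarrow> 'a"
  assumes W: "wiener_process M W"
    and X: "sde_solution M W T x0 b g X"
    and b: "\<And>s x. s \<in> {0..T} \<Longrightarrow> b s x = a s *\<^sub>R x + c s"
    and cont: "continuous_on {0..T} a" "continuous_on {0..T} c" "continuous_on {0..T} g"
    and \<psi>: "\<And>s. s \<in> {0..T} \<Longrightarrow> (\<psi> has_real_derivative (- a s * \<psi> s)) (at s within {0..T})"
    and m: "\<And>s. s \<in> {0..T} \<Longrightarrow> (m has_vector_derivative (a s *\<^sub>R m s + c s)) (at s within {0..T})"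
    and m0: "m 0 = x0" and t: "0 \<le> t" "t \<le> T"
    and pos: "\<psi> t \<noteq> 0"
  shows "distr M borel (X t) = gauss_law (m t) (integral {0..t} (\<lambda>u. (\<psi> u)\<^sup>2 * (g u)\<^sup>2) / (\<psi> t)\<^sup>2)"
proof -
  have [measurable]: "X t \<in> borel_measurable M"
    using X t by (auto simp: sde_solution_def)
  let ?v = "integral {0..t} (\<lambda>u. (\<psi> u)\<^sup>2 * (g u)\<^sup>2) / (\<psi> t)\<^sup>2"
  let ?w = "integral {t..t} (\<lambda>u. (\<psi> u)\<^sup>2 * (g u)\<^sup>2) / (\<psi> t)\<^sup>2"
  interpret prob_space "gauss_law (0::'a) ?w" by (rule prob_space_gauss_law)
  have "gauss_law (m t) ?v = distr (gauss_law (m t) ?v \<Otimes>\<^sub>M gauss_law (0::'a) ?w) (gauss_law (m t) ?v) fst"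
    by (rule distr_pair_fst[symmetric])
  also have "\<dots> = distr (distr M borel (\<lambda>\<omega>. (X t \<omega>, X t \<omega> - m t - (\<psi> t / \<psi> t) *\<^sub>R (X t \<omega> - m t)))) borel fst"
  proof -
    have J: "distr M borel (\<lambda>\<omega>. (X t \<omega>, X t \<omega> - m t - (\<psi> t / \<psi> t) *\<^sub>R (X t \<omega> - m t)))
      = gauss_law (m t) ?v \<Otimes>\<^sub>M gauss_law 0 ?w"
      by (rule linear_sde_joint_law[OF W X b cont \<psi> m m0 t(1) order_refl t(2) pos pos])
    show ?thesis
      unfolding J by (rule distr_cong) simp_all
  qed
  also have "\<dots> = distr M borel (X t)"
    unfolding borel_prod[symmetric] by (subst distr_distr) (simp_all add: comp_def)
  finally show ?thesis ..
qed

lemma has_vector_derivative_scaleR_const: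
  "(f has_real_derivative D) (at x within S) \<Longrightarrow> ((\<lambda>s. f s *\<^sub>R v) has_vector_derivative D *\<^sub>R v) (at x within S)"
  using has_vector_derivative_scaleR[of f D x S "\<lambda>_. v" 0] by simp

section \<open>The Ornstein-Uhlenbeck process and its h-transform\<close>

locale gou_coefficients =
  fixes \<theta> g :: "real \<Rightarrow> real" and T :: real
  assumes T: "0 < T" and cont_\<theta>: "continuous_on {0..T} \<theta>" and cont_g: "continuous_on {0..T} g"
begin

text \<open>The integrating factor of the reference drift. Together with \<open>energy\<close> it
  replaces the two-time quantities by functions of one time:
  \<open>exp (- theta_bar \<theta> s t)\<close> is a quotient of values of \<open>growth\<close>,
  and \<open>var_bar\<close> a scaled increment of \<open>energy\<close>. Differentiating in either
  end point then becomes routine.\<close>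

definition growth :: "real \<Rightarrow> real" where
  "growth s = exp (theta_bar \<theta> 0 s)"

text \<open>The per-coordinate variance at time s of \<open>growth\<close> times the centred
  reference process.\<close>

definition energy :: "real \<Rightarrow> real" where
  "energy s = integral {0..s} (\<lambda>u. (growth u)\<^sup>2 * (g u)\<^sup>2)"

lemma growth_pos [simp]: "0 < growth s" "growth s \<noteq> 0"
  by (simp_all add: growth_def)

lemma growth_0 [simp]: "growth 0 = 1"
  by (simp add: growth_def theta_bar_def)

lemma energy_0 [simp]: "energy 0 = 0"
  by (simp add: energy_def)

lemma growth_deriv:
  assumes "s \<in> {0..T}"
  shows "(growth has_real_derivative \<theta> s * growth s) (at s within {0..T})"
proof -
  have "(theta_bar \<theta> 0 has_real_derivative \<theta> s) (at s within {0..T})"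
    unfolding theta_bar_def[abs_def] using cont_\<theta> assms by (rule integral_has_real_derivative)
  then show ?thesis
    unfolding growth_def[abs_def] by (auto intro!: derivative_eq_intros)
qed

lemma cont_growth: "continuous_on {0..T} growth"
  using growth_deriv by (rule DERIV_continuous_on)

lemma cont_energy_density: "continuous_on {0..T} (\<lambda>u. (growth u)\<^sup>2 * (g u)\<^sup>2)"
  by (intro continuous_intros cont_growth cont_g)

lemma energy_deriv:
  assumes "s \<in> {0..T}"
  shows "(energy has_real_derivative (growth s)\<^sup>2 * (g s)\<^sup>2) (at s within {0..T})"
  unfolding energy_def[abs_def] using cont_energy_density assms by (rule integral_has_real_derivative)

lemma integral_energy_density:
  assumes "0 \<le> s" "s \<le> t" "t \<le> T"
  shows "integral {s..t} (\<lambda>u. (growth u)\<^sup>2 * (g u)\<^sup>2) = energy t - energy s"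
proof -
  have "(\<lambda>u. (growth u)\<^sup>2 * (g u)\<^sup>2) integrable_on {0..t}"
    using assms by (intro integrable_continuous_real continuous_on_subset[OF cont_energy_density]) auto
  then show ?thesis
    using Henstock_Kurzweil_Integration.integral_combine[of 0 s t "\<lambda>u. (growth u)\<^sup>2 * (g u)\<^sup>2"] assms
    by (simp add: energy_def)
qed

lemma energy_mono: "0 \<le> s \<Longrightarrow> s \<le> t \<Longrightarrow> t \<le> T \<Longrightarrow> energy s \<le> energy t"
  using integral_energy_density[of s t]
    integral_nonneg[OF integrable_continuous_real[OF continuous_on_subset[OF cont_energy_density]], of s t]
  by simp

lemma exp_theta_bar:
  assumes "0 \<le> s" "s \<le> t" "t \<le> T"
  shows "exp (- theta_bar \<theta> s t) = growth s / growth t"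
proof -
  have "\<theta> integrable_on {0..t}"
    using assms by (intro integrable_continuous_real continuous_on_subset[OF cont_\<theta>]) auto
  then have "theta_bar \<theta> 0 s + theta_bar \<theta> s t = theta_bar \<theta> 0 t"
    using Henstock_Kurzweil_Integration.integral_combine[of 0 s t \<theta>] assms by (simp add: theta_bar_def)
  then have "- theta_bar \<theta> s t = theta_bar \<theta> 0 s - theta_bar \<theta> 0 t" by simp
  then show ?thesis by (simp only: growth_def exp_diff)
qed

lemma var_bar_eq:
  assumes "0 \<le> s" "s \<le> t" "t \<le> T"
  shows "var_bar \<theta> g s t = (energy t - energy s) / (growth t)\<^sup>2"
proof -
  have "var_bar \<theta> g s t = integral {s..t} (\<lambda>u. ((growth u)\<^sup>2 * (g u)\<^sup>2) / (growth t)\<^sup>2)"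
    unfolding var_bar_def
  proof (rule integral_cong)
    fix u assume "u \<in> {s..t}"
    then have "exp (- theta_bar \<theta> u t) = growth u / growth t"
      using assms by (intro exp_theta_bar) auto
    moreover have "exp (- 2 * theta_bar \<theta> u t) = (exp (- theta_bar \<theta> u t))\<^sup>2"
      by (simp add: exp_double[symmetric])
    ultimately show "exp (- 2 * theta_bar \<theta> u t) * (g u)\<^sup>2 = (growth u)\<^sup>2 * (g u)\<^sup>2 / (growth t)\<^sup>2"
      by (simp add: power_divide)
  qed
  then show ?thesis
    using integral_energy_density[OF assms] by simp
qed

lemma var_bar_nonneg: "0 \<le> s \<Longrightarrow> s \<le> t \<Longrightarrow> t \<le> T \<Longrightarrow> 0 \<le> var_bar \<theta> g s t"
  using energy_mono[of s t] by (simp add: var_bar_eq)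

lemma mu_bar_eq:
  assumes "0 \<le> s" "s \<le> t" "t \<le> T"
  shows "mu_bar \<theta> \<mu> s t x = (growth s / growth t) *\<^sub>R x + (1 - growth s / growth t) *\<^sub>R \<mu>"
  unfolding mu_bar_def exp_theta_bar[OF assms] ..

section \<open>The function h, its logarithmic gradient and the closed form of the density\<close>

lemma gou_law_eq_gauss_law:
  assumes "0 \<le> s" "s \<le> t" "t \<le> T"
  shows "gou_law \<theta> g \<mu> s x t = gauss_law (mu_bar \<theta> \<mu> s t x) (var_bar \<theta> g s t)"
  using var_bar_nonneg[OF assms]
  by (auto simp: gou_law_def gauss_law_0 gou_density_def[abs_def] gauss_law_eq_density)

text \<open>Smoothing a Gaussian by the Gaussian transition law adds the variances. At t = T the
  transition variance is 0, so the separate clause in \<open>h_fun\<close> agrees with the general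
  formula.\<close>

lemma h_fun_eq:
  assumes "t \<in> {0..T}" "0 < \<sigma>h"
  shows "h_fun \<theta> g \<mu> T xh \<sigma>h x t = gauss_density (mu_bar \<theta> \<mu> t T x) (\<sigma>h\<^sup>2 + var_bar \<theta> g t T) xh"
proof (cases "t < T")
  case True
  then show ?thesis
    using assms var_bar_nonneg[of t T]
    by (simp add: h_fun_def gou_law_eq_gauss_law integral_gauss_density_gauss_law)
next
  case False
  then have "t = T" using assms by simp
  then show ?thesis
    using T by (simp add: h_fun_def mu_bar_eq var_bar_eq gauss_density_commute[of xh])
qed

lemma h_fun_pos: "t \<in> {0..T} \<Longrightarrow> 0 < \<sigma>h \<Longrightarrow> 0 < h_fun \<theta> g \<mu> T xh \<sigma>h x t"
  using var_bar_nonneg[of t T] by (simp add: h_fun_eq gauss_density_pos add_pos_nonneg)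

lemma mu_bar_compose:
  assumes "0 \<le> t" "t \<le> T"
  shows "mu_bar \<theta> \<mu> t T (mu_bar \<theta> \<mu> 0 t x) = mu_bar \<theta> \<mu> 0 T x"
  using assms by (simp add: mu_bar_eq algebra_simps)

text \<open>Bayes' rule with the reference marginal at t as prior and h as likelihood of
  \<open>xh\<close>. The normalisation h(x0, 0) is exactly the marginal factor, so the posterior
  remains.\<close>

lemma p_h_eq_gauss_density:
  assumes t: "t \<in> {0<..T}" and v: "0 < var_bar \<theta> g 0 t" and \<sigma>h: "0 < \<sigma>h"
  shows "p_h \<theta> g \<mu> T xh \<sigma>h x0 t x =
    gauss_density
      (mu_bar \<theta> \<mu> 0 t x0 +
         (exp (- theta_bar \<theta> t T) * var_bar \<theta> g 0 t / (\<sigma>h\<^sup>2 + var_bar \<theta> g 0 T)) *\<^sub>R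
           (xh - mu_bar \<theta> \<mu> 0 T x0))
      (var_bar \<theta> g 0 t * (\<sigma>h\<^sup>2 + var_bar \<theta> g t T) / (\<sigma>h\<^sup>2 + var_bar \<theta> g 0 T))
      x"
proof -
  define \<kappa> where "\<kappa> = growth t / growth T"
  define D where "D = \<sigma>h\<^sup>2 + var_bar \<theta> g t T"
  have t': "0 \<le> t" "t \<le> T" "t \<in> {0..T}" "0 \<in> {0..T}" using t by auto
  have D: "0 < D" using var_bar_nonneg[of t T] t' \<sigma>h by (simp add: D_def add_pos_nonneg)
  \<comment> \<open>The variance from 0 to T is that from t to T plus the damped variance from 0 to
    t. This makes the variance in h(x0, 0) equal to that of the marginal factor.\<close>
  have r: "\<sigma>h\<^sup>2 + var_bar \<theta> g 0 T = D + \<kappa>\<^sup>2 * var_bar \<theta> g 0 t"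
    unfolding D_def using t' T by (simp add: var_bar_eq \<kappa>_def power_divide diff_divide_distrib)
  have mT: "mu_bar \<theta> \<mu> t T y = \<kappa> *\<^sub>R y + (1 - \<kappa>) *\<^sub>R \<mu>" for y
    using t' by (simp add: mu_bar_eq \<kappa>_def)
  have "p_h \<theta> g \<mu> T xh \<sigma>h x0 t x =
    gauss_density (mu_bar \<theta> \<mu> 0 t x0) (var_bar \<theta> g 0 t) x * gauss_density (\<kappa> *\<^sub>R x + (1 - \<kappa>) *\<^sub>R \<mu>) D xh
      / gauss_density (mu_bar \<theta> \<mu> 0 T x0) (D + \<kappa>\<^sup>2 * var_bar \<theta> g 0 t) xh"
    unfolding p_h_def gou_density_def h_fun_eq[OF t'(3) \<sigma>h] h_fun_eq[OF t'(4) \<sigma>h] r D_def mT ..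
  also have "\<dots> = gauss_density
      (mu_bar \<theta> \<mu> 0 t x0 + (\<kappa> * var_bar \<theta> g 0 t / (D + \<kappa>\<^sup>2 * var_bar \<theta> g 0 t)) *\<^sub>R (xh - mu_bar \<theta> \<mu> 0 T x0))
      (var_bar \<theta> g 0 t * D / (D + \<kappa>\<^sup>2 * var_bar \<theta> g 0 t)) x"
    unfolding gauss_density_mult[OF v D]
    unfolding mT[symmetric] mu_bar_compose[OF t'(1,2)]
    using gauss_density_pos[of "D + \<kappa>\<^sup>2 * var_bar \<theta> g 0 t" "mu_bar \<theta> \<mu> 0 T x0" xh] D v
    by (simp add: add_pos_nonneg)
  finally show ?thesis
    unfolding exp_theta_bar[OF t'(1,2) order_refl] r by (simp add: D_def \<kappa>_def)
qed

text \<open>Up to a constant, ln h is minus a multiple of the squared norm of w, and w is affine in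
  the state with slope - \<kappa>, which is where the factor
  \<open>exp (- theta_bar \<theta> t T)\<close> comes from.\<close>

lemma GDERIV_ln_h_fun:
  assumes "t \<in> {0..T}" "0 < \<sigma>h"
  shows "GDERIV (\<lambda>y. ln (h_fun \<theta> g \<mu> T xh \<sigma>h y t)) x :>
    (exp (- theta_bar \<theta> t T) / (\<sigma>h\<^sup>2 + var_bar \<theta> g t T)) *\<^sub>R (xh - mu_bar \<theta> \<mu> t T x)"
proof -
  define D where "D = \<sigma>h\<^sup>2 + var_bar \<theta> g t T"
  define \<kappa> where "\<kappa> = exp (- theta_bar \<theta> t T)"
  define C where "C = (2 * pi * D) powr (- real DIM('a) / 2)"
  define w where "w y = xh - mu_bar \<theta> \<mu> t T y" for y
  have D: "0 < D" using assms var_bar_nonneg[of t T] by (simp add: D_def add_pos_nonneg)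
  have C: "0 < C" using D by (simp add: C_def)
  have eq: "ln (h_fun \<theta> g \<mu> T xh \<sigma>h y t) = ln C - (w y \<bullet> w y) / (2 * D)" for y
  proof -
    have "h_fun \<theta> g \<mu> T xh \<sigma>h y t = C * exp (- (w y \<bullet> w y) / (2 * D))"
      unfolding h_fun_eq[OF assms] gauss_density_def power2_norm_eq_inner D_def C_def w_def ..
    then show ?thesis
      using C by (simp add: ln_mult)
  qed
  have dw: "(w has_derivative (\<lambda>h. - (\<kappa> *\<^sub>R h))) (at x)"
    unfolding w_def mu_bar_def \<kappa>_def by (auto intro!: derivative_eq_intros)
  have "((\<lambda>y. ln C - (w y \<bullet> w y) / (2 * D)) has_derivative
      (\<lambda>h. - ((w x \<bullet> - (\<kappa> *\<^sub>R h) + - (\<kappa> *\<^sub>R h) \<bullet> w x) / (2 * D)))) (at x)"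
    using D by (auto intro!: derivative_eq_intros dw simp: fun_eq_iff field_simps)
  moreover have "- ((w x \<bullet> - (\<kappa> *\<^sub>R h) + - (\<kappa> *\<^sub>R h) \<bullet> w x) / (2 * D)) = h \<bullet> ((\<kappa> / D) *\<^sub>R w x)" for h
    using D by (simp add: inner_commute[of "w x"] field_simps)
  ultimately show ?thesis
    unfolding gderiv_def eq by (simp add: D_def \<kappa>_def w_def)
qed

section \<open>Laws of the reference process, of its h-transform and of the bridge\<close>

lemma gou_drift_affine: "gou_drift \<theta> \<mu> s x = (- \<theta> s) *\<^sub>R x + \<theta> s *\<^sub>R \<mu>"
  by (simp add: gou_drift_def algebra_simps)

lemma inverse_growth_deriv:
  assumes "s \<in> {0..T}"
  shows "((\<lambda>s. 1 / growth s) has_real_derivative - \<theta> s / growth s) (at s within {0..T})"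
  using growth_deriv[OF assms]
  by (auto intro!: derivative_eq_intros simp: power2_eq_square)

lemma gou_mean_deriv:
  assumes "s \<in> {0..T}"
  shows "((\<lambda>s. mu_bar \<theta> \<mu> 0 s x) has_vector_derivative ((- \<theta> s) *\<^sub>R mu_bar \<theta> \<mu> 0 s x + \<theta> s *\<^sub>R \<mu>)) (at s within {0..T})"
proof -
  have "((\<lambda>s. (1 / growth s) *\<^sub>R x + (1 - 1 / growth s) *\<^sub>R \<mu>) has_vector_derivative
     ((- \<theta> s / growth s) *\<^sub>R x + (0 - (- \<theta> s / growth s)) *\<^sub>R \<mu>)) (at s within {0..T})"
    using inverse_growth_deriv[OF assms]
    by (intro has_vector_derivative_add has_vector_derivative_scaleR_const DERIV_diff DERIV_const)
  moreover have "(- \<theta> s / growth s) *\<^sub>R x + (0 - (- \<theta> s / growth s)) *\<^sub>R \<mu>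
     = (- \<theta> s) *\<^sub>R mu_bar \<theta> \<mu> 0 s x + \<theta> s *\<^sub>R \<mu>"
    using assms by (simp add: mu_bar_eq algebra_simps)
  \<comment> \<open>The explicit form of the mean holds on \<open>{0..T}\<close> only, which is
    enough for derivatives within that interval.\<close>
  moreover have "mu_bar \<theta> \<mu> 0 u x = (1 / growth u) *\<^sub>R x + (1 - 1 / growth u) *\<^sub>R \<mu>" if "u \<in> {0..T}" for u
    using that by (simp add: mu_bar_eq)
  ultimately show ?thesis
    using assms by (auto intro: has_vector_derivative_transform)
qed

lemma gou_joint_law:
  fixes W :: "real \<Rightarrow> 'w \<Rightarrow> 'a::euclidean_space"
  assumes W: "wiener_process M W" and Y: "sde_solution M W T x0 (gou_drift \<theta> \<mu>) g Y"
    and t: "0 \<le> t" "t \<le> T"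
  shows "distr M borel (\<lambda>\<omega>. (Y t \<omega>, Y T \<omega> - mu_bar \<theta> \<mu> t T (Y t \<omega>))) =
    gauss_law (mu_bar \<theta> \<mu> 0 t x0) (var_bar \<theta> g 0 t) \<Otimes>\<^sub>M gauss_law 0 (var_bar \<theta> g t T)"
proof -
  have d\<psi>: "(growth has_real_derivative - (- \<theta> s) * growth s) (at s within {0..T})" if "s \<in> {0..T}" for s
    using growth_deriv[OF that] by simp
  have m0: "mu_bar \<theta> \<mu> 0 0 x0 = x0"
    using T by (simp add: mu_bar_eq)
  have "distr M borel (\<lambda>\<omega>. (Y t \<omega>, Y T \<omega> - mu_bar \<theta> \<mu> 0 T x0 - (growth t / growth T) *\<^sub>R (Y t \<omega> - mu_bar \<theta> \<mu> 0 t x0))) =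
    gauss_law (mu_bar \<theta> \<mu> 0 t x0) (integral {0..t} (\<lambda>u. (growth u)\<^sup>2 * (g u)\<^sup>2) / (growth t)\<^sup>2) \<Otimes>\<^sub>M
    gauss_law 0 (integral {t..T} (\<lambda>u. (growth u)\<^sup>2 * (g u)\<^sup>2) / (growth T)\<^sup>2)"
    by (rule linear_sde_joint_law[where a = "\<lambda>s. - \<theta> s" and c = "\<lambda>s. \<theta> s *\<^sub>R \<mu>" and m = "\<lambda>s. mu_bar \<theta> \<mu> 0 s x0",
        OF W Y gou_drift_affine _ _ cont_g d\<psi> gou_mean_deriv m0 t order_refl])
      (auto intro!: continuous_intros cont_\<theta>)
  \<comment> \<open>By the composition rule for \<open>mu_bar\<close>, the mean at T is
    \<open>mu_bar \<theta> \<mu> t T\<close> of the mean at t, so the initial point drops out of the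
    prediction error.\<close>
  moreover have "Y T \<omega> - mu_bar \<theta> \<mu> 0 T x0 - (growth t / growth T) *\<^sub>R (Y t \<omega> - mu_bar \<theta> \<mu> 0 t x0)
      = Y T \<omega> - mu_bar \<theta> \<mu> t T (Y t \<omega>)" for \<omega>
    unfolding mu_bar_compose[OF t, symmetric] using t by (simp add: mu_bar_eq[of t T] algebra_simps)
  ultimately show ?thesis
    using t T by (simp add: var_bar_eq integral_energy_density)
qed

text \<open>The terminal weight is a function of the state at t plus independent noise. Averaging
  over that noise replaces it by h at time t, which is the martingale property of h along the
  reference process; the remaining weight times the reference marginal is
  \<open>p_h\<close>.\<close>

lemma distributed_h_transform:
  fixes W :: "real \<Rightarrow> 'w \<Rightarrow> 'a::euclidean_space"
  assumes W: "wiener_process M W" and Y: "sde_solution M W T x0 (gou_drift \<theta> \<mu>) g Y"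
    and t: "t \<in> {0<..T}" and v: "0 < var_bar \<theta> g 0 t" and \<sigma>h: "0 < \<sigma>h"
  shows "distributed (h_transform \<theta> g \<mu> T xh \<sigma>h x0 M Y) lborel (Y t) (p_h \<theta> g \<mu> T xh \<sigma>h x0 t)"
proof -
  have t': "0 \<le> t" "t \<le> T" "t \<in> {0..T}" "0 \<in> {0..T}" "T \<in> {0..T}" using t by auto
  have [measurable]: "Y t \<in> borel_measurable M" "Y T \<in> borel_measurable M"
    using Y t' by (auto simp: sde_solution_def)
  define h0 where "h0 = h_fun \<theta> g \<mu> T xh \<sigma>h x0 0"
  have h0: "0 < h0" using h_fun_pos[OF t'(4) \<sigma>h] by (simp add: h0_def)
  let ?q = "gauss_density xh (\<sigma>h\<^sup>2)"
  let ?G = "gauss_law (mu_bar \<theta> \<mu> 0 t x0) (var_bar \<theta> g 0 t)" and ?R = "gauss_law (0::'a) (var_bar \<theta> g t T)"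
  interpret R: prob_space ?R by (rule prob_space_gauss_law)
  have [measurable]: "mu_bar \<theta> \<mu> t T \<in> borel_measurable borel"
    unfolding mu_bar_def by measurable
  have [measurable]: "p_h \<theta> g \<mu> T xh \<sigma>h x0 t \<in> borel_measurable borel"
    unfolding p_h_eq_gauss_density[OF t v \<sigma>h, abs_def] by measurable
  have ht: "h_transform \<theta> g \<mu> T xh \<sigma>h x0 M Y = density M (\<lambda>\<omega>. ennreal (?q (Y T \<omega>) / h0))"
    by (simp add: h_transform_def h_fun_def h0_def)
  have "distr (density M (\<lambda>\<omega>. ennreal (?q (Y T \<omega>) / h0))) lborel (Y t) = density lborel (p_h \<theta> g \<mu> T xh \<sigma>h x0 t)"
  proof (rule measure_eqI)
    fix S assume "S \<in> sets (distr (density M (\<lambda>\<omega>. ennreal (?q (Y T \<omega>) / h0))) lborel (Y t))"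
    then have [measurable]: "S \<in> sets borel" by simp
    have "emeasure (distr (density M (\<lambda>\<omega>. ennreal (?q (Y T \<omega>) / h0))) lborel (Y t)) S
       = (\<integral>\<^sup>+\<omega>. ennreal (?q (Y T \<omega>) / h0) * indicator S (Y t \<omega>) \<partial>M)"
      by (simp add: nn_integral_indicator[symmetric] nn_integral_distr nn_integral_density del: nn_integral_indicator)
    also have "\<dots> = (\<integral>\<^sup>+z. ennreal (?q (mu_bar \<theta> \<mu> t T (fst z) + snd z) / h0) * indicator S (fst z)
        \<partial>distr M (borel \<Otimes>\<^sub>M borel) (\<lambda>\<omega>. (Y t \<omega>, Y T \<omega> - mu_bar \<theta> \<mu> t T (Y t \<omega>))))"
      by (subst nn_integral_distr) simp_all
    also have "\<dots> = (\<integral>\<^sup>+z. ennreal (?q (mu_bar \<theta> \<mu> t T (fst z) + snd z) / h0) * indicator S (fst z) \<partial>(?G \<Otimes>\<^sub>M ?R))"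
      unfolding borel_prod gou_joint_law[OF W Y t'(1,2)] ..
    also have "\<dots> = (\<integral>\<^sup>+y. \<integral>\<^sup>+r. ennreal (?q (mu_bar \<theta> \<mu> t T y + r) / h0) * indicator S y \<partial>?R \<partial>?G)"
      by (subst R.nn_integral_fst[symmetric]) simp_all
    also have "\<dots> = (\<integral>\<^sup>+y. ennreal (h_fun \<theta> g \<mu> T xh \<sigma>h y t / h0) * indicator S y \<partial>?G)"
    proof (rule nn_integral_cong)
      fix y
      \<comment> \<open>Point and mean are swapped so that the noise r appears in the mean, as the
        mixture formula requires.\<close>
      have "(\<integral>\<^sup>+r. ennreal (?q (mu_bar \<theta> \<mu> t T y + r) / h0) * indicator S y \<partial>?R)
         = (\<integral>\<^sup>+r. ennreal (gauss_density (1 *\<^sub>R r + mu_bar \<theta> \<mu> t T y) (\<sigma>h\<^sup>2) xh) * (ennreal (1 / h0) * indicator S y) \<partial>?R)"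
        using h0 by (intro nn_integral_cong)
          (simp add: gauss_density_commute[of xh] add.commute ennreal_mult[symmetric] gauss_density_nonneg mult.assoc[symmetric])
      also have "\<dots> = (\<integral>\<^sup>+r. ennreal (gauss_density (1 *\<^sub>R r + mu_bar \<theta> \<mu> t T y) (\<sigma>h\<^sup>2) xh) \<partial>?R) * (ennreal (1 / h0) * indicator S y)"
        by (rule nn_integral_multc) (simp add: gauss_density_def)
      also have "\<dots> = ennreal (h_fun \<theta> g \<mu> T xh \<sigma>h y t) * (ennreal (1 / h0) * indicator S y)"
        using nn_integral_gauss_density_gauss_law[OF var_bar_nonneg[OF t'(1,2) order_refl], where s = "\<sigma>h\<^sup>2" and \<kappa> = 1 and b = "mu_bar \<theta> \<mu> t T y" and y = xh and m = 0] \<sigma>h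
        by (simp add: h_fun_eq[OF t'(3) \<sigma>h])
      also have "\<dots> = ennreal (h_fun \<theta> g \<mu> T xh \<sigma>h y t / h0) * indicator S y"
        using h0 h_fun_pos[OF t'(3) \<sigma>h, of \<mu> xh y]
        by (simp add: mult.assoc[symmetric] ennreal_mult[symmetric])
      finally show "(\<integral>\<^sup>+r. ennreal (?q (mu_bar \<theta> \<mu> t T y + r) / h0) * indicator S y \<partial>?R)
        = ennreal (h_fun \<theta> g \<mu> T xh \<sigma>h y t / h0) * indicator S y" .
    qed
    also have "\<dots> = (\<integral>\<^sup>+y. ennreal (p_h \<theta> g \<mu> T xh \<sigma>h x0 t y) * indicator S y \<partial>lborel)"
    proof -
      have [measurable]: "(\<lambda>y. h_fun \<theta> g \<mu> T xh \<sigma>h y t) \<in> borel_measurable borel"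
        unfolding h_fun_eq[OF t'(3) \<sigma>h] gauss_density_commute[of _ _ xh] by measurable
      show ?thesis
        using v h0 h_fun_pos[OF t'(3) \<sigma>h, of \<mu> xh]
        by (simp add: gauss_law_eq_density nn_integral_density p_h_def gou_density_def h0_def[symmetric]
            mult.assoc[symmetric] ennreal_mult[symmetric] gauss_density_nonneg less_imp_le)
    qed
    also have "\<dots> = emeasure (density lborel (p_h \<theta> g \<mu> T xh \<sigma>h x0 t)) S"
      by (simp add: emeasure_density)
    finally show "emeasure (distr (density M (\<lambda>\<omega>. ennreal (?q (Y T \<omega>) / h0))) lborel (Y t)) S
       = emeasure (density lborel (p_h \<theta> g \<mu> T xh \<sigma>h x0 t)) S" .
  qed simp
  then show ?thesis
    unfolding ht by (simp add: distributed_def)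
qed

text \<open>The bridge drift is itself affine in the state, so the law follows from the linear
  theory alone, without a change of measure. The task is to exhibit integrating factor and mean in
  closed form.\<close>

lemma distributed_bridge:
  fixes W :: "real \<Rightarrow> 'w \<Rightarrow> 'a::euclidean_space"
  assumes W: "wiener_process M W" and X: "sde_solution M W T x0 (bridge_drift \<theta> g \<mu> T xh \<sigma>h) g X"
    and t: "t \<in> {0<..T}" and v: "0 < var_bar \<theta> g 0 t" and \<sigma>h: "0 < \<sigma>h"
  shows "distributed M lborel (X t) (p_h \<theta> g \<mu> T xh \<sigma>h x0 t)"
proof -
  have t': "0 \<le> t" "t \<le> T" "t \<in> {0..T}" "0 \<in> {0..T}" using t by auto
  have Xt [measurable]: "X t \<in> borel_measurable M"
    using X t' by (auto simp: sde_solution_def)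
  \<comment> \<open>D is the variance of the Gaussian h(., s), w the miss of the undisturbed mean at
    time T, and \<open>\<beta>\<close> the gain with which the drift corrects a predicted
    miss.\<close>
  define D where "D s = \<sigma>h\<^sup>2 + (energy T - energy s) / (growth T)\<^sup>2" for s
  define w where "w = xh - mu_bar \<theta> \<mu> 0 T x0"
  define \<beta> where "\<beta> s = (g s)\<^sup>2 * (growth s / growth T) / D s" for s
  define a where "a s = - \<theta> s - \<beta> s * (growth s / growth T)" for s
  define c where "c s = \<theta> s *\<^sub>R \<mu> + \<beta> s *\<^sub>R (xh - (1 - growth s / growth T) *\<^sub>R \<mu>)" for s
  \<comment> \<open>proportional to the inverse of the fundamental solution, since a = - \<theta> + D' / D\<close>
  define \<psi> where "\<psi> s = growth s / D s" for s
  \<comment> \<open>The mean of the claimed Gaussian: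
    \<open>energy s / (growth s * growth T)\<close> is
    \<open>exp (- theta_bar \<theta> s T) * var_bar \<theta> g 0 s\<close>. It starts at x0 because
    \<open>energy 0 = 0\<close>.\<close>
  define m where "m s = mu_bar \<theta> \<mu> 0 s x0 + (energy s / growth s / (growth T * D 0)) *\<^sub>R w" for s
  have D: "0 < D s" if "s \<in> {0..T}" for s
    using energy_mono[of s T] that \<sigma>h by (auto simp: D_def intro!: add_pos_nonneg)
  have D': "D s = \<sigma>h\<^sup>2 + var_bar \<theta> g s T" if "s \<in> {0..T}" for s
    using that by (simp add: D_def var_bar_eq)
  have dD: "(D has_real_derivative - ((growth s)\<^sup>2 * (g s)\<^sup>2) / (growth T)\<^sup>2) (at s within {0..T})" if "s \<in> {0..T}" for s
  proof -
    have "(D has_real_derivative 0 + (0 - (growth s)\<^sup>2 * (g s)\<^sup>2) / (growth T)\<^sup>2) (at s within {0..T})"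
      unfolding D_def by (intro DERIV_add DERIV_cdivide DERIV_diff DERIV_const energy_deriv that)
    then show ?thesis by simp
  qed
  have cont_D: "continuous_on {0..T} D"
    using dD by (rule DERIV_continuous_on)
  have cont_\<beta>: "continuous_on {0..T} \<beta>"
    unfolding \<beta>_def using D by (intro continuous_intros cont_g cont_growth cont_D) force+
  have drift: "bridge_drift \<theta> g \<mu> T xh \<sigma>h s x = a s *\<^sub>R x + c s" if s: "s \<in> {0..T}" for s x
  proof -
    have "(g s)\<^sup>2 * exp (- theta_bar \<theta> s T) / (\<sigma>h\<^sup>2 + var_bar \<theta> g s T) = \<beta> s"
      using s by (simp add: \<beta>_def D' exp_theta_bar)
    then have "bridge_drift \<theta> g \<mu> T xh \<sigma>h s x
       = \<theta> s *\<^sub>R (\<mu> - x) + \<beta> s *\<^sub>R (xh - ((growth s / growth T) *\<^sub>R x + (1 - growth s / growth T) *\<^sub>R \<mu>))"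
      using s by (simp add: bridge_drift_def mu_bar_eq)
    also have "\<dots> = a s *\<^sub>R x + c s"
      by (simp add: a_def c_def scaleR_add_left scaleR_add_right scaleR_diff_left scaleR_diff_right)
    finally show ?thesis .
  qed
  have d\<psi>: "(\<psi> has_real_derivative - a s * \<psi> s) (at s within {0..T})" if s: "s \<in> {0..T}" for s
  proof -
    have "(\<psi> has_real_derivative (\<theta> s * growth s * D s - growth s * (- ((growth s)\<^sup>2 * (g s)\<^sup>2) / (growth T)\<^sup>2)) / (D s * D s))
      (at s within {0..T})"
      unfolding \<psi>_def using D[OF s] by (intro DERIV_divide growth_deriv dD s) simp
    moreover have "(\<theta> s * growth s * D s - growth s * (- ((growth s)\<^sup>2 * (g s)\<^sup>2) / (growth T)\<^sup>2)) / (D s * D s) = - a s * \<psi> s"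
      using D[OF s] by (simp add: a_def \<psi>_def \<beta>_def field_simps power2_eq_square)
    ultimately show ?thesis by simp
  qed
  have dm: "(m has_vector_derivative (a s *\<^sub>R m s + c s)) (at s within {0..T})" if s: "s \<in> {0..T}" for s
  proof -
    define k where "k s = energy s / growth s / (growth T * D 0)" for s
    have "((\<lambda>s. energy s / growth s / (growth T * D 0)) has_real_derivative
        ((growth s)\<^sup>2 * (g s)\<^sup>2 * growth s - energy s * (\<theta> s * growth s)) / (growth s * growth s) / (growth T * D 0)) (at s within {0..T})"
      by (intro DERIV_cdivide DERIV_divide energy_deriv growth_deriv s) simp
    moreover have "((growth s)\<^sup>2 * (g s)\<^sup>2 * growth s - energy s * (\<theta> s * growth s)) / (growth s * growth s) / (growth T * D 0)
       = (g s)\<^sup>2 * (growth s / growth T) / D 0 - \<theta> s * k s"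
      using D[OF t'(4)] by (simp add: k_def field_simps power2_eq_square)
    ultimately have dk: "(k has_real_derivative (g s)\<^sup>2 * (growth s / growth T) / D 0 - \<theta> s * k s) (at s within {0..T})"
      by (simp add: k_def[abs_def])
    have "(m has_vector_derivative ((- \<theta> s) *\<^sub>R mu_bar \<theta> \<mu> 0 s x0 + \<theta> s *\<^sub>R \<mu>
        + ((g s)\<^sup>2 * (growth s / growth T) / D 0 - \<theta> s * k s) *\<^sub>R w)) (at s within {0..T})"
      unfolding m_def k_def[symmetric]
      by (intro has_vector_derivative_add gou_mean_deriv has_vector_derivative_scaleR_const dk s)
    moreover have "a s *\<^sub>R m s + c s = (- \<theta> s) *\<^sub>R mu_bar \<theta> \<mu> 0 s x0 + \<theta> s *\<^sub>R \<mu>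
        + ((g s)\<^sup>2 * (growth s / growth T) / D 0 - \<theta> s * k s) *\<^sub>R w"
    proof -
      have ms: "m s = mu_bar \<theta> \<mu> 0 s x0 + k s *\<^sub>R w"
        by (simp add: m_def k_def)
      \<comment> \<open>Along m the predicted miss at T shrinks proportionally to D, from w at time
        0. Hence the factor D s of the miss cancels the one in \<open>\<beta> s\<close>, and the
        correction term is explicit.\<close>
      have "mu_bar \<theta> \<mu> s T (m s) = mu_bar \<theta> \<mu> s T (mu_bar \<theta> \<mu> 0 s x0) + ((growth s / growth T) * k s) *\<^sub>R w"
        unfolding ms using s by (simp add: mu_bar_eq[of s T] scaleR_add_right)
      also have "mu_bar \<theta> \<mu> s T (mu_bar \<theta> \<mu> 0 s x0) = xh - w"
        using s by (simp add: mu_bar_compose w_def)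
      finally have "xh - mu_bar \<theta> \<mu> s T (m s) = w - ((growth s / growth T) * k s) *\<^sub>R w"
        by simp
      also have "\<dots> = (D s / D 0) *\<^sub>R w"
      proof -
        have "(growth s / growth T) * k s = energy s / (growth T)\<^sup>2 / D 0"
          by (simp add: k_def power2_eq_square)
        also have "energy s / (growth T)\<^sup>2 = D 0 - D s"
          by (simp add: D_def diff_divide_distrib)
        finally have "1 - (growth s / growth T) * k s = D s / D 0"
          using D[OF t'(4)] by (simp add: field_simps)
        then show ?thesis by (metis scaleR_left_diff_distrib scaleR_one)
      qed
      finally have e: "xh - mu_bar \<theta> \<mu> s T (m s) = (D s / D 0) *\<^sub>R w" .
      have "a s *\<^sub>R m s + c s = \<theta> s *\<^sub>R (\<mu> - m s) + \<beta> s *\<^sub>R (xh - mu_bar \<theta> \<mu> s T (m s))"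
        using s by (simp add: a_def c_def mu_bar_eq[of s T] scaleR_add_left scaleR_add_right scaleR_diff_left scaleR_diff_right)
      also have "\<beta> s *\<^sub>R (xh - mu_bar \<theta> \<mu> s T (m s)) = ((g s)\<^sup>2 * (growth s / growth T) / D 0) *\<^sub>R w"
        unfolding e using D[OF s] by (simp add: \<beta>_def)
      also have "\<theta> s *\<^sub>R (\<mu> - m s) + ((g s)\<^sup>2 * (growth s / growth T) / D 0) *\<^sub>R w
         = (- \<theta> s) *\<^sub>R mu_bar \<theta> \<mu> 0 s x0 + \<theta> s *\<^sub>R \<mu>
           + ((g s)\<^sup>2 * (growth s / growth T) / D 0 - \<theta> s * k s) *\<^sub>R w"
        unfolding ms by (simp add: algebra_simps)
      finally show ?thesis .
    qed
    ultimately show ?thesis by simp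
  qed
  have m0: "m 0 = x0"
    using T by (simp add: m_def mu_bar_eq)
  have \<psi>t: "\<psi> t \<noteq> 0" using D[OF t'(3)] by (simp add: \<psi>_def)
  \<comment> \<open>Since D' is - growth^2 g^2 / (growth T)^2, the integrand growth^2 g^2 / D^2 is
    the derivative of (growth T)^2 / D.\<close>
  have J: "((\<lambda>u. (\<psi> u)\<^sup>2 * (g u)\<^sup>2) has_integral ((growth T)\<^sup>2 / D t - (growth T)\<^sup>2 / D 0)) {0..t}"
  proof (rule fundamental_theorem_of_calculus[OF t'(1)])
    fix s assume "s \<in> {0..t}"
    then have s: "s \<in> {0..T}" using t' by auto
    have "((\<lambda>s. (growth T)\<^sup>2 / D s) has_real_derivative
       (0 * D s - (growth T)\<^sup>2 * (- ((growth s)\<^sup>2 * (g s)\<^sup>2) / (growth T)\<^sup>2)) / (D s * D s)) (at s within {0..T})"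
      using D[OF s] by (intro DERIV_divide DERIV_const dD s) simp
    moreover have "(0 * D s - (growth T)\<^sup>2 * (- ((growth s)\<^sup>2 * (g s)\<^sup>2) / (growth T)\<^sup>2)) / (D s * D s) = (\<psi> s)\<^sup>2 * (g s)\<^sup>2"
      by (simp add: \<psi>_def power_divide power2_eq_square)
    ultimately have "((\<lambda>s. (growth T)\<^sup>2 / D s) has_real_derivative (\<psi> s)\<^sup>2 * (g s)\<^sup>2) (at s within {0..T})"
      by simp
    then show "((\<lambda>s. (growth T)\<^sup>2 / D s) has_vector_derivative (\<psi> s)\<^sup>2 * (g s)\<^sup>2) (at s within {0..t})"
      using t' by (auto simp: has_real_derivative_iff_has_vector_derivative[symmetric] intro: has_field_derivative_subset)
  qed
  have "distr M borel (X t) = gauss_law (m t) (integral {0..t} (\<lambda>u. (\<psi> u)\<^sup>2 * (g u)\<^sup>2) / (\<psi> t)\<^sup>2)"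
    by (rule linear_sde_marginal_law[OF W X drift _ _ cont_g d\<psi> dm m0 t'(1,2) \<psi>t])
      (auto simp: a_def c_def intro!: continuous_intros cont_\<theta> cont_\<beta> cont_growth)
  also have "integral {0..t} (\<lambda>u. (\<psi> u)\<^sup>2 * (g u)\<^sup>2) / (\<psi> t)\<^sup>2 = var_bar \<theta> g 0 t * D t / D 0"
  proof -
    \<comment> \<open>Inverting the definition of D expresses the variance up to t through D 0 - D
      t, which is what the integral produces.\<close>
    have e: "energy t = (growth T)\<^sup>2 * (D 0 - D t)"
      by (simp add: D_def field_simps)
    have "integral {0..t} (\<lambda>u. (\<psi> u)\<^sup>2 * (g u)\<^sup>2) / (\<psi> t)\<^sup>2
       = ((growth T)\<^sup>2 / D t - (growth T)\<^sup>2 / D 0) / (growth t / D t)\<^sup>2"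
      using J by (simp add: integral_unique \<psi>_def)
    also have "\<dots> = (growth T)\<^sup>2 * (D 0 - D t) / (growth t)\<^sup>2 * D t / D 0"
      using D[OF t'(3)] D[OF t'(4)] by (simp add: field_simps power2_eq_square)
    finally show ?thesis
      using t' by (simp add: var_bar_eq e)
  qed
  also have "m t = mu_bar \<theta> \<mu> 0 t x0 + (exp (- theta_bar \<theta> t T) * var_bar \<theta> g 0 t / D 0) *\<^sub>R w"
  proof -
    have "energy t / growth t / (growth T * D 0) = exp (- theta_bar \<theta> t T) * var_bar \<theta> g 0 t / D 0"
      using t' by (simp add: exp_theta_bar var_bar_eq power2_eq_square)
    then show ?thesis by (simp add: m_def)
  qed
  also have "gauss_law \<dots> (var_bar \<theta> g 0 t * D t / D 0) = density lborel (p_h \<theta> g \<mu> T xh \<sigma>h x0 t)"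
    using D[OF t'(3)] D[OF t'(4)] v
    by (subst gauss_law_eq_density) (simp_all add: p_h_eq_gauss_density[OF t v \<sigma>h] D'[OF t'(3)] D'[OF t'(4)] w_def)
  finally have "distr M lborel (X t) = density lborel (p_h \<theta> g \<mu> T xh \<sigma>h x0 t)"
    by (simp cong: distr_cong)
  moreover have "p_h \<theta> g \<mu> T xh \<sigma>h x0 t \<in> borel_measurable borel"
    unfolding p_h_eq_gauss_density[OF t v \<sigma>h, abs_def] by measurable
  ultimately show ?thesis
    by (simp add: distributed_def)
qed

end

theorem proposition3p4:
  fixes \<theta> g :: "real \<Rightarrow> real" and \<mu> xh x0 :: "real ^ 'd" and T \<sigma>h :: real
    and M :: "'w measure" and W X Y :: "real \<Rightarrow> 'w \<Rightarrow> real ^ 'd"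
  assumes "0 < T"
    and "continuous_on {0..T} \<theta>" and "\<forall>t\<in>{0..T}. 0 < \<theta> t"
    and "continuous_on {0..T} g"
    and "\<forall>t\<in>{0<..T}. 0 < var_bar \<theta> g 0 t"
    and "0 < \<sigma>h"
  shows
    \<comment> \<open>the displayed SDE is the h-transform of the reference SDE\<close>
    "(\<forall>t\<in>{0..T}. \<forall>x. \<exists>G. GDERIV (\<lambda>y. ln (h_fun \<theta> g \<mu> T xh \<sigma>h y t)) x :> G \<and>
        bridge_drift \<theta> g \<mu> T xh \<sigma>h t x = gou_drift \<theta> \<mu> t x + (g t)\<^sup>2 *\<^sub>R G) \<and>
    \<comment> \<open>\<open>p_h\<close> is the time-t marginal density of the process governed by the displayed SDE\<close>
     (wiener_process M W \<and> sde_solution M W T x0 (bridge_drift \<theta> g \<mu> T xh \<sigma>h) g X \<longrightarrow>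
        (\<forall>t\<in>{0<..T}. distributed M lborel (X t) (p_h \<theta> g \<mu> T xh \<sigma>h x0 t))) \<and>
    \<comment> \<open>\<open>p_h\<close> is the time-t marginal density of the h-transformed path measure\<close>
     (wiener_process M W \<and> sde_solution M W T x0 (gou_drift \<theta> \<mu>) g Y \<longrightarrow>
        (\<forall>t\<in>{0<..T}. distributed (h_transform \<theta> g \<mu> T xh \<sigma>h x0 M Y) lborel (Y t)
           (p_h \<theta> g \<mu> T xh \<sigma>h x0 t))) \<and>
    \<comment> \<open>its closed form\<close>
     (\<forall>t\<in>{0<..T}. \<forall>x. p_h \<theta> g \<mu> T xh \<sigma>h x0 t x =
        gauss_density
          (mu_bar \<theta> \<mu> 0 t x0 +
             (exp (- theta_bar \<theta> t T) * var_bar \<theta> g 0 t / (\<sigma>h\<^sup>2 + var_bar \<theta> g 0 T)) *\<^sub>R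
               (xh - mu_bar \<theta> \<mu> 0 T x0))
          (var_bar \<theta> g 0 t * (\<sigma>h\<^sup>2 + var_bar \<theta> g t T) / (\<sigma>h\<^sup>2 + var_bar \<theta> g 0 T))
          x)"
proof -
  interpret gou_coefficients \<theta> g T
    using assms by unfold_locales
  have v: "0 < var_bar \<theta> g 0 t" if "t \<in> {0<..T}" for t
    using assms(5) that by blast
  \<comment> \<open>The vector multiplied by the square of g is the gradient of ln h, so it serves
    as the witness G.\<close>
  have "bridge_drift \<theta> g \<mu> T xh \<sigma>h t x = gou_drift \<theta> \<mu> t x + (g t)\<^sup>2 *\<^sub>R
      ((exp (- theta_bar \<theta> t T) / (\<sigma>h\<^sup>2 + var_bar \<theta> g t T)) *\<^sub>R (xh - mu_bar \<theta> \<mu> t T x))" for t x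
    by (simp add: bridge_drift_def gou_drift_def)
  with GDERIV_ln_h_fun[OF _ assms(6)] show ?thesis
    by (intro conjI ballI allI impI)
      (blast, auto intro!: distributed_bridge distributed_h_transform p_h_eq_gauss_density v assms(6))
qed

end
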